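(* Let $M$ be a closed manifold equipped with a Riemannian metric, and let $\mathbf{K}_M$ be a compact subset of the space of probability measures on $\mathrm{Diff}^1(M)$. Assume that (log-moment condition) for every $\mu\in\mathbf{K}_M$ one has $\int_{\mathrm{Diff}^1(M)}\log\mathcal{N}(f)\,d\mu(f)<\infty$; (measures condition) for every $\mu\in\mathbf{K}_M$ there are no Borel probability measures $\nu_1,\nu_2$ on $M$ such that $f_*\nu_1=\nu_2$ for $\mu$-almost every $f\in\mathrm{Diff}^1(M)$. Then there exists $\mathbf{h}>0$ such that for any $n\in\mathbb{N}$ and any $\mu_1,\dots,\mu_n\in\mathbf{K}_M$ one has $$\mathbb{E}\log\mathcal{N}(F_n)\ge n\,\mathbf{h},$$ where $F_n=f_n\circ\dots\circ f_1$ and the $f_i$ are chosen independently, $f_i$ having distribution $\mu_i$, the expectation being over $\mu_1\times\dots\times\mu_n$. In particular, for any sequence $(\mu_i)_{i\in\mathbb{N}}$ with $\mu_i\in\mathbf{K}_M$ one has $$\liminf_{n\to\infty}\frac1n\,\mathbb{E}\log\mathcal{N}(F_n)\ge\mathbf{h}>0,$$ where the expectation is taken with respect to the infinite product measure $\prod_i\mu_i$.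
   Context: $\mathrm{Diff}^1(M)$ is the group of $C^1$-diffeomorphisms of $M$ with the $C^1$ topology; the space of probability measures on it is equipped with the topology of weak-$*$ (weak) convergence. $\mathrm{Leb}_M$ is the Lebesgue (Riemannian volume) measure on $M$; $\mathrm{Jac}(f)|_x=|\det df|_x|$ is the Jacobian computed with respect to the Riemannian metric; and the maximum volume contraction rate is $$\mathcal{N}(f)=\max_{x\in M}\mathrm{Jac}(f)|_x^{-1}=\max_{x\in M}\frac{d f_*\mathrm{Leb}_M}{d\mathrm{Leb}_M}(x).$$ *)

theory Defs
  imports "HOL-Analysis.Analysis" "HOL-Probability.Probability"
begin

text \<open>Only meant for open \<open>S\<close>. In finite dimension, \<open>C\<^sup>k\<^sup>+\<^sup>1\<close> means differentiable with all
  directional derivatives of class \<open>C\<^sup>k\<close>.\<close>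

primrec Ck_on :: "nat \<Rightarrow> 'a::euclidean_space set \<Rightarrow> ('a \<Rightarrow> 'b::euclidean_space) \<Rightarrow> bool" where
  "Ck_on 0 S f \<longleftrightarrow> continuous_on S f"
| "Ck_on (Suc k) S f \<longleftrightarrow>
     (\<forall>x\<in>S. f differentiable (at x)) \<and> (\<forall>v. Ck_on k S (\<lambda>x. frechet_derivative f (at x) v))"

definition smooth_on :: "'a::euclidean_space set \<Rightarrow> ('a \<Rightarrow> 'b::euclidean_space) \<Rightarrow> bool" where
  "smooth_on S f \<longleftrightarrow> (\<forall>k. Ck_on k S f)"

text \<open>The manifold is the whole type \<open>'m\<close>; its dimension is \<open>CARD('n)\<close>. A chart is a pair
  \<open>(U, \<phi>)\<close> of a domain and a coordinate map; values of \<open>\<phi>\<close> outside \<open>U\<close> are irrelevant.\<close>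

type_synonym ('m, 'n) chart = "'m set \<times> ('m \<Rightarrow> real^'n)"

definition chart_inv :: "('m, 'n) chart \<Rightarrow> real^'n \<Rightarrow> 'm" where
  "chart_inv c = inv_into (fst c) (snd c)"

definition is_chart :: "('m::topological_space, 'n::finite) chart \<Rightarrow> bool" where
  "is_chart c \<longleftrightarrow> open (fst c) \<and> open (snd c ` fst c) \<and>
     homeomorphism (fst c) (snd c ` fst c) (snd c) (chart_inv c)"

definition local_rep ::
    "('m, 'n) chart \<Rightarrow> ('m, 'n) chart \<Rightarrow> ('m \<Rightarrow> 'm) \<Rightarrow> real^'n \<Rightarrow> real^'n" where
  "local_rep c d f = snd d \<circ> f \<circ> chart_inv c"

definition local_deriv ::
    "('m, 'n::finite) chart \<Rightarrow> ('m, 'n) chart \<Rightarrow> ('m \<Rightarrow> 'm) \<Rightarrow> 'm \<Rightarrow> real^'n \<Rightarrow> real^'n" where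
  "local_deriv c d f p = frechet_derivative (local_rep c d f) (at (snd c p))"

definition smooth_atlas :: "('m::topological_space, 'n::finite) chart set \<Rightarrow> bool" where
  "smooth_atlas A \<longleftrightarrow> (\<forall>c\<in>A. is_chart c) \<and> (\<Union>c\<in>A. fst c) = UNIV \<and>
     (\<forall>c\<in>A. \<forall>d\<in>A. smooth_on (snd c ` (fst c \<inter> fst d)) (local_rep c d id))"

text \<open>A Riemannian metric is given by its Gram matrices \<open>G c p\<close> in the coordinates of each
  chart \<open>c\<close> at \<open>p\<close>; the last conjunct says that they define one inner product on the tangent
  space at \<open>p\<close>.\<close>

definition riemannian_metric :: "('m::topological_space, 'n::finite) chart set \<Rightarrow>
    (('m, 'n) chart \<Rightarrow> 'm \<Rightarrow> real^'n^'n) \<Rightarrow> bool" where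
  "riemannian_metric A G \<longleftrightarrow>
     (\<forall>c\<in>A. \<forall>p\<in>fst c. transpose (G c p) = G c p \<and> (\<forall>v. v \<noteq> 0 \<longrightarrow> v \<bullet> (G c p *v v) > 0)) \<and>
     (\<forall>c\<in>A. smooth_on (snd c ` fst c) (\<lambda>x. G c (chart_inv c x))) \<and>
     (\<forall>c\<in>A. \<forall>d\<in>A. \<forall>p\<in>fst c \<inter> fst d. \<forall>u v.
        u \<bullet> (G c p *v v) = local_deriv c d id p u \<bullet> (G d p *v local_deriv c d id p v))"

definition closed_riemannian_manifold ::
    "('m::{t2_space, second_countable_topology}, 'n::finite) chart set \<Rightarrow>
     (('m, 'n) chart \<Rightarrow> 'm \<Rightarrow> real^'n^'n) \<Rightarrow> bool" where
  "closed_riemannian_manifold A G \<longleftrightarrow>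
     compact (UNIV :: 'm set) \<and> smooth_atlas A \<and> riemannian_metric A G"

definition C1_map :: "('m::topological_space, 'n::finite) chart set \<Rightarrow> ('m \<Rightarrow> 'm) \<Rightarrow> bool" where
  "C1_map A f \<longleftrightarrow> continuous_on UNIV f \<and>
     (\<forall>c\<in>A. \<forall>d\<in>A. Ck_on 1 (snd c ` (fst c \<inter> f -` fst d)) (local_rep c d f))"

definition Diff1 :: "('m::topological_space, 'n::finite) chart set \<Rightarrow> ('m \<Rightarrow> 'm) set" where
  "Diff1 A = {f. bij f \<and> C1_map A f \<and> C1_map A (inv f)}"

text \<open>The usual subbasis of the \<open>C\<^sup>1\<close> topology on \<open>C\<^sup>1(M, M)\<close>: closeness of local representatives
  and of their derivatives on a compact part of a chart domain.\<close>

definition C1_nbhd :: "('m::topological_space, 'n::finite) chart set \<Rightarrow> ('m \<Rightarrow> 'm) \<Rightarrow>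
    ('m, 'n) chart \<Rightarrow> ('m, 'n) chart \<Rightarrow> 'm set \<Rightarrow> real \<Rightarrow> ('m \<Rightarrow> 'm) set" where
  "C1_nbhd A f c d C e = {g. C1_map A g \<and> g ` C \<subseteq> fst d \<and>
     (\<forall>p\<in>C. norm (snd d (g p) - snd d (f p)) < e \<and>
            onorm (\<lambda>v. local_deriv c d g p v - local_deriv c d f p v) < e)}"

definition C1_topology :: "('m::topological_space, 'n::finite) chart set \<Rightarrow> ('m \<Rightarrow> 'm) topology" where
  "C1_topology A = topology_generated_by
     {C1_nbhd A f c d C e | f c d C e. C1_map A f \<and> c \<in> A \<and> d \<in> A \<and> compact C \<and>
        C \<subseteq> fst c \<and> f ` C \<subseteq> fst d \<and> e > 0}"

definition Diff1_topology :: "('m::topological_space, 'n::finite) chart set \<Rightarrow> ('m \<Rightarrow> 'm) topology" where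
  "Diff1_topology A = subtopology (C1_topology A) (Diff1 A)"

definition borel_of :: "'a topology \<Rightarrow> 'a measure" where
  "borel_of X = sigma (topspace X) {U. openin X U}"

definition borel_prob_measures :: "'a topology \<Rightarrow> 'a measure set" where
  "borel_prob_measures X = {\<mu>. prob_space \<mu> \<and> sets \<mu> = sets (borel_of X)}"

text \<open>The coarsest topology making \<open>\<mu> \<mapsto> \<integral> \<phi> d\<mu>\<close> continuous for every bounded continuous
  \<open>\<phi>\<close>.\<close>

definition weak_topology :: "'a topology \<Rightarrow> 'a measure topology" where
  "weak_topology X = topology_generated_by
     {{\<mu> \<in> borel_prob_measures X. (\<integral>x. \<phi> x \<partial>\<mu>) \<in> U} | \<phi> U.
        continuous_map X euclideanreal \<phi> \<and> bounded (\<phi> ` topspace X) \<and> open U}"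

definition chart_at :: "('m, 'n) chart set \<Rightarrow> 'm \<Rightarrow> ('m, 'n) chart" where
  "chart_at A p = (SOME c. c \<in> A \<and> p \<in> fst c)"

text \<open>The absolute value of the determinant of \<open>df\<close> at \<open>p\<close> with respect to the inner products at
  \<open>p\<close> and \<open>f p\<close>, written in coordinates. By the transformation rule in \<open>riemannian_metric\<close>,
  the value does not depend on the choice of charts.\<close>

definition Jac :: "('m, 'n::finite) chart set \<Rightarrow> (('m, 'n) chart \<Rightarrow> 'm \<Rightarrow> real^'n^'n) \<Rightarrow>
    ('m \<Rightarrow> 'm) \<Rightarrow> 'm \<Rightarrow> real" where
  "Jac A G f p = (let c = chart_at A p; d = chart_at A (f p) in
     sqrt (det (G d (f p))) / sqrt (det (G c p)) * \<bar>det (matrix (local_deriv c d f p))\<bar>)"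

text \<open>The coordinate formula is the usual determinant in orthonormal frames: the columns of \<open>E\<close>
  and \<open>E'\<close> are orthonormal for the inner products with Gram matrices \<open>P\<close> and \<open>Q\<close>.\<close>

lemma abs_det_orthonormal_frames:
  fixes P Q E E' D :: "real^'n::finite^'n"
  assumes P: "transpose E ** P ** E = mat 1" and Q: "transpose E' ** Q ** E' = mat 1"
  shows "\<bar>det (matrix_inv E' ** D ** E)\<bar> = sqrt (det Q) / sqrt (det P) * \<bar>det D\<bar>"
proof -
  have p: "(det E)\<^sup>2 * det P = 1" and q: "(det E')\<^sup>2 * det Q = 1"
    using arg_cong[OF P, of det] arg_cong[OF Q, of det]
    by (simp_all add: det_mul power2_eq_square mult_ac)
  have nz: "det E \<noteq> 0" "det E' \<noteq> 0"
    using p q by auto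
  then have "invertible E'"
    by (simp add: invertible_det_nz)
  then have "matrix_inv E' ** E' = mat 1"
    unfolding invertible_def matrix_inv_def by (rule someI2_ex) simp
  from arg_cong[OF this, of det] have i: "det (matrix_inv E') * det E' = 1"
    by (simp add: det_mul)
  have P': "sqrt (det P) = 1 / \<bar>det E\<bar>" and Q': "sqrt (det Q) = 1 / \<bar>det E'\<bar>"
    using arg_cong[OF p, of sqrt] arg_cong[OF q, of sqrt] nz
    by (simp_all add: real_sqrt_mult field_simps)
  have "det (matrix_inv E') = 1 / det E'"
    using i nz by (simp add: field_simps)
  then show ?thesis
    by (simp add: det_mul abs_mult P' Q')
qed

text \<open>For a \<open>C\<^sup>1\<close>-diffeomorphism of a closed manifold the function below is continuous on a
  compact space, so the supremum is a maximum.\<close>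

definition max_contraction :: "('m, 'n::finite) chart set \<Rightarrow>
    (('m, 'n) chart \<Rightarrow> 'm \<Rightarrow> real^'n^'n) \<Rightarrow> ('m \<Rightarrow> 'm) \<Rightarrow> real" where
  "max_contraction A G f = (SUP p. inverse (Jac A G f p))"

text \<open>Factors are indexed from \<open>0\<close>: \<open>rand_comp n \<omega> = \<omega> (n - 1) \<circ> \<dots> \<circ> \<omega> 0\<close>.\<close>

primrec rand_comp :: "nat \<Rightarrow> (nat \<Rightarrow> 'm \<Rightarrow> 'm) \<Rightarrow> 'm \<Rightarrow> 'm" where
  "rand_comp 0 \<omega> = id"
| "rand_comp (Suc n) \<omega> = \<omega> n \<circ> rand_comp n \<omega>"

end

theory Submission
  imports Defs
begin

text \<open>
  Let \<open>m\<close> be the normalized Riemannian volume, and start the composition at a random point \<open>x\<close> with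
  law \<open>m\<close>. The density of the image of \<open>m\<close> under \<open>F\<close> is at most \<open>max_contraction A G F\<close>, so
  \<open>ln (max_contraction A G F)\<close> is at least the relative entropy of this image with respect to \<open>m\<close>. In
  the mean over \<open>F = rand_comp n \<omega>\<close>, this entropy is at least the information about the maps that is
  carried by the end point \<open>F x\<close>, and this information adds up along the composition: a step with
  random map \<open>f\<close> contributes what \<open>f z\<close> tells about \<open>f\<close>, where \<open>z\<close> has the law \<open>\<nu>\<close> of the point reached so
  far. The contribution vanishes only if the image of \<open>\<nu>\<close> under \<open>f\<close> is almost surely the same
  measure, which the measures condition excludes; by compactness it is bounded below.

  The proof replaces the entropies by explicit densities. Let \<open>\<phi>\<close> be a continuous function with values
  in \<open>[0, 1]\<close>, let \<open>avg \<nu> \<phi> f\<close> be its mean for the image of \<open>\<nu>\<close> under \<open>f\<close>, and let \<open>c\<close> be the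
  expectation of this mean. The function \<open>t (f, y) = 1 + (avg \<nu> \<phi> f - c) * (\<phi> y - c) / 4\<close> has mean \<open>1\<close>
  over \<open>f\<close> for each \<open>y\<close>, and the mean of \<open>ln (t (f, f z))\<close> is at least \<open>spread \<mu> \<nu> \<phi> / 8\<close>, where the
  spread is the variance of \<open>avg \<nu> \<phi> f\<close> (\<open>tilt_exists\<close>). Let \<open>P\<close> be the product of such functions along
  the composition. The change of variables \<open>y = F x\<close> shows that \<open>P\<close> times the Jacobian of \<open>F\<close> has
  integral at most \<open>1\<close> (\<open>tilted_chain\<close>). As the Jacobian is at least the inverse of the maximal
  contraction, \<open>ln s \<le> s - 1\<close> yields that the mean of \<open>ln (max_contraction A G F)\<close> is at least the
  mean of \<open>ln P\<close> (\<open>expected_log_growth\<close>), which is the sum of the gains of the steps.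

  A uniform lower bound for the best spread (\<open>uniform_spread\<close>) comes from compactness. If there
  were none, take pairs of \<open>\<mu>s k\<close> in \<open>K\<close> and probability measures \<open>\<nu>s k\<close> whose spreads tend to \<open>0\<close>. A
  subsequence of \<open>\<nu>s\<close> is realised by random points that converge almost surely
  (\<open>subsequence_coupling\<close>); this replaces weak compactness of the probability measures on the
  manifold, and it lets the spread pass to the limit in both measures at once, since only one
  continuous function of \<open>f\<close> has to be integrated against \<open>\<mu>s k\<close> (\<open>spread_cluster_zero\<close>).

  The geometric input is the change of variables formula for the volume
  (\<open>normalized_volume_exists\<close>), the chain rule \<open>Jac_chain\<close>, and the continuity of evaluation and
  Jacobian in the \<open>C\<^sup>1\<close> topology.
\<close>

section \<open>Binary digits on a compact space\<close>

text \<open>Each pair yields one binary digit of a point \<open>x\<close>: whether \<open>x \<in> V j\<close>. The digits determine the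
  point, and they make approximation, coding by reals and compactness arguments elementary.\<close>

lemma separating_open_pairs:
  obtains U V :: "nat \<Rightarrow> 'm::{t2_space,second_countable_topology} set"
  where "\<And>j. open (U j)" "\<And>j. open (V j)" "\<And>j. U j \<inter> V j = {}"
    "\<And>x y. x \<noteq> y \<Longrightarrow> \<exists>j. x \<in> U j \<and> y \<in> V j"
proof -
  obtain B :: "'m set set" where B: "countable B" "topological_basis B"
    using ex_countable_basis by blast
  define P where "P = insert ({},{}) {(u,v) \<in> B \<times> B. u \<inter> v = {}}"
  have P: "countable P" "P \<noteq> {}"
    unfolding P_def using B(1) by (auto intro: countable_subset[of _ "B \<times> B"])
  define U V where "U j = fst (from_nat_into P j)" and "V j = snd (from_nat_into P j)" for j
  have inP: "(U j, V j) \<in> P" for j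
    using from_nat_into[OF P(2), of j] by (simp add: U_def V_def)
  have BO: "open b" if "b \<in> B" for b
    using B(2) that topological_basis_open by blast
  show thesis
  proof (rule that[of U V])
    fix j
    show "open (U j)" "open (V j)" "U j \<inter> V j = {}"
      using inP[of j] BO unfolding P_def by auto
  next
    fix x y :: 'm assume "x \<noteq> y"
    then obtain S T where ST: "open S" "open T" "x \<in> S" "y \<in> T" "S \<inter> T = {}"
      using hausdorff by metis
    obtain s t where st: "s \<in> B" "x \<in> s" "s \<subseteq> S" "t \<in> B" "y \<in> t" "t \<subseteq> T"
      using topological_basisE[OF B(2) ST(1,3)] topological_basisE[OF B(2) ST(2,4)] by metis
    then have "(s,t) \<in> P" using ST(5) unfolding P_def by auto
    then obtain j where "from_nat_into P j = (s,t)"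
      using from_nat_into_surj[OF P(1)] by metis
    then show "\<exists>j. x \<in> U j \<and> y \<in> V j"
      using st by (intro exI[of _ j]) (simp add: U_def V_def)
  qed
qed

text \<open>The points whose first \<open>n\<close> digits may be \<open>b\<close>. Closed complements of one member of each
  pair are used instead of the pairs themselves, so that compactness applies.\<close>

definition cell :: "(nat \<Rightarrow> 'm set) \<Rightarrow> (nat \<Rightarrow> 'm set) \<Rightarrow> (nat \<Rightarrow> bool) \<Rightarrow> nat \<Rightarrow> 'm set" where
  "cell U V b n = (\<Inter>j<n. if b j then - U j else - V j)"

lemma cell_cong: "(\<And>j. j < n \<Longrightarrow> b j = c j) \<Longrightarrow> cell U V b n = cell U V c n"
  by (auto simp: cell_def)

lemma mem_own_cell:
  assumes "\<And>j. U j \<inter> V j = {}"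
  shows "x \<in> cell U V (\<lambda>j. x \<in> V j) n"
  using assms by (auto simp: cell_def)

text \<open>The cells are closed and decrease with \<open>n\<close>, so by compactness a neighbourhood of their
  intersection contains one of them.\<close>

lemma cells_shrink:
  fixes U V :: "nat \<Rightarrow> 'm::t2_space set"
  assumes "compact (UNIV :: 'm set)" and "\<And>j. open (U j)" "\<And>j. open (V j)"
    and "open W" and "\<And>x. (\<And>n. x \<in> cell U V b n) \<Longrightarrow> x \<in> W"
  shows "\<exists>n. cell U V b n \<subseteq> W"
proof -
  have cW: "compact (- W)"
    using assms(1,4) by (metis closed_Int_compact closed_Compl inf_top_right)
  define O' where "O' j = (if b j then U j else V j)" for j
  have "- W \<subseteq> (\<Union>j. O' j)"
  proof
    fix x assume "x \<in> - W"
    then obtain n where "x \<notin> cell U V b n" using assms(5) by blast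
    then show "x \<in> (\<Union>j. O' j)" by (auto simp: cell_def O'_def split: if_splits)
  qed
  moreover have "open (O' j)" for j using assms(2,3) by (simp add: O'_def)
  ultimately obtain C where C: "finite C" "- W \<subseteq> (\<Union>j\<in>C. O' j)"
    using compactE_image[OF cW, of UNIV O'] by auto
  obtain n where n: "\<forall>j\<in>C. j < n" using C(1) finite_nat_set_iff_bounded by blast
  have "cell U V b n \<subseteq> W"
  proof
    fix x assume x: "x \<in> cell U V b n"
    show "x \<in> W"
    proof (rule ccontr)
      assume "x \<notin> W"
      then obtain j where "j \<in> C" "x \<in> O' j" using C(2) by auto
      then show False using x n unfolding cell_def O'_def by (auto split: if_splits)
    qed
  qed
  then show ?thesis by blast
qed

lemma cells_separate:
  assumes "\<And>x y. x \<noteq> y \<Longrightarrow> \<exists>j. x \<in> U j \<and> y \<in> V j"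
    and "\<And>n. x \<in> cell U V b n" "\<And>n. y \<in> cell U V b n"
  shows "x = y"
proof (rule ccontr)
  assume "x \<noteq> y"
  then obtain j where j: "x \<in> U j" "y \<in> V j" using assms(1) by blast
  have "z \<in> (if b j then - U j else - V j)" if "z \<in> cell U V b (Suc j)" for z
    using that unfolding cell_def by blast
  from this[OF assms(2)] this[OF assms(3)] show False using j by (simp split: if_splits)
qed

lemma measurable_cell_code:
  assumes "\<And>j. Measurable.pred M (\<lambda>t. b t j)"
  shows "(\<lambda>t. {j. j < n \<and> b t j}) \<in> measurable M (count_space (Pow {..<n::nat}))"
proof (subst measurable_count_space_eq2)
  have "(\<lambda>t. {j. j < n \<and> b t j}) -` {T} \<inter> space M \<in> sets M" if "T \<subseteq> {..<n}" for T
  proof -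
    have "(\<lambda>t. {j. j < n \<and> b t j}) -` {T} \<inter> space M = {t \<in> space M. \<forall>j\<in>{..<n}. b t j = (j \<in> T)}"
      using that by auto
    also have "\<dots> \<in> sets M" using assms by measurable
    finally show ?thesis .
  qed
  then show "(\<lambda>t. {j. j < n \<and> b t j}) \<in> space M \<rightarrow> Pow {..<n} \<and>
      (\<forall>a\<in>Pow {..<n}. (\<lambda>t. {j. j < n \<and> b t j}) -` {a} \<inter> space M \<in> sets M)"
    by auto
qed simp

text \<open>The point \<open>s n x\<close> is any point with the same first \<open>n\<close> digits as \<open>x\<close>.\<close>

lemma finite_valued_approximation:
  assumes "compact (UNIV :: 'm::{t2_space,second_countable_topology} set)"
  obtains s :: "nat \<Rightarrow> 'm::{t2_space,second_countable_topology} \<Rightarrow> 'm" and I where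
    "\<And>n. finite (I n)" "\<And>n. s n \<in> measurable borel (count_space (I n))"
    "\<And>x. (\<lambda>n. s n x) \<longlonglongrightarrow> x"
proof -
  obtain U V :: "nat \<Rightarrow> 'm set" where UV: "\<And>j. open (U j)" "\<And>j. open (V j)"
      "\<And>j. U j \<inter> V j = {}" "\<And>x y. x \<noteq> y \<Longrightarrow> \<exists>j. x \<in> U j \<and> y \<in> V j"
    using separating_open_pairs by blast
  define g where "g n T = (SOME y. \<forall>j<n. (y \<in> V j) = (j \<in> T))" for n T
  define s where "s n x = g n {j. j < n \<and> x \<in> V j}" for n x
  have sd: "(s n x \<in> V j) = (x \<in> V j)" if "j < n" for n x j
  proof -
    have "\<forall>j<n. (g n {j. j < n \<and> x \<in> V j} \<in> V j) = (j \<in> {j. j < n \<and> x \<in> V j})"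
      unfolding g_def by (rule someI[of _ x]) auto
    then show ?thesis using that by (simp add: s_def)
  qed
  define I where "I n = g n ` Pow {..<n}" for n
  have 1: "finite (I n)" for n by (simp add: I_def)
  have 2: "s n \<in> measurable borel (count_space (I n))" for n
  proof -
    have "Measurable.pred borel (\<lambda>x. x \<in> V j)" for j
      using UV(2) by (simp add: pred_def)
    then have "(\<lambda>x. {j. j < n \<and> x \<in> V j}) \<in> measurable borel (count_space (Pow {..<n}))"
      by (rule measurable_cell_code)
    from measurable_compose[OF this, of "g n" "count_space (g n ` Pow {..<n})"]
    show ?thesis
      unfolding s_def[abs_def] I_def by auto
  qed
  have 3: "(\<lambda>n. s n x) \<longlonglongrightarrow> x" for x
    proof (rule topological_tendstoI)
      fix W assume W: "open W" "x \<in> W"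
      have "\<exists>n. cell U V (\<lambda>j. x \<in> V j) n \<subseteq> W"
      proof (rule cells_shrink[OF assms UV(1,2) W(1)])
        fix y assume "\<And>n. y \<in> cell U V (\<lambda>j. x \<in> V j) n"
        then have "y = x"
          using cells_separate[OF UV(4), of y "\<lambda>j. x \<in> V j" x] mem_own_cell[of U V x, OF UV(3)]
          by blast
        then show "y \<in> W" using W by simp
      qed
      then obtain N where N: "cell U V (\<lambda>j. x \<in> V j) N \<subseteq> W" by blast
      have "s n x \<in> W" if "n \<ge> N" for n
      proof -
        have "s n x \<in> cell U V (\<lambda>j. s n x \<in> V j) N" by (rule mem_own_cell) (rule UV(3))
        also have "\<dots> = cell U V (\<lambda>j. x \<in> V j) N"
          by (rule cell_cong) (use that sd in auto)
        finally show ?thesis using N by blast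
      qed
      then show "\<forall>\<^sub>F n in sequentially. s n x \<in> W"
        unfolding eventually_sequentially by blast
    qed
  show thesis by (rule that[OF 1 2 3])
qed

text \<open>With the second argument replaced by its approximation with finitely many values, measurability
  in the first argument suffices. This gives joint measurability in a map and a point without recourse to a
  countable base of the space of maps.\<close>

lemma measurable_separately_continuous:
  fixes h :: "'a \<Rightarrow> 'm::{t2_space,second_countable_topology} \<Rightarrow> real"
  assumes "compact (UNIV :: 'm set)" and meas: "\<And>y. (\<lambda>f. h f y) \<in> borel_measurable X"
    and cont: "\<And>f. f \<in> space X \<Longrightarrow> continuous_on UNIV (h f)"
  shows "(\<lambda>(f, y). h f y) \<in> borel_measurable (X \<Otimes>\<^sub>M borel)"
proof -
  obtain s :: "nat \<Rightarrow> 'm \<Rightarrow> 'm" and I where s: "\<And>n. finite (I n)"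
      "\<And>n. s n \<in> measurable borel (count_space (I n))" "\<And>x. (\<lambda>n. s n x) \<longlonglongrightarrow> x"
    by (rule finite_valued_approximation[OF assms(1)], rule that, assumption+)
  show ?thesis
  proof (rule borel_measurable_LIMSEQ_real)
    fix n
    show "(\<lambda>p. h (fst p) (s n (snd p))) \<in> borel_measurable (X \<Otimes>\<^sub>M borel)"
    proof (rule measurable_compose_countable'[where I="I n"])
      show "(\<lambda>p. h (fst p) i) \<in> borel_measurable (X \<Otimes>\<^sub>M borel)" for i
        by (rule measurable_compose[OF measurable_fst meas])
      show "(\<lambda>p. s n (snd p)) \<in> measurable (X \<Otimes>\<^sub>M borel) (count_space (I n))"
        by (rule measurable_compose[OF measurable_snd s(2)])
      show "countable (I n)" using s(1) by (simp add: countable_finite)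
    qed
  next
    fix p assume p: "p \<in> space (X \<Otimes>\<^sub>M (borel :: 'm measure))"
    then have "fst p \<in> space X" by (auto simp: space_pair_measure)
    then have "isCont (h (fst p)) (snd p)"
      using cont continuous_on_eq_continuous_at[OF open_UNIV] by blast
    then show "(\<lambda>n. h (fst p) (s n (snd p))) \<longlonglongrightarrow> (case p of (f, y) \<Rightarrow> h f y)"
      using isCont_tendsto_compose[OF _ s(3)] by (simp add: case_prod_beta)
  qed
qed

section \<open>Continuous functions determine measures\<close>

text \<open>Urysohn's lemma provides a function for each point of \<open>V\<close>. By Lindelof's theorem countably many
  of them suffice for one, doubled and cut off at \<open>1\<close>, to have the value \<open>1\<close> at each given
  point of \<open>V\<close>; the products combine them into one sequence.\<close>

lemma indicator_limit_continuous:
  fixes V :: "'m::{t2_space,second_countable_topology} set"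
  assumes comp: "compact (UNIV :: 'm set)" and "open V"
  shows "\<exists>\<phi> :: nat \<Rightarrow> 'm \<Rightarrow> real. (\<forall>k. continuous_on UNIV (\<phi> k)) \<and>
    (\<forall>k x. \<phi> k x \<in> {0..1}) \<and> (\<forall>x. (\<lambda>k. \<phi> k x) \<longlonglongrightarrow> indicator V x)"
proof -
  have "Hausdorff_space (euclidean :: 'm topology)"
    unfolding Hausdorff_space_def disjnt_def by (simp, metis hausdorff)
  then have norm: "normal_space (euclidean :: 'm topology)"
    by (intro compact_Hausdorff_or_regular_imp_normal_space)
       (use comp in \<open>auto simp: compact_space_def\<close>)
  have "\<exists>f. continuous_on UNIV f \<and> (\<forall>y. f y \<in> {0..1::real}) \<and> f x = 1 \<and> (\<forall>y. y \<notin> V \<longrightarrow> f y = 0)"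
    if "x \<in> V" for x
  proof -
    have "closedin euclidean (- V)" "closedin euclidean {x}" "disjnt (- V) {x}"
      using \<open>open V\<close> that by (auto simp: disjnt_def)
    from Urysohn_lemma[OF norm this, of 0 1]
    obtain f where f: "continuous_map euclidean (top_of_set {0..1::real}) f" "f ` (- V) \<subseteq> {0}" "f ` {x} \<subseteq> {1}"
      by (metis zero_le_one)
    then show ?thesis
      by (intro exI[of _ f]) (auto simp: continuous_map_in_subtopology image_subset_iff)
  qed
  then obtain f where f: "\<And>x. x \<in> V \<Longrightarrow> continuous_on UNIV (f x)" "\<And>x y. x \<in> V \<Longrightarrow> f x y \<in> {0..1::real}"
      "\<And>x. x \<in> V \<Longrightarrow> f x x = 1" "\<And>x y. x \<in> V \<Longrightarrow> y \<notin> V \<Longrightarrow> f x y = 0"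
    by metis
  define O' where "O' x = {y. f x y > 1/2}" for x
  have "open (O' x)" if "x \<in> V" for x
    unfolding O'_def using f(1)[OF that] by (intro open_Collect_less) auto
  then have op: "open S" if "S \<in> O' ` V" for S using that by auto
  obtain F where F: "F \<subseteq> O' ` V" "countable F" "\<Union>F = \<Union>(O' ` V)"
    by (rule Lindelof[of "O' ` V", OF op])
  then obtain D where D: "D \<subseteq> V" "countable D" "F = O' ` D"
    using countable_subset_image[of F O' V] by auto
  have cov: "\<exists>x\<in>D. f x y > 1/2" if "y \<in> V" for y
  proof -
    have "y \<in> O' y" using f(3)[OF that] by (simp add: O'_def)
    then have "y \<in> \<Union>F" using F(3) that by auto
    then show ?thesis using D(3) by (auto simp: O'_def)
  qed
  define d where "d i y = (if D = {} then 0 else min 1 (2 * f (from_nat_into D i) y))" for i y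
  have d: "continuous_on UNIV (d i)" "d i y \<in> {0..1}" for i y
  proof -
    show "continuous_on UNIV (d i)"
    proof (cases "D = {}")
      case False
      then have "from_nat_into D i \<in> V" using D(1) from_nat_into[of D i] by blast
      from f(1)[OF this] have "continuous_on UNIV (\<lambda>y. min 1 (2 * f (from_nat_into D i) y))"
        by (intro continuous_intros)
      then show ?thesis using False by (simp add: d_def)
    qed (simp add: d_def)
    show "d i y \<in> {0..1}"
    proof (cases "D = {}")
      case False
      then have "from_nat_into D i \<in> V" using D(1) from_nat_into[of D i] by blast
      from f(2)[OF this, of y] show ?thesis unfolding d_def using False by simp
    qed (simp add: d_def)
  qed
  define \<phi> where "\<phi> k y = 1 - (\<Prod>i<k. 1 - d i y)" for k y
  show ?thesis
  proof (intro exI[of _ \<phi>] conjI allI)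
    fix k y
    show "continuous_on UNIV (\<phi> k)"
      unfolding \<phi>_def using d(1) by (intro continuous_intros)
    have "(\<Prod>i<k. 1 - d i y) \<ge> 0" "(\<Prod>i<k. 1 - d i y) \<le> 1"
      using d(2) by (auto intro!: prod_nonneg prod_le_1)
    then show "\<phi> k y \<in> {0..1}" by (simp add: \<phi>_def)
  next
    fix y
    show "(\<lambda>k. \<phi> k y) \<longlonglongrightarrow> indicator V y"
    proof (cases "y \<in> V")
      case True
      then obtain x where x: "x \<in> D" "f x y > 1/2" using cov by blast
      then obtain i where i: "from_nat_into D i = x" using D(2) from_nat_into_surj by metis
      have "d i y = 1" using x i by (auto simp: d_def)
      then have "\<phi> k y = 1" if "k > i" for k
        using that by (auto simp: \<phi>_def prod_zero_iff)
      then have "\<forall>\<^sub>F k in sequentially. \<phi> k y = 1"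
        unfolding eventually_at_top_dense by blast
      then show ?thesis using True by (simp add: tendsto_eventually)
    next
      case False
      then have "d i y = 0" for i
        using f(4)[of "from_nat_into D i" y] D(1) from_nat_into[of D i] subsetD
        by (cases "D = {}") (simp_all add: d_def subset_iff)
      then show ?thesis using False by (simp add: \<phi>_def)
    qed
  qed
qed

lemma measurable_if_continuous_tests:
  fixes g :: "'a \<Rightarrow> 'm::{t2_space,second_countable_topology}"
  assumes comp: "compact (UNIV :: 'm set)"
    and "\<And>\<phi> :: 'm \<Rightarrow> real. continuous_on UNIV \<phi> \<Longrightarrow> (\<lambda>x. \<phi> (g x)) \<in> borel_measurable X"
  shows "g \<in> measurable X borel"
proof (rule borel_measurableI)
  fix V :: "'m set" assume "open V"
  from indicator_limit_continuous[OF comp this]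
  obtain \<phi> :: "nat \<Rightarrow> 'm \<Rightarrow> real" where \<phi>: "\<And>k. continuous_on UNIV (\<phi> k)"
    "\<And>x. (\<lambda>k. \<phi> k x) \<longlonglongrightarrow> indicator V x"
    by auto
  have "(\<lambda>x. indicator V (g x) :: real) \<in> borel_measurable X"
    by (rule borel_measurable_LIMSEQ_real[of _ "\<lambda>k x. \<phi> k (g x)"])
       (use \<phi> assms(2) in auto)
  from measurable_sets[OF this, of "{1}"]
  show "g -` V \<inter> space X \<in> sets X"
    by (auto simp: vimage_def indicator_def cong: conj_cong split: if_splits)
qed

text \<open>Countability matters because later each test function comes with its own null set of maps. The
  finite unions of basic open sets suffice, since every open set is an increasing union of these.\<close>

lemma countable_determining_family:
  assumes comp: "compact (UNIV :: 'm::{t2_space,second_countable_topology} set)"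
  shows "\<exists>\<Phi> :: ('m::{t2_space,second_countable_topology} \<Rightarrow> real) set. countable \<Phi> \<and>
    (\<forall>\<phi>\<in>\<Phi>. continuous_on UNIV \<phi> \<and> (\<forall>x. \<phi> x \<in> {0..1})) \<and>
    (\<forall>M N. prob_space M \<longrightarrow> prob_space N \<longrightarrow> sets M = sets borel \<longrightarrow> sets N = sets borel \<longrightarrow>
       (\<forall>\<phi>\<in>\<Phi>. (\<integral>x. \<phi> x \<partial>M) = (\<integral>x. \<phi> x \<partial>N)) \<longrightarrow> M = N)"
proof -
  obtain B :: "'m set set" where B: "countable B" "topological_basis B"
    using ex_countable_basis by blast
  define C where "C = {\<Union>F | F. finite F \<and> F \<subseteq> B}"
  have C: "countable C" "\<And>V. V \<in> C \<Longrightarrow> open V"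
  proof -
    have "C = Union ` {F. finite F \<and> F \<subseteq> B}" by (auto simp: C_def)
    then show "countable C" using countable_Collect_finite_subset[OF B(1)] by (simp add: conj_commute)
    show "open V" if "V \<in> C" for V
      using that B(2) topological_basis_open by (fastforce simp: C_def)
  qed
  have "\<forall>V\<in>C. \<exists>\<phi> :: nat \<Rightarrow> 'm \<Rightarrow> real. (\<forall>k. continuous_on UNIV (\<phi> k)) \<and>
      (\<forall>k x. \<phi> k x \<in> {0..1}) \<and> (\<forall>x. (\<lambda>k. \<phi> k x) \<longlonglongrightarrow> indicator V x)"
    using indicator_limit_continuous[OF comp C(2)] by simp
  then obtain \<psi> :: "'m set \<Rightarrow> nat \<Rightarrow> 'm \<Rightarrow> real" where \<psi>: "\<And>V k. V \<in> C \<Longrightarrow> continuous_on UNIV (\<psi> V k)"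
      "\<And>V k x. V \<in> C \<Longrightarrow> \<psi> V k x \<in> {0..1}" "\<And>V x. V \<in> C \<Longrightarrow> (\<lambda>k. \<psi> V k x) \<longlonglongrightarrow> indicator V x"
    by metis
  define \<Phi> where "\<Phi> = (\<lambda>(V,k). \<psi> V k) ` (C \<times> UNIV)"
  show ?thesis
  proof (rule exI[of _ \<Phi>], intro conjI ballI allI impI)
    show "countable \<Phi>" unfolding \<Phi>_def using C(1) by auto
    show "continuous_on UNIV \<phi>" if "\<phi> \<in> \<Phi>" for \<phi> using that \<psi>(1) by (auto simp: \<Phi>_def)
    show "\<phi> x \<in> {0..1}" if "\<phi> \<in> \<Phi>" for \<phi> x using that \<psi>(2) by (force simp: \<Phi>_def)
  next
    fix M N :: "'m measure"
    assume M: "prob_space M" and N: "prob_space N" and sM: "sets M = sets borel" and sN: "sets N = sets borel"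
      and eq': "\<forall>\<phi>\<in>\<Phi>. (\<integral>x. \<phi> x \<partial>M) = (\<integral>x. \<phi> x \<partial>N)"
    have eq: "\<And>\<phi>. \<phi> \<in> \<Phi> \<Longrightarrow> (\<integral>x. \<phi> x \<partial>M) = (\<integral>x. \<phi> x \<partial>N)" using eq' by simp
    interpret M: prob_space M by fact
    interpret N: prob_space N by fact
    have lim: "(\<lambda>k. \<integral>x. \<psi> V k x \<partial>L) \<longlonglongrightarrow> measure L V"
      if V: "V \<in> C" and L: "prob_space L" "sets L = sets borel" for V L
    proof -
      interpret L: prob_space L by fact
      note [measurable_cong] = L(2)
      have [measurable]: "\<psi> V k \<in> borel_measurable borel" for k
        using \<psi>(1)[OF V] by (rule borel_measurable_continuous_onI)
      have [measurable]: "V \<in> sets borel" using C(2)[OF V] by simp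
      have "(\<lambda>k. \<integral>x. \<psi> V k x \<partial>L) \<longlonglongrightarrow> (\<integral>x. indicator V x \<partial>L)"
        by (rule integral_dominated_convergence[where w="\<lambda>_. 1"])
           (use \<psi>(2,3)[OF V] in auto)
      moreover have "(\<integral>x. indicator V x \<partial>L) = measure L V"
        using sets_eq_imp_space_eq[OF L(2)] by simp
      ultimately show ?thesis by simp
    qed
    have eqC: "emeasure M V = emeasure N V" if "V \<in> C" for V
    proof -
      have "(\<integral>x. \<psi> V k x \<partial>M) = (\<integral>x. \<psi> V k x \<partial>N)" for k
        by (rule eq) (use that in \<open>auto simp: \<Phi>_def\<close>)
      then have "measure M V = measure N V"
        using LIMSEQ_unique[OF lim[OF that M sM]] lim[OF that N sN] by simp
      then show ?thesis unfolding M.emeasure_eq_measure N.emeasure_eq_measure by simp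
    qed
    have eqO: "emeasure M V = emeasure N V" if "open V" for V
    proof -
      from B(2) have "\<exists>B'\<subseteq>B. \<Union>B' = V" if "open V" for V
        using that unfolding topological_basis_def by simp
      from this[OF that] obtain B' where B': "B' \<subseteq> B" "\<Union>B' = V" by auto
      show ?thesis
      proof (cases "B' = {}")
        case False
        have cB': "countable B'" using B' B(1) countable_subset by blast
        define W where "W n = (\<Union>i<n. from_nat_into B' i)" for n :: nat
        have WC: "W n \<in> C" for n
        proof -
          have "W n = \<Union>(from_nat_into B' ` {..<n})" by (simp add: W_def)
          moreover have "from_nat_into B' ` {..<n} \<subseteq> B" using from_nat_into[OF False] B' by auto
          ultimately show ?thesis unfolding C_def by blast
        qed
        have WV: "(\<Union>n. W n) = V"
        proof -
          have "(\<Union>n. W n) = \<Union>(range (from_nat_into B'))" by (auto simp: W_def)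
          then show ?thesis using B'(2) range_from_nat_into[OF False cB'] by simp
        qed
        have inc: "incseq W" unfolding W_def incseq_def by (intro allI impI UN_mono) auto
        have "range W \<subseteq> sets borel" using WC C(2) by auto
        then have lims: "(\<lambda>n. emeasure M (W n)) \<longlonglongrightarrow> emeasure M V" "(\<lambda>n. emeasure N (W n)) \<longlonglongrightarrow> emeasure N V"
          using Lim_emeasure_incseq[OF _ inc, of M] Lim_emeasure_incseq[OF _ inc, of N]
          by (simp_all add: sM sN WV)
        show ?thesis using LIMSEQ_unique[OF lims(1)] lims(2) eqC[OF WC] by simp
      qed (use B' in auto)
    qed
    show "M = N"
    proof (rule measure_eqI_generator_eq[of "{S. open S}" UNIV _ _ "\<lambda>_. UNIV"])
      show "Int_stable {S :: 'm set. open S}" by (auto simp: Int_stable_def)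
      show "sets M = sigma_sets UNIV {S. open S}" "sets N = sigma_sets UNIV {S. open S}"
        by (simp_all add: sM sN borel_def)
    qed (use eqO in auto)
  qed
qed

section \<open>Coupling of measures on a compact space\<close>

text \<open>Ternary expansions with digits \<open>0\<close> and \<open>1\<close>: the value lies in \<open>[0, 1/2]\<close> or in
  \<open>[1, 3/2]\<close> according to the first digit, so digits survive limits.\<close>

definition ternary :: "(nat \<Rightarrow> bool) \<Rightarrow> real" where
  "ternary b = (\<Sum>j. of_bool (b j) * (1/3)^j)"

text \<open>The expansion of \<open>t\<close> after removal of its first \<open>j\<close> digits; digit \<open>j\<close> is \<open>1\<close> iff this value is at
  least \<open>1\<close>.\<close>

primrec rest :: "nat \<Rightarrow> real \<Rightarrow> real" where
  "rest 0 t = t"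
| "rest (Suc j) t = 3 * (rest j t - of_bool (rest j t \<ge> 1))"

lemma summable_ternary: "summable (\<lambda>j. of_bool (b j) * (1/3)^j :: real)"
  by (rule summable_comparison_test'[of "\<lambda>j. (1/3)^j" 0]) (auto simp: summable_geometric)

lemma ternary_nonneg: "0 \<le> ternary b"
  unfolding ternary_def by (rule suminf_nonneg[OF summable_ternary]) auto

lemma ternary_le: "ternary b \<le> 3/2"
proof -
  have "ternary b \<le> (\<Sum>j. (1/3)^j)"
    unfolding ternary_def by (rule suminf_le[OF _ summable_ternary]) (auto simp: summable_geometric)
  also have "\<dots> = 3/2" by (subst suminf_geometric) auto
  finally show ?thesis .
qed

lemma ternary_split: "ternary b = of_bool (b 0) + ternary (\<lambda>j. b (Suc j)) / 3"
proof -
  have "ternary b = (\<Sum>j. of_bool (b (Suc j)) * (1/3)^Suc j) + of_bool (b 0)"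
    unfolding ternary_def using suminf_split_head[OF summable_ternary, of b] by simp
  also have "(\<Sum>j. of_bool (b (Suc j)) * (1/3)^Suc j) = (\<Sum>j. (of_bool (b (Suc j)) * (1/3)^j) / 3 :: real)"
    by simp
  also have "\<dots> = ternary (\<lambda>j. b (Suc j)) / 3"
    unfolding ternary_def by (rule suminf_divide[OF summable_ternary])
  finally show ?thesis by simp
qed

lemma ternary_head: "if b 0 then ternary b \<ge> 1 else ternary b \<le> 1/2"
  using ternary_split[of b] ternary_nonneg[of "\<lambda>j. b (Suc j)"] ternary_le[of "\<lambda>j. b (Suc j)"] by simp

lemma rest_ternary: "rest j (ternary b) = ternary (\<lambda>i. b (i + j))"
proof (induction j)
  case (Suc j)
  then show ?case
    using ternary_split[of "\<lambda>i. b (i + j)"] ternary_head[of "\<lambda>i. b (i + j)"] by (simp split: if_splits)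
qed simp

lemma digit_ternary: "rest j (ternary b) \<ge> 1 \<longleftrightarrow> b j"
  using ternary_head[of "\<lambda>i. b (i + j)"] by (simp add: rest_ternary split: if_splits)

lemma measurable_rest[measurable]: "rest j \<in> borel_measurable borel"
  by (induction j) (simp_all add: rest.simps[abs_def])

text \<open>Since no expansion has a value between \<open>1/2\<close> and \<open>1\<close>, a convergent sequence of values
  eventually has a constant first digit, and the rests converge again.\<close>

lemma rest_limit:
  assumes "(\<lambda>k. ternary (b k)) \<longlonglongrightarrow> t"
  shows "(\<lambda>k. rest j (ternary (b k))) \<longlonglongrightarrow> rest j t \<and>
    (\<forall>\<^sub>F k in sequentially. b k j = (rest j t \<ge> 1))"
proof -
  have digit: "\<forall>\<^sub>F k in sequentially. b k j = (rest j t \<ge> 1)"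
    if lim: "(\<lambda>k. rest j (ternary (b k))) \<longlonglongrightarrow> rest j t" for j
  proof (cases "rest j t \<ge> 1")
    case True
    then have "\<forall>\<^sub>F k in sequentially. rest j (ternary (b k)) > 1/2"
      using order_tendstoD(1)[OF lim, of "1/2"] by simp
    then show ?thesis
    proof (rule eventually_mono)
      fix k assume "rest j (ternary (b k)) > 1/2"
      then have "b k j" using ternary_head[of "\<lambda>i. b k (i + j)"]
        by (simp add: rest_ternary split: if_splits)
      then show "b k j = (rest j t \<ge> 1)" using True by simp
    qed
  next
    case False
    then have "\<forall>\<^sub>F k in sequentially. rest j (ternary (b k)) < 1"
      using order_tendstoD(2)[OF lim, of 1] by simp
    then show ?thesis
    proof (rule eventually_mono)
      fix k assume "rest j (ternary (b k)) < 1"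
      then have "\<not> b k j" using digit_ternary[of j "b k"] by simp
      then show "b k j = (rest j t \<ge> 1)" using False by simp
    qed
  qed
  have "(\<lambda>k. rest j (ternary (b k))) \<longlonglongrightarrow> rest j t"
  proof (induction j)
    case 0
    show ?case using assms by simp
  next
    case (Suc j)
    have "(\<lambda>k. of_bool (rest j (ternary (b k)) \<ge> 1) :: real) \<longlonglongrightarrow> of_bool (rest j t \<ge> 1)"
      by (rule tendsto_eventually, rule eventually_mono[OF digit[OF Suc]]) (simp add: digit_ternary)
    then show ?case unfolding rest.simps by (intro tendsto_intros Suc)
  qed
  with digit show ?thesis by blast
qed

text \<open>A weak limit point of the codes exists by Helly's theorem, and Skorohod's theorem realises
  the convergence pointwise; decoding transports the convergence back.\<close>

lemma subsequence_coupling: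
  fixes \<nu> :: "nat \<Rightarrow> 'm::{t2_space,second_countable_topology} measure"
  assumes comp: "compact (UNIV :: 'm set)"
    and prob: "\<And>k. prob_space (\<nu> k)" and sets: "\<And>k. sets (\<nu> k) = sets borel"
  shows "\<exists>r (\<Omega> :: real measure) x y. strict_mono r \<and> prob_space \<Omega> \<and>
    (\<forall>k. x k \<in> measurable \<Omega> borel \<and> distr \<Omega> borel (x k) = \<nu> (r k)) \<and>
    y \<in> measurable \<Omega> borel \<and> (AE u in \<Omega>. (\<lambda>k. x k u) \<longlonglongrightarrow> y u)"
proof -
  obtain U V :: "nat \<Rightarrow> 'm set" where UV: "\<And>j. open (U j)" "\<And>j. open (V j)"
      "\<And>j. U j \<inter> V j = {}" "\<And>x y. x \<noteq> y \<Longrightarrow> \<exists>j. x \<in> U j \<and> y \<in> V j"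
    using separating_open_pairs by blast
  note shrink = cells_shrink[OF comp UV(1,2)]
  define e where "e x = ternary (\<lambda>j. x \<in> V j)" for x
  define b where "b t j = (rest j t \<ge> 1)" for t j
  define Z where "Z t n = cell U V (b t) n" for t n
  \<comment> \<open>The decoding map. It is total, so points outside the range of \<open>e\<close> may be sent anywhere.\<close>
  define \<pi> where "\<pi> t = (if \<exists>x. \<forall>n. x \<in> Z t n then THE x. \<forall>n. x \<in> Z t n else undefined)" for t
  have \<pi>I: "\<pi> t = x" if "\<And>n. x \<in> Z t n" for t x
  proof -
    have "y = x" if "\<forall>n. y \<in> Z t n" for y
      using cells_separate[OF UV(4), of y "b t" x] that \<open>\<And>n. x \<in> Z t n\<close> unfolding Z_def by blast
    then have "(THE x. \<forall>n. x \<in> Z t n) = x"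
      using \<open>\<And>n. x \<in> Z t n\<close> by (intro the_equality) auto
    then show ?thesis unfolding \<pi>_def using that by auto
  qed
  have be: "b (e x) = (\<lambda>j. x \<in> V j)" for x
    by (rule ext) (simp add: b_def e_def digit_ternary)
  have \<pi>e: "\<pi> (e x) = x" for x
    by (rule \<pi>I) (simp add: Z_def be mem_own_cell[OF UV(3)])
  have Zempty: "(\<nexists>x. \<forall>n. x \<in> Z t n) \<longleftrightarrow> (\<exists>n. Z t n \<subseteq> {})" for t
  proof
    assume "\<nexists>x. \<forall>n. x \<in> Z t n"
    then show "\<exists>n. Z t n \<subseteq> {}" unfolding Z_def by (intro shrink) auto
  qed blast
  have Zin: "\<pi> t \<in> W \<longleftrightarrow> (\<exists>n. Z t n \<subseteq> W)" if x: "\<forall>n. x \<in> Z t n" and W: "open W" for t x W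
  proof -
    have *: "\<pi> t = x" using \<pi>I x by blast
    show ?thesis
    proof
      assume "\<pi> t \<in> W"
      show "\<exists>n. Z t n \<subseteq> W" unfolding Z_def
      proof (rule shrink[OF W])
        fix z assume "\<And>n. z \<in> cell U V (b t) n"
        then have "\<pi> t = z" by (intro \<pi>I) (simp add: Z_def)
        then show "z \<in> W" using \<open>\<pi> t \<in> W\<close> by simp
      qed
    next
      assume "\<exists>n. Z t n \<subseteq> W"
      then show "\<pi> t \<in> W" using x * by auto
    qed
  qed
  have mb: "Measurable.pred borel (\<lambda>t. b t j)" for j
    unfolding b_def by measurable
  have Zmeas: "{t. Z t n \<subseteq> W} \<in> sets borel" for n W
  proof -
    have "Z t n = cell U V (\<lambda>j. j \<in> {j. j < n \<and> b t j}) n" for t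
      unfolding Z_def by (rule cell_cong) simp
    then have *: "{t. Z t n \<subseteq> W} = (\<lambda>t. {j. j < n \<and> b t j}) -`
        {T \<in> Pow {..<n}. cell U V (\<lambda>j. j \<in> T) n \<subseteq> W} \<inter> space borel" by auto
    show ?thesis unfolding *
      by (rule measurable_sets[OF measurable_cell_code[OF mb]]) auto
  qed
  have m\<pi>[measurable]: "\<pi> \<in> measurable borel borel"
  proof (rule borel_measurableI)
    fix W :: "'m set" assume W: "open W"
    define E where "E = (\<Union>n. {t. Z t n \<subseteq> {}})"
    have E: "t \<in> E \<longleftrightarrow> (\<nexists>x. \<forall>n. x \<in> Z t n)" for t using Zempty[of t] by (simp add: E_def)
    have "\<pi> -` W = ((\<Union>n. {t. Z t n \<subseteq> W}) - E) \<union> (if undefined \<in> W then E else {})"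
    proof (rule set_eqI)
      fix t
      show "t \<in> \<pi> -` W \<longleftrightarrow> t \<in> ((\<Union>n. {t. Z t n \<subseteq> W}) - E) \<union> (if undefined \<in> W then E else {})"
      proof (cases "t \<in> E")
        case True
        then have "\<pi> t = undefined" using E[of t] unfolding \<pi>_def by meson
        then show ?thesis using True by simp
      next
        case False
        then obtain x where "\<forall>n. x \<in> Z t n" using E by blast
        from Zin[OF this W] show ?thesis using False by simp
      qed
    qed
    moreover have "E \<in> sets borel" "(\<Union>n. {t. Z t n \<subseteq> W}) \<in> sets borel"
      unfolding E_def using Zmeas by blast+
    ultimately show "\<pi> -` W \<inter> space borel \<in> sets borel" by auto
  qed
  have me[measurable]: "e \<in> borel_measurable borel"
  proof -
    have [measurable]: "V j \<in> sets borel" for j using UV(2) by simp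
    show ?thesis unfolding e_def ternary_def by measurable
  qed
  have decode_limit: "(\<lambda>k. x k) \<longlonglongrightarrow> \<pi> t" if lim: "(\<lambda>k. e (x k)) \<longlonglongrightarrow> t" for x :: "nat \<Rightarrow> 'm" and t
  proof -
    have ev: "\<forall>\<^sub>F k in sequentially. (x k \<in> V j) = b t j" for j
      using rest_limit[of "\<lambda>k j. x k \<in> V j" t j] lim unfolding e_def b_def by blast
    have evZ: "\<forall>\<^sub>F k in sequentially. x k \<in> Z t n" for n
    proof -
      have "\<forall>\<^sub>F k in sequentially. \<forall>j\<in>{..<n}. (x k \<in> V j) = b t j"
        using ev by (intro eventually_ball_finite) auto
      then show ?thesis
      proof (rule eventually_mono)
        fix k assume "\<forall>j\<in>{..<n}. (x k \<in> V j) = b t j"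
        then have "cell U V (\<lambda>j. x k \<in> V j) n = Z t n" unfolding Z_def by (intro cell_cong) auto
        then show "x k \<in> Z t n" using mem_own_cell[of U V "x k" n, OF UV(3)] by simp
      qed
    qed
    have "Z t n \<noteq> {}" for n
      using eventually_happens'[OF sequentially_bot evZ[of n]] by blast
    then obtain z where z: "\<forall>n. z \<in> Z t n" using Zempty[of t] by blast
    show ?thesis
    proof (rule topological_tendstoI)
      fix W :: "'m set" assume W: "open W" "\<pi> t \<in> W"
      then obtain n where "Z t n \<subseteq> W" using Zin[OF z W(1)] by blast
      then show "\<forall>\<^sub>F k in sequentially. x k \<in> W"
        using evZ[of n] by (auto elim: eventually_mono)
    qed
  qed
  define \<sigma> where "\<sigma> k = distr (\<nu> k) borel e" for k
  have [measurable_cong]: "sets (\<nu> k) = sets borel" for k by (rule sets)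
  have rd: "real_distribution (\<sigma> k)" for k
  proof -
    interpret prob_space "\<nu> k" by (rule prob)
    show ?thesis unfolding \<sigma>_def by (intro real_distribution_distr) measurable
  qed
  have "tight \<sigma>"
    unfolding tight_def
  proof (intro conjI allI impI rd)
    fix \<epsilon> :: real assume "\<epsilon> > 0"
    have "measure (\<sigma> k) {-1<..2} = 1" for k
    proof -
      interpret prob_space "\<nu> k" by (rule prob)
      have "e -` {-1<..2} = UNIV"
      proof -
        have "-1 < e x \<and> e x \<le> 2" for x
          using ternary_nonneg[of "\<lambda>j. x \<in> V j"] ternary_le[of "\<lambda>j. x \<in> V j"] unfolding e_def by linarith
        then show ?thesis by auto
      qed
      then show ?thesis unfolding \<sigma>_def
        by (subst measure_distr) (use prob_space in \<open>auto simp: sets_eq_imp_space_eq[OF sets]\<close>)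
    qed
    then show "\<exists>a b. a < b \<and> (\<forall>n. 1 - \<epsilon> < measure (\<sigma> n) {a<..b})"
      using \<open>\<epsilon> > 0\<close> by (intro exI[of _ "-1"] exI[of _ 2]) auto
  qed
  from tight_imp_convergent_subsubsequence[OF this strict_mono_id]
  obtain r S where r: "strict_mono r" and S: "real_distribution S" and "weak_conv_m (\<sigma> \<circ> id \<circ> r) S"
    by blast
  then have wc: "weak_conv_m (\<lambda>k. \<sigma> (r k)) S" by (simp add: comp_def)
  from Skorohod[OF rd S wc]
  obtain \<Omega> :: "real measure" and Yk Y where *: "prob_space \<Omega> \<and> (\<forall>k. Yk k \<in> measurable \<Omega> borel) \<and>
      (\<forall>k. distr \<Omega> borel (Yk k) = \<sigma> (r k)) \<and> Y \<in> measurable \<Omega> lborel \<and> distr \<Omega> borel Y = S \<and>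
      (\<forall>u\<in>space \<Omega>. (\<lambda>k. Yk k u) \<longlonglongrightarrow> Y u)"
    by (elim exE)
  have \<Omega>: "prob_space \<Omega>" "\<And>k. Yk k \<in> measurable \<Omega> borel" "\<And>k. distr \<Omega> borel (Yk k) = \<sigma> (r k)"
      "Y \<in> measurable \<Omega> lborel" "\<And>u. u \<in> space \<Omega> \<Longrightarrow> (\<lambda>k. Yk k u) \<longlonglongrightarrow> Y u"
    using * by simp_all
  note [measurable] = \<Omega>(2)
  have [measurable]: "Y \<in> measurable \<Omega> borel" using \<Omega>(4) by simp
  have "AE u in \<Omega>. e (\<pi> (Yk k u)) = Yk k u" for k
  proof -
    have "AE t in \<sigma> (r k). e (\<pi> t) = t"
      unfolding \<sigma>_def by (subst AE_distr_iff) (auto simp: \<pi>e)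
    then show ?thesis
      unfolding \<Omega>(3)[symmetric] by (subst (asm) AE_distr_iff) auto
  qed
  then have ae: "AE u in \<Omega>. \<forall>k. e (\<pi> (Yk k u)) = Yk k u" by (simp add: AE_all_countable)
  have "AE u in \<Omega>. (\<lambda>k. \<pi> (Yk k u)) \<longlonglongrightarrow> \<pi> (Y u)"
    using ae AE_space by eventually_elim (auto intro!: decode_limit simp: \<Omega>(5))
  moreover have "distr \<Omega> borel (\<lambda>u. \<pi> (Yk k u)) = \<nu> (r k)" for k
  proof -
    have "distr \<Omega> borel (\<lambda>u. \<pi> (Yk k u)) = distr (distr \<Omega> borel (Yk k)) borel \<pi>"
      by (subst distr_distr) (auto simp: comp_def)
    also have "\<dots> = distr (\<nu> (r k)) borel (\<lambda>x. \<pi> (e x))"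
      unfolding \<Omega>(3) \<sigma>_def by (subst distr_distr) (auto simp: comp_def)
    also have "\<dots> = \<nu> (r k)" unfolding \<pi>e by (rule distr_id2) (simp add: sets)
    finally show ?thesis .
  qed
  ultimately show ?thesis
    using r \<Omega>(1) by (intro exI[of _ r] exI[of _ \<Omega>] exI[of _ "\<lambda>k u. \<pi> (Yk k u)"] exI[of _ "\<lambda>u. \<pi> (Y u)"]) auto
qed

section \<open>Weak topology\<close>

lemma borel_of_sets: "sets (borel_of X) = sigma_sets (topspace X) {U. openin X U}"
  unfolding borel_of_def by (rule sets_measure_of) (auto dest: openin_subset)

lemma borel_of_space: "space (borel_of X) = topspace X"
  unfolding borel_of_def by (rule space_measure_of) (auto dest: openin_subset)

lemma measurable_continuous_map:
  fixes \<psi> :: "'a \<Rightarrow> real"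
  assumes "continuous_map X euclideanreal \<psi>" and "sets \<mu> = sets (borel_of X)"
  shows "\<psi> \<in> borel_measurable \<mu>"
proof (rule borel_measurableI)
  fix S :: "real set" assume "open S"
  have sp: "space \<mu> = topspace X" using sets_eq_imp_space_eq[OF assms(2)] by (simp add: borel_of_space)
  have "openin X {x \<in> topspace X. \<psi> x \<in> S}"
    using assms(1) \<open>open S\<close> by (simp add: continuous_map_def)
  moreover have "\<psi> -` S \<inter> space \<mu> = {x \<in> topspace X. \<psi> x \<in> S}" using sp by auto
  ultimately show "\<psi> -` S \<inter> space \<mu> \<in> sets \<mu>"
    by (simp add: assms(2) borel_of_sets sigma_sets.Basic)
qed

lemma openin_weak_topology:
  assumes "continuous_map X euclideanreal \<psi>" "bounded (\<psi> ` topspace X)" "open U"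
  shows "openin (weak_topology X) {\<mu> \<in> borel_prob_measures X. (\<integral>x. \<psi> x \<partial>\<mu>) \<in> U}"
  unfolding weak_topology_def openin_topology_generated_by_iff
  by (rule generate_topology_on.Basis) (use assms in blast)

lemma topspace_weak_topology_subset: "topspace (weak_topology X) \<subseteq> borel_prob_measures X"
  unfolding weak_topology_def topology_generated_by_topspace by auto

text \<open>What remains of sequential compactness when the topology need not be metrizable.\<close>

lemma compactin_cluster_point:
  fixes \<kappa> :: "nat \<Rightarrow> 'a"
  assumes "compactin X K" and "\<And>k. \<kappa> k \<in> K"
  shows "\<exists>\<mu>\<in>K. \<forall>U. openin X U \<longrightarrow> \<mu> \<in> U \<longrightarrow> (\<forall>n. \<exists>k\<ge>n. \<kappa> k \<in> U)"
proof (rule ccontr)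
  assume neg: "\<not> ?thesis"
  have "\<exists>U. openin X U \<and> \<mu> \<in> U \<and> (\<forall>\<^sub>F k in sequentially. \<kappa> k \<notin> U)" if "\<mu> \<in> K" for \<mu>
  proof -
    have "\<not> (\<forall>U. openin X U \<longrightarrow> \<mu> \<in> U \<longrightarrow> (\<forall>n. \<exists>k\<ge>n. \<kappa> k \<in> U))"
      by (rule notI, rule notE[OF neg], rule bexI[OF _ that])
    then show ?thesis unfolding eventually_sequentially not_all not_imp by simp
  qed
  then obtain U where U: "\<And>\<mu>. \<mu> \<in> K \<Longrightarrow> openin X (U \<mu>)" "\<And>\<mu>. \<mu> \<in> K \<Longrightarrow> \<mu> \<in> U \<mu>"
      "\<And>\<mu>. \<mu> \<in> K \<Longrightarrow> \<forall>\<^sub>F k in sequentially. \<kappa> k \<notin> U \<mu>"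
    by metis
  have "openin X V" if "V \<in> U ` K" for V using that U(1) by auto
  moreover have "K \<subseteq> \<Union>(U ` K)" using U(2) by auto
  ultimately have "\<exists>\<F>. finite \<F> \<and> \<F> \<subseteq> U ` K \<and> K \<subseteq> \<Union>\<F>"
    by (rule compactinD[OF assms(1)])
  then obtain \<F> where \<F>: "finite \<F>" "\<F> \<subseteq> U ` K" "K \<subseteq> \<Union>\<F>"
    by (elim exE conjE)
  from finite_subset_image[OF \<F>(1,2)] obtain C where C: "C \<subseteq> K" "finite C" "\<F> = U ` C"
    by (elim exE conjE)
  have "\<forall>\<^sub>F k in sequentially. \<forall>\<mu>\<in>C. \<kappa> k \<notin> U \<mu>"
    using U(3) C(1) by (intro eventually_ball_finite[OF C(2)]) auto
  from eventually_happens'[OF sequentially_bot this]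
  obtain k where k: "\<forall>\<mu>\<in>C. \<kappa> k \<notin> U \<mu>" ..
  have "\<kappa> k \<in> \<Union>\<F>" using assms(2)[of k] \<F>(3) by blast
  then show False using k C(3) by blast
qed

section \<open>The uniform gap\<close>

definition avg :: "'m measure \<Rightarrow> ('m \<Rightarrow> real) \<Rightarrow> ('m \<Rightarrow> 'm) \<Rightarrow> real" where
  "avg \<nu> \<phi> f = (\<integral>x. \<phi> (f x) \<partial>\<nu>)"

text \<open>The variance of \<open>avg \<nu> \<phi> f\<close> for random \<open>f\<close>. It vanishes for all continuous \<open>\<phi>\<close> only if the image of
  \<open>\<nu>\<close> under \<open>f\<close> is almost surely the same measure.\<close>

definition spread :: "('m \<Rightarrow> 'm) measure \<Rightarrow> 'm measure \<Rightarrow> ('m \<Rightarrow> real) \<Rightarrow> real" where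
  "spread \<mu> \<nu> \<phi> = (\<integral>f. (avg \<nu> \<phi> f)\<^sup>2 \<partial>\<mu>) - (\<integral>f. avg \<nu> \<phi> f \<partial>\<mu>)\<^sup>2"

lemma avg_unit:
  assumes \<nu>: "prob_space \<nu>" and \<phi>: "\<And>x. \<phi> x \<in> {0..1}"
  shows "avg \<nu> \<phi> f \<in> {0..1}"
proof -
  interpret \<nu>: prob_space \<nu> by fact
  have "(\<integral>x. \<phi> (f x) \<partial>\<nu>) \<le> 1"
  proof (cases "integrable \<nu> (\<lambda>x. \<phi> (f x))")
    case True
    then have "(\<integral>x. \<phi> (f x) \<partial>\<nu>) \<le> (\<integral>x. 1 \<partial>\<nu>)" using \<phi> by (intro integral_mono) auto
    then show ?thesis by (simp add: \<nu>.prob_space)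
  qed (simp add: not_integrable_integral_eq)
  moreover have "(\<integral>x. \<phi> (f x) \<partial>\<nu>) \<ge> 0" using \<phi> by (intro integral_nonneg_AE) auto
  ultimately show ?thesis by (simp add: avg_def)
qed

text \<open>The property of the \<open>C\<^sup>1\<close> topology on which the compactness argument rests:
  \<open>f \<mapsto> \<phi> \<circ> f\<close> is continuous for the supremum norm.\<close>

definition uniform_evaluation :: "('m::topological_space \<Rightarrow> 'm) topology \<Rightarrow> bool" where
  "uniform_evaluation T \<longleftrightarrow> (\<forall>f\<in>topspace T. continuous_on UNIV f) \<and>
     (\<forall>f\<in>topspace T. \<forall>\<phi> :: 'm \<Rightarrow> real. \<forall>e>0. continuous_on UNIV \<phi> \<longrightarrow>
        (\<exists>W. openin T W \<and> f \<in> W \<and> (\<forall>g\<in>W. \<forall>x. \<bar>\<phi> (g x) - \<phi> (f x)\<bar> \<le> e)))"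

lemma uniform_evaluation_nhd:
  assumes "uniform_evaluation T" "f \<in> topspace T" "continuous_on UNIV (\<phi> :: _ \<Rightarrow> real)" "e > 0"
  shows "\<exists>W. openin T W \<and> f \<in> W \<and> (\<forall>g\<in>W. \<forall>x. \<bar>\<phi> (g x) - \<phi> (f x)\<bar> \<le> e)"
  using assms by (simp add: uniform_evaluation_def)

lemma uniform_evaluation_continuous:
  "uniform_evaluation T \<Longrightarrow> f \<in> topspace T \<Longrightarrow> continuous_on UNIV f"
  by (simp add: uniform_evaluation_def)

lemma continuous_map_sup_Lipschitz:
  fixes \<Psi> :: "('m::topological_space \<Rightarrow> 'm) \<Rightarrow> real"
  assumes T: "uniform_evaluation T" and \<phi>: "continuous_on UNIV \<phi>"
    and lip: "\<And>f g e. f \<in> topspace T \<Longrightarrow> g \<in> topspace T \<Longrightarrow> e \<ge> 0 \<Longrightarrow>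
      (\<And>x. \<bar>\<phi> (g x) - \<phi> (f x)\<bar> \<le> e) \<Longrightarrow> \<bar>\<Psi> g - \<Psi> f\<bar> \<le> C * e"
  shows "continuous_map T euclideanreal \<Psi>"
proof -
  have "openin T {f \<in> topspace T. \<Psi> f \<in> U}" if U: "open U" for U
  proof (subst openin_subopen, rule ballI)
    fix f assume f: "f \<in> {f \<in> topspace T. \<Psi> f \<in> U}"
    then obtain d where d: "d > 0" "\<And>t. \<bar>t - \<Psi> f\<bar> < d \<Longrightarrow> t \<in> U"
      using U unfolding open_dist by (auto simp: dist_real_def)
    define e where "e = d / (2 * (\<bar>C\<bar> + 1))"
    have e: "e > 0" using d(1) by (simp add: e_def)
    have fT: "f \<in> topspace T" using f by simp
    from uniform_evaluation_nhd[OF T fT \<phi> e]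
    obtain W where W: "openin T W" "f \<in> W" "\<forall>g\<in>W. \<forall>x. \<bar>\<phi> (g x) - \<phi> (f x)\<bar> \<le> e"
      by (elim exE conjE)
    have "C * e \<le> (\<bar>C\<bar> + 1) * e" using e by (intro mult_right_mono) auto
    also have "\<dots> = d / 2"
    proof -
      have "c * (d / (2 * c)) = d / 2" if "c \<noteq> 0" for c :: real using that by simp
      moreover have "\<bar>C\<bar> + 1 \<noteq> 0" by linarith
      ultimately show ?thesis unfolding e_def by blast
    qed
    also have "\<dots> < d" using d(1) by simp
    finally have small: "C * e < d" .
    have "g \<in> {f \<in> topspace T. \<Psi> f \<in> U}" if "g \<in> W" for g
    proof -
      have g: "g \<in> topspace T" using openin_subset[OF W(1)] that by blast
      have "\<bar>\<phi> (g x) - \<phi> (f x)\<bar> \<le> e" for x using W(3) that by simp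
      then have "\<bar>\<Psi> g - \<Psi> f\<bar> \<le> C * e" using lip[OF fT g] e by simp
      then show ?thesis using small d(2)[of "\<Psi> g"] g by simp
    qed
    then show "\<exists>W. openin T W \<and> f \<in> W \<and> W \<subseteq> {f \<in> topspace T. \<Psi> f \<in> U}"
      using W(1,2) by blast
  qed
  then show ?thesis by (simp add: continuous_map_def)
qed

lemma continuous_map_avg:
  fixes \<nu> :: "'m::topological_space measure"
  assumes T: "uniform_evaluation T" and \<phi>: "continuous_on UNIV \<phi>" "\<And>x. \<phi> x \<in> {0..1}"
    and \<nu>: "prob_space \<nu>" "sets \<nu> = sets borel"
  shows "continuous_map T euclideanreal (avg \<nu> \<phi>)"
    and "avg \<nu> \<phi> f \<in> {0..1}"
    and "f \<in> topspace T \<Longrightarrow> (\<lambda>x. \<phi> (f x)) \<in> borel_measurable borel"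
proof -
  interpret \<nu>: prob_space \<nu> by fact
  have meas: "(\<lambda>x. \<phi> (f x)) \<in> borel_measurable borel" if "f \<in> topspace T" for f
  proof -
    have "continuous_on UNIV f" by (rule uniform_evaluation_continuous[OF T that])
    then have "continuous_on UNIV (\<lambda>x. \<phi> (f x))"
      by (rule continuous_on_compose2[OF \<phi>(1)]) simp
    then show ?thesis by (rule borel_measurable_continuous_onI)
  qed
  have int: "integrable \<nu> (\<lambda>x. \<phi> (f x))" if "f \<in> topspace T" for f
    by (rule \<nu>.integrable_const_bound[of _ 1])
       (use \<phi>(2) meas[OF that] \<nu>(2) in \<open>auto cong: measurable_cong_sets\<close>)
  show "continuous_map T euclideanreal (avg \<nu> \<phi>)"
  proof (rule continuous_map_sup_Lipschitz[OF T \<phi>(1), where C=1])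
    fix f g e assume *: "f \<in> topspace T" "g \<in> topspace T" "e \<ge> (0::real)" "\<And>x. \<bar>\<phi> (g x) - \<phi> (f x)\<bar> \<le> e"
    have "\<bar>avg \<nu> \<phi> g - avg \<nu> \<phi> f\<bar> = \<bar>\<integral>x. \<phi> (g x) - \<phi> (f x) \<partial>\<nu>\<bar>"
      unfolding avg_def by (subst Bochner_Integration.integral_diff) (use int * in auto)
    also have "\<dots> \<le> (\<integral>x. \<bar>\<phi> (g x) - \<phi> (f x)\<bar> \<partial>\<nu>)" by (rule integral_abs_bound)
    also have "\<dots> \<le> (\<integral>x. e \<partial>\<nu>)"
      by (rule integral_mono) (use int * in auto)
    finally show "\<bar>avg \<nu> \<phi> g - avg \<nu> \<phi> f\<bar> \<le> 1 * e" by (simp add: \<nu>.prob_space)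
  qed
  show "f \<in> topspace T \<Longrightarrow> (\<lambda>x. \<phi> (f x)) \<in> borel_measurable borel" by (rule meas)
  show "avg \<nu> \<phi> f \<in> {0..1}" by (rule avg_unit[OF \<nu>(1) \<phi>(2)])
qed

lemma spread_perturbation:
  assumes \<mu>: "prob_space \<mu>" and m: "avg \<nu> \<phi> \<in> borel_measurable \<mu>" "avg \<nu>' \<phi> \<in> borel_measurable \<mu>" "D \<in> borel_measurable \<mu>"
    and b: "\<And>f. avg \<nu> \<phi> f \<in> {0..1}" "\<And>f. avg \<nu>' \<phi> f \<in> {0..1}" "\<And>f. f \<in> space \<mu> \<Longrightarrow> D f \<in> {0..1}"
    and d: "\<And>f. f \<in> space \<mu> \<Longrightarrow> \<bar>avg \<nu> \<phi> f - avg \<nu>' \<phi> f\<bar> \<le> D f"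
  shows "\<bar>spread \<mu> \<nu> \<phi> - spread \<mu> \<nu>' \<phi>\<bar> \<le> 4 * (\<integral>f. D f \<partial>\<mu>)"
proof -
  interpret prob_space \<mu> by fact
  let ?X = "avg \<nu> \<phi>" and ?Y = "avg \<nu>' \<phi>"
  have i: "integrable \<mu> ?X" "integrable \<mu> ?Y" "integrable \<mu> D"
    by (rule integrable_const_bound[of _ 1]; use m b in auto)+
  have i2: "integrable \<mu> (\<lambda>f. (?X f)\<^sup>2)" "integrable \<mu> (\<lambda>f. (?Y f)\<^sup>2)"
    by (rule integrable_const_bound[of _ 1]; use m b in \<open>auto simp: abs_square_le_1\<close>)+
  have sq: "\<bar>a\<^sup>2 - c\<^sup>2\<bar> \<le> 2 * \<bar>a - c\<bar>" if "a \<in> {0..1}" "c \<in> {0..1}" for a c :: real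
  proof -
    have "\<bar>a\<^sup>2 - c\<^sup>2\<bar> = \<bar>a - c\<bar> * \<bar>a + c\<bar>" by (simp add: power2_eq_square abs_mult[symmetric] algebra_simps)
    also have "\<dots> \<le> \<bar>a - c\<bar> * 2" using that by (intro mult_left_mono) auto
    finally show ?thesis by simp
  qed
  have E: "expectation ?X \<in> {0..1}" "expectation ?Y \<in> {0..1}"
    using b(1,2) integral_mono[OF i(1), of "\<lambda>_. 1"] integral_mono[OF i(2), of "\<lambda>_. 1"]
    by (auto simp: prob_space intro!: integral_nonneg_AE)
  have D0: "\<bar>expectation ?X - expectation ?Y\<bar> \<le> expectation D"
  proof -
    have "\<bar>expectation ?X - expectation ?Y\<bar> = \<bar>\<integral>f. ?X f - ?Y f \<partial>\<mu>\<bar>" using i by simp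
    also have "\<dots> \<le> (\<integral>f. \<bar>?X f - ?Y f\<bar> \<partial>\<mu>)" by (rule integral_abs_bound)
    also have "\<dots> \<le> expectation D" using i d by (intro integral_mono) auto
    finally show ?thesis .
  qed
  have "\<bar>(\<integral>f. (?X f)\<^sup>2 \<partial>\<mu>) - (\<integral>f. (?Y f)\<^sup>2 \<partial>\<mu>)\<bar> = \<bar>\<integral>f. (?X f)\<^sup>2 - (?Y f)\<^sup>2 \<partial>\<mu>\<bar>" using i2 by simp
  also have "\<dots> \<le> (\<integral>f. \<bar>(?X f)\<^sup>2 - (?Y f)\<^sup>2\<bar> \<partial>\<mu>)" by (rule integral_abs_bound)
  also have "\<dots> \<le> (\<integral>f. 2 * D f \<partial>\<mu>)"
  proof (rule integral_mono)
    fix f assume "f \<in> space \<mu>"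
    then show "\<bar>(?X f)\<^sup>2 - (?Y f)\<^sup>2\<bar> \<le> 2 * D f" using sq[OF b(1,2), of f f] d[of f] by simp
  qed (use i i2 in auto)
  finally have "\<bar>(\<integral>f. (?X f)\<^sup>2 \<partial>\<mu>) - (\<integral>f. (?Y f)\<^sup>2 \<partial>\<mu>)\<bar> \<le> 2 * expectation D" by simp
  moreover have "\<bar>(expectation ?X)\<^sup>2 - (expectation ?Y)\<^sup>2\<bar> \<le> 2 * expectation D"
    by (rule order_trans[OF sq[OF E]]) (use D0 in simp)
  ultimately show ?thesis unfolding spread_def by linarith
qed

lemma spread_eq_variance:
  assumes "prob_space \<mu>" "avg \<nu> \<phi> \<in> borel_measurable \<mu>" "\<And>f. avg \<nu> \<phi> f \<in> {0..1}"
  shows "spread \<mu> \<nu> \<phi> = (\<integral>f. (avg \<nu> \<phi> f - (\<integral>g. avg \<nu> \<phi> g \<partial>\<mu>))\<^sup>2 \<partial>\<mu>)"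
proof -
  interpret prob_space \<mu> by fact
  have i: "integrable \<mu> (avg \<nu> \<phi>)"
    by (rule integrable_const_bound[of _ 1]) (use assms(2,3) in auto)
  have i2: "integrable \<mu> (\<lambda>f. (avg \<nu> \<phi> f)\<^sup>2)"
    by (rule integrable_const_bound[of _ 1]) (use assms(2,3) in \<open>auto simp: abs_square_le_1\<close>)
  show ?thesis unfolding spread_def using variance_eq[OF i i2] by simp
qed

text \<open>Along a coupling \<open>x k \<rightarrow> y\<close> the spread is continuous in both arguments at once: the error made
  by replacing \<open>x k\<close> with \<open>y\<close> is dominated by \<open>worst\<close>, one continuous function of \<open>f\<close>, and weak
  convergence controls its integral uniformly along the sequence.\<close>

lemma spread_cluster_zero:
  fixes \<kappa> :: "nat \<Rightarrow> ('m::t2_space \<Rightarrow> 'm) measure"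
  assumes T: "uniform_evaluation T" and \<phi>: "continuous_on UNIV \<phi>" "\<And>x. \<phi> x \<in> {0..1}"
    and \<Omega>: "prob_space \<Omega>"
    and x: "\<And>k. x k \<in> measurable \<Omega> borel" and y: "y \<in> measurable \<Omega> borel"
    and lim: "AE u in \<Omega>. (\<lambda>k. x k u) \<longlonglongrightarrow> y u"
    and \<mu>: "\<mu> \<in> borel_prob_measures T" and \<kappa>: "\<And>k. \<kappa> k \<in> borel_prob_measures T"
    and cluster: "\<And>U n. openin (weak_topology T) U \<Longrightarrow> \<mu> \<in> U \<Longrightarrow> \<exists>k\<ge>n. \<kappa> k \<in> U"
    and small: "(\<lambda>k. b k) \<longlonglongrightarrow> 0" "\<And>k. spread (\<kappa> k) (distr \<Omega> borel (x k)) \<phi> < b k"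
  shows "spread \<mu> (distr \<Omega> borel y) \<phi> \<le> 0"
proof (rule field_le_epsilon)
  interpret \<Omega>: prob_space \<Omega> by fact
  let ?P = "\<lambda>k. distr \<Omega> borel (x k)" and ?Q = "distr \<Omega> borel y"
  have p: "prob_space (?P k)" "prob_space ?Q" for k
    using x y by (auto intro: \<Omega>.prob_space_distr)
  note c = continuous_map_avg[OF T \<phi> p(1)] and c0 = continuous_map_avg[OF T \<phi> p(2)]
  have mf: "(\<lambda>z. \<phi> (f z)) \<in> borel_measurable borel" if "f \<in> topspace T" for f
    using c0(3)[OF _ that] by simp
  have av: "avg (?P k) \<phi> f = (\<integral>u. \<phi> (f (x k u)) \<partial>\<Omega>)" "avg ?Q \<phi> f = (\<integral>u. \<phi> (f (y u)) \<partial>\<Omega>)"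
    if "f \<in> topspace T" for f k
    unfolding avg_def using mf[OF that] x y by (auto simp: integral_distr)
  define a where "a k f = (\<integral>u. \<bar>\<phi> (f (x k u)) - \<phi> (f (y u))\<bar> \<partial>\<Omega>)" for k f
  define worst where "worst n f = (SUP k\<in>{n..}. a k f)" for n f
  have mx: "(\<lambda>u. \<phi> (f (x k u))) \<in> borel_measurable \<Omega>" "(\<lambda>u. \<phi> (f (y u))) \<in> borel_measurable \<Omega>"
    if "f \<in> topspace T" for f k
    using measurable_compose[OF x mf[OF that]] measurable_compose[OF y mf[OF that]] by auto
  have ix: "integrable \<Omega> (\<lambda>u. \<phi> (f (x k u)))" "integrable \<Omega> (\<lambda>u. \<phi> (f (y u)))"
    if "f \<in> topspace T" for f k
    by (rule \<Omega>.integrable_const_bound[of _ 1]; use mx[OF that] \<phi>(2) in auto)+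
  have abs1: "\<bar>\<phi> z - \<phi> w\<bar> \<le> 1" for z w using \<phi>(2)[of z] \<phi>(2)[of w] by auto
  have a01: "a k f \<in> {0..1}" if "f \<in> topspace T" for k f
  proof -
    have "a k f \<le> (\<integral>u. 1 \<partial>\<Omega>)" unfolding a_def
      by (rule integral_mono) (use ix[OF that] abs1 in auto)
    moreover have "a k f \<ge> 0" unfolding a_def by simp
    ultimately show ?thesis by (simp add: \<Omega>.prob_space)
  qed
  have bdd: "bdd_above ((\<lambda>k. a k f) ` {n..})" if "f \<in> topspace T" for f n
    using a01[OF that] by (intro bdd_aboveI[of _ 1]) auto
  have aw: "a k f \<le> worst n f" if "f \<in> topspace T" "k \<ge> n" for k n f
    unfolding worst_def using bdd[OF that(1)] that(2) by (intro cSUP_upper) auto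
  have w01: "worst n f \<in> {0..1}" if "f \<in> topspace T" for n f
  proof -
    have "worst n f \<le> 1" unfolding worst_def using a01[OF that] by (intro cSUP_least) auto
    moreover have "0 \<le> worst n f" using aw[OF that order_refl, of n] a01[OF that, of n] by simp
    ultimately show ?thesis by simp
  qed
  have wcont: "continuous_map T euclideanreal (worst n)" for n
  proof (rule continuous_map_sup_Lipschitz[OF T \<phi>(1), where C=2])
    have half: "worst n g \<le> worst n f + 2 * e"
      if h: "f \<in> topspace T" "g \<in> topspace T" "\<And>x. \<bar>\<phi> (g x) - \<phi> (f x)\<bar> \<le> e" for f g e
    proof -
      have "a k g \<le> worst n f + 2 * e" if k: "k \<in> {n..}" for k
      proof -
        have "a k g \<le> (\<integral>u. \<bar>\<phi> (f (x k u)) - \<phi> (f (y u))\<bar> + 2 * e \<partial>\<Omega>)"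
          unfolding a_def
        proof (rule integral_mono)
          fix u
          show "\<bar>\<phi> (g (x k u)) - \<phi> (g (y u))\<bar> \<le> \<bar>\<phi> (f (x k u)) - \<phi> (f (y u))\<bar> + 2 * e"
            using h(3)[of "x k u"] h(3)[of "y u"] by linarith
        qed (use ix[OF h(1)] ix[OF h(2)] in auto)
        also have "\<dots> = a k f + 2 * e"
          unfolding a_def using ix[OF h(1)] by (simp add: \<Omega>.prob_space)
        finally show ?thesis using aw[OF h(1), of n k] k by simp
      qed
      then show ?thesis unfolding worst_def[of n g] by (intro cSUP_least) auto
    qed
    fix f g e assume *: "f \<in> topspace T" "g \<in> topspace T" "e \<ge> (0::real)" "\<And>x. \<bar>\<phi> (g x) - \<phi> (f x)\<bar> \<le> e"
    have **: "\<bar>\<phi> (f x) - \<phi> (g x)\<bar> \<le> e" for x using *(4)[of x] by (simp add: abs_minus_commute)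
    show "\<bar>worst n g - worst n f\<bar> \<le> 2 * e"
      using half[OF *(1,2,4)] half[OF *(2,1) **] by linarith
  qed
  have wlim: "(\<lambda>n. worst n f) \<longlonglongrightarrow> 0" if f: "f \<in> topspace T" for f
  proof -
    have cf: "isCont (\<lambda>z. \<phi> (f z)) w" for w
    proof -
      have "continuous_on UNIV f" by (rule uniform_evaluation_continuous[OF T f])
      then have "continuous_on UNIV (\<lambda>x. \<phi> (f x))"
        by (rule continuous_on_compose2[OF \<phi>(1)]) simp
      then show ?thesis using continuous_on_eq_continuous_at[OF open_UNIV] by blast
    qed
    have "(\<lambda>k. a k f) \<longlonglongrightarrow> (\<integral>u. 0 \<partial>\<Omega>)"
      unfolding a_def
    proof (rule integral_dominated_convergence[where w="\<lambda>_. 1"])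
      show "AE u in \<Omega>. (\<lambda>k. \<bar>\<phi> (f (x k u)) - \<phi> (f (y u))\<bar>) \<longlonglongrightarrow> 0"
        using lim
      proof eventually_elim
        case (elim u)
        have "(\<lambda>k. \<phi> (f (x k u))) \<longlonglongrightarrow> \<phi> (f (y u))"
          by (rule isCont_tendsto_compose[OF cf elim])
        then show ?case using tendsto_rabs_zero Lim_null by blast
      qed
    qed (use mx[OF f] abs1 in auto)
    then have lim0: "(\<lambda>k. a k f) \<longlonglongrightarrow> 0" by simp
    show ?thesis
    proof (rule LIMSEQ_I)
      fix e :: real assume "e > 0"
      then obtain N where N: "\<And>k. k \<ge> N \<Longrightarrow> \<bar>a k f\<bar> < e / 2"
        using LIMSEQ_D[OF lim0, of "e/2"] by auto
      have "norm (worst n f - 0) < e" if "n \<ge> N" for n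
      proof -
        have "worst n f \<le> e / 2"
          unfolding worst_def
        proof (rule cSUP_least)
          fix k assume "k \<in> {n..}"
          then show "a k f \<le> e / 2" using N[of k] that by simp
        qed simp
        then show ?thesis using w01[OF f, of n] \<open>e > 0\<close> by auto
      qed
      then show "\<exists>no. \<forall>n\<ge>no. norm (worst n f - 0) < e" by blast
    qed
  qed
  have probT: "prob_space M" "sets M = sets (borel_of T)" "space M = topspace T"
    if "M \<in> borel_prob_measures T" for M
    using that sets_eq_imp_space_eq[of M "borel_of T"] by (auto simp: borel_prob_measures_def borel_of_space)
  have wmu: "(\<lambda>n. \<integral>f. worst n f \<partial>\<mu>) \<longlonglongrightarrow> (\<integral>f. 0 \<partial>\<mu>)"
  proof (rule integral_dominated_convergence[where w="\<lambda>_. 1"])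
    show "AE f in \<mu>. (\<lambda>n. worst n f) \<longlonglongrightarrow> 0" using wlim probT(3)[OF \<mu>] by auto
    show "worst n \<in> borel_measurable \<mu>" for n by (rule measurable_continuous_map[OF wcont probT(2)[OF \<mu>]])
    show "AE f in \<mu>. norm (worst n f) \<le> 1" for n using w01 probT(3)[OF \<mu>] by auto
    show "integrable \<mu> (\<lambda>_. 1 :: real)"
      using prob_space.finite_measure[OF probT(1)[OF \<mu>]] by (rule finite_measure.integrable_const)
  qed simp
  fix e :: real assume e: "e > 0"
  \<comment> \<open>The errors below add up to less than \<open>8 * \<eta>\<close>.\<close>
  define \<eta> where "\<eta> = e / 10"
  have \<eta>: "\<eta> > 0" using e by (simp add: \<eta>_def)
  have "\<forall>\<^sub>F n in sequentially. (\<integral>f. worst n f \<partial>\<mu>) < \<eta> \<and> (\<forall>k\<ge>n. b k < \<eta>)"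
  proof (rule eventually_conj)
    show "\<forall>\<^sub>F n in sequentially. (\<integral>f. worst n f \<partial>\<mu>) < \<eta>"
      using order_tendstoD(2)[OF wmu, of \<eta>] \<eta> by simp
    show "\<forall>\<^sub>F n in sequentially. \<forall>k\<ge>n. b k < \<eta>"
      using order_tendstoD(2)[OF small(1) \<eta>] by (simp add: eventually_all_ge_at_top)
  qed
  from eventually_happens'[OF sequentially_bot this]
  obtain n where "(\<integral>f. worst n f \<partial>\<mu>) < \<eta> \<and> (\<forall>k\<ge>n. b k < \<eta>)" ..
  then have n: "(\<integral>f. worst n f \<partial>\<mu>) < \<eta>" "\<And>k. k \<ge> n \<Longrightarrow> b k < \<eta>" by simp_all
  let ?X = "avg ?Q \<phi>"
  have sb: "sets ?Q = sets borel" "sets (?P k) = sets borel" for k by auto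
  have X: "continuous_map T euclideanreal ?X" "\<And>f. ?X f \<in> {0..1}" using c0(1,2)[OF sb(1)] by auto
  \<comment> \<open>The members of \<open>W\<close> nearly agree with \<open>\<mu>\<close> on the three integrals that enter the estimate.\<close>
  define W where "W = {M \<in> borel_prob_measures T. (\<integral>f. worst n f \<partial>M) \<in> {..<\<eta>}} \<inter>
     ({M \<in> borel_prob_measures T. (\<integral>f. (?X f)\<^sup>2 \<partial>M) \<in> ball (\<integral>f. (?X f)\<^sup>2 \<partial>\<mu>) \<eta>} \<inter>
      {M \<in> borel_prob_measures T. (\<integral>f. ?X f \<partial>M) \<in> ball (\<integral>f. ?X f \<partial>\<mu>) \<eta>})"
  have "openin (weak_topology T) W"
    unfolding W_def
  proof (intro openin_Int openin_weak_topology)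
    show "bounded (worst n ` topspace T)" "bounded (?X ` topspace T)"
      using w01 X(2) by (auto intro!: boundedI[of _ 1])
    show "bounded ((\<lambda>f. (?X f)\<^sup>2) ` topspace T)"
      using X(2) by (auto intro!: boundedI[of _ 1] simp: abs_square_le_1)
    show "continuous_map T euclideanreal (\<lambda>f. (?X f)\<^sup>2)"
      using X(1) by (rule continuous_map_real_pow)
  qed (use wcont X(1) in auto)
  moreover have "\<mu> \<in> W" using \<mu> n(1) \<eta> by (simp add: W_def)
  ultimately have "\<exists>k\<ge>n. \<kappa> k \<in> W" by (rule cluster)
  then obtain k where k: "k \<ge> n" "\<kappa> k \<in> W" by (elim exE conjE)
  note K = probT[OF \<kappa>[of k]]
  have sp: "\<bar>spread (\<kappa> k) (?P k) \<phi> - spread (\<kappa> k) ?Q \<phi>\<bar> \<le> 4 * (\<integral>f. worst n f \<partial>\<kappa> k)"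
  proof (rule spread_perturbation[OF K(1)])
    show "avg (?P k) \<phi> \<in> borel_measurable (\<kappa> k)" "?X \<in> borel_measurable (\<kappa> k)" "worst n \<in> borel_measurable (\<kappa> k)"
      using c(1)[OF sb(2)] X(1) wcont by (auto intro: measurable_continuous_map[OF _ K(2)])
    fix f
    show "avg (?P k) \<phi> f \<in> {0..1}" using c(2)[OF sb(2)] .
    show "?X f \<in> {0..1}" using X(2) .
    assume f: "f \<in> space (\<kappa> k)"
    then show "worst n f \<in> {0..1}" using w01 K(3) by auto
    have f': "f \<in> topspace T" using f K(3) by simp
    have "\<bar>avg (?P k) \<phi> f - ?X f\<bar> = \<bar>\<integral>u. \<phi> (f (x k u)) - \<phi> (f (y u)) \<partial>\<Omega>\<bar>"
      unfolding av[OF f'] using ix[OF f'] by simp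
    also have "\<dots> \<le> a k f" unfolding a_def by (rule integral_abs_bound)
    also have "\<dots> \<le> worst n f" by (rule aw[OF f' k(1)])
    finally show "\<bar>avg (?P k) \<phi> f - ?X f\<bar> \<le> worst n f" .
  qed
  have 1: "spread (\<kappa> k) ?Q \<phi> < 5 * \<eta>"
    using abs_le_D2[OF sp] small(2)[of k] n(2)[OF k(1)] k(2) by (simp add: W_def)
  let ?p = "\<integral>f. ?X f \<partial>\<mu>" and ?q = "\<integral>f. ?X f \<partial>\<kappa> k"
  have unit: "(\<integral>f. ?X f \<partial>M) \<in> {0..1}" if "M \<in> borel_prob_measures T" for M
  proof -
    interpret prob_space M using probT(1)[OF that] .
    have "integrable M ?X"
      by (rule integrable_const_bound[of _ 1])
         (use X(2) measurable_continuous_map[OF X(1) probT(2)[OF that]] in auto)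
    from integral_mono[OF this, of "\<lambda>_. 1"] show ?thesis
      using X(2) by (auto simp: prob_space intro!: integral_nonneg_AE)
  qed
  have "\<bar>?p\<^sup>2 - ?q\<^sup>2\<bar> = \<bar>?p - ?q\<bar> * \<bar>?p + ?q\<bar>"
    by (simp add: power2_eq_square abs_mult[symmetric] algebra_simps)
  also have "\<dots> \<le> \<eta> * 2"
    using k(2) unit[OF \<mu>] unit[OF \<kappa>[of k]] \<eta> by (intro mult_mono) (auto simp: W_def dist_real_def)
  finally have "\<bar>?p\<^sup>2 - ?q\<^sup>2\<bar> \<le> 2 * \<eta>" by simp
  moreover have "\<bar>(\<integral>f. (?X f)\<^sup>2 \<partial>\<mu>) - (\<integral>f. (?X f)\<^sup>2 \<partial>\<kappa> k)\<bar> < \<eta>"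
    using k(2) by (simp add: W_def dist_real_def)
  ultimately have "spread \<mu> ?Q \<phi> < 8 * \<eta>"
    using 1 unfolding spread_def by linarith
  then show "spread \<mu> ?Q \<phi> \<le> 0 + e" using e by (simp add: \<eta>_def)
qed

text \<open>Otherwise there are pairs \<open>(\<mu>s k, \<nu>s k)\<close> whose spreads tend to \<open>0\<close>. At a cluster point \<open>(\<mu>, \<nu>)\<close> all
  spreads vanish, so the image of \<open>\<nu>\<close> under \<open>f\<close> does not depend on \<open>f\<close>, almost surely.\<close>

lemma uniform_spread:
  fixes T :: "('m::{t2_space,second_countable_topology} \<Rightarrow> 'm) topology"
  assumes comp: "compact (UNIV :: 'm set)" and T: "uniform_evaluation T"
    and K: "compactin (weak_topology T) K"
    and no: "\<And>\<mu>. \<mu> \<in> K \<Longrightarrow>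
      \<not> (\<exists>\<nu>1 \<nu>2 :: 'm measure. prob_space \<nu>1 \<and> sets \<nu>1 = sets borel \<and>
           prob_space \<nu>2 \<and> sets \<nu>2 = sets borel \<and> (AE f in \<mu>. distr \<nu>1 borel f = \<nu>2))"
  shows "\<exists>e>0. \<forall>\<mu>\<in>K. \<forall>\<nu>. prob_space \<nu> \<longrightarrow> sets \<nu> = sets borel \<longrightarrow>
    (\<exists>\<phi>. continuous_on UNIV \<phi> \<and> (\<forall>x. \<phi> x \<in> {0..1}) \<and> spread \<mu> \<nu> \<phi> \<ge> e)"
proof (rule ccontr)
  assume neg: "\<not> ?thesis"
  have KT: "K \<subseteq> borel_prob_measures T"
    using compactin_subset_topspace[OF K] topspace_weak_topology_subset by blast
  have neg': "\<forall>e>0. \<exists>\<mu>\<in>K. \<exists>\<nu>. prob_space \<nu> \<and> sets \<nu> = sets (borel :: 'm measure) \<and>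
     (\<forall>\<phi>. continuous_on UNIV \<phi> \<longrightarrow> (\<forall>x. \<phi> x \<in> {0..1}) \<longrightarrow> spread \<mu> \<nu> \<phi> < e)"
  proof -
    define test where "test \<phi> = (continuous_on UNIV \<phi> \<and> (\<forall>x. \<phi> x \<in> {0..1::real}))" for \<phi> :: "'m \<Rightarrow> real"
    have "\<not> (\<exists>e>0. \<forall>\<mu>\<in>K. \<forall>\<nu>. prob_space \<nu> \<longrightarrow> sets \<nu> = sets borel \<longrightarrow> (\<exists>\<phi>. test \<phi> \<and> spread \<mu> \<nu> \<phi> \<ge> e))"
      using neg unfolding test_def by (simp only: conj_assoc not_False_eq_True)
    then have "\<forall>e>0. \<exists>\<mu>\<in>K. \<exists>\<nu>. prob_space \<nu> \<and> sets \<nu> = sets (borel :: 'm measure) \<and>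
     (\<forall>\<phi>. test \<phi> \<longrightarrow> spread \<mu> \<nu> \<phi> < e)"
      by (simp add: not_le)
    then show ?thesis unfolding test_def by (simp only: imp_conjL)
  qed
  have "\<exists>p. fst p \<in> K \<and> prob_space (snd p) \<and> sets (snd p) = sets (borel :: 'm measure) \<and>
     (\<forall>\<phi>. continuous_on UNIV \<phi> \<longrightarrow> (\<forall>x. \<phi> x \<in> {0..1}) \<longrightarrow> spread (fst p) (snd p) \<phi> < 1 / real (Suc k))" for k
  proof -
    have "(0::real) < 1 / real (Suc k)" by simp
    from neg'[rule_format, OF this] obtain \<mu> \<nu> where "\<mu> \<in> K" "prob_space \<nu>" "sets \<nu> = sets (borel :: 'm measure)"
      "\<forall>\<phi>. continuous_on UNIV \<phi> \<longrightarrow> (\<forall>x. \<phi> x \<in> {0..1}) \<longrightarrow> spread \<mu> \<nu> \<phi> < 1 / real (Suc k)"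
      by (elim bexE exE conjE)
    then show ?thesis by (intro exI[of _ "(\<mu>, \<nu>)"]) simp
  qed
  then have "\<forall>k. \<exists>p. fst p \<in> K \<and> prob_space (snd p) \<and> sets (snd p) = sets (borel :: 'm measure) \<and>
     (\<forall>\<phi>. continuous_on UNIV \<phi> \<longrightarrow> (\<forall>x. \<phi> x \<in> {0..1}) \<longrightarrow> spread (fst p) (snd p) \<phi> < 1 / real (Suc k))" ..
  from choice[OF this] obtain p where p: "\<forall>k. fst (p k) \<in> K \<and> prob_space (snd (p k)) \<and> sets (snd (p k)) = sets (borel :: 'm measure) \<and>
     (\<forall>\<phi>. continuous_on UNIV \<phi> \<longrightarrow> (\<forall>x. \<phi> x \<in> {0..1}) \<longrightarrow> spread (fst (p k)) (snd (p k)) \<phi> < 1 / real (Suc k))"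
    by (elim exE)
  define \<mu>s \<nu>s where "\<mu>s k = fst (p k)" and "\<nu>s k = snd (p k)" for k
  have s: "\<And>k. \<mu>s k \<in> K" "\<And>k. prob_space (\<nu>s k)" "\<And>k. sets (\<nu>s k) = sets (borel :: 'm measure)"
    and small: "\<And>k \<phi>. continuous_on UNIV \<phi> \<Longrightarrow> (\<forall>x. \<phi> x \<in> {0..1}) \<Longrightarrow> spread (\<mu>s k) (\<nu>s k) \<phi> < 1 / real (Suc k)"
    using p unfolding \<mu>s_def \<nu>s_def by simp_all
  from subsequence_coupling[of \<nu>s, OF comp s(2,3)]
  obtain r and \<Omega> :: "real measure" and x y where r: "strict_mono r" and \<Omega>: "prob_space \<Omega>"
      and xx: "\<forall>k. x k \<in> measurable \<Omega> borel \<and> distr \<Omega> borel (x k) = \<nu>s (r k)"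
      and y: "y \<in> measurable \<Omega> borel" and lim: "AE u in \<Omega>. (\<lambda>k. x k u) \<longlonglongrightarrow> y u"
    by (elim exE conjE)
  from compactin_cluster_point[OF K, of "\<lambda>k. \<mu>s (r k)", OF s(1)]
  obtain \<mu> where \<mu>: "\<mu> \<in> K" and cl: "\<forall>U. openin (weak_topology T) U \<longrightarrow> \<mu> \<in> U \<longrightarrow> (\<forall>n. \<exists>k\<ge>n. \<mu>s (r k) \<in> U)"
    by (elim bexE)
  define \<nu> where "\<nu> = distr \<Omega> borel y"
  have \<nu>: "prob_space \<nu>" "sets \<nu> = sets borel"
    using prob_space.prob_space_distr[OF \<Omega> y] by (auto simp: \<nu>_def)
  have \<mu>T: "\<mu> \<in> borel_prob_measures T" using \<mu> KT by blast
  then have pm: "prob_space \<mu>" "sets \<mu> = sets (borel_of T)" "space \<mu> = topspace T"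
    using sets_eq_imp_space_eq[of \<mu> "borel_of T"] by (auto simp: borel_prob_measures_def borel_of_space)
  interpret prob_space \<mu> by fact
  have const: "AE f in \<mu>. avg \<nu> \<phi> f = (\<integral>g. avg \<nu> \<phi> g \<partial>\<mu>)"
    if \<phi>: "continuous_on UNIV \<phi>" "\<And>x. \<phi> x \<in> {0..1}" for \<phi>
  proof -
    have "spread \<mu> \<nu> \<phi> \<le> 0"
      unfolding \<nu>_def
    proof (rule spread_cluster_zero[OF T \<phi> \<Omega> _ y lim \<mu>T, where \<kappa>="\<lambda>k. \<mu>s (r k)" and b="\<lambda>k. 1 / real (Suc k)"])
      show "x k \<in> measurable \<Omega> borel" for k using xx by simp
      show "\<mu>s (r k) \<in> borel_prob_measures T" for k using s(1) KT by blast
      show "\<exists>k\<ge>n. \<mu>s (r k) \<in> U" if "openin (weak_topology T) U" "\<mu> \<in> U" for U n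
        using cl that by simp
      show "(\<lambda>k. 1 / real (Suc k)) \<longlonglongrightarrow> 0" by (rule lim_1_over_n[THEN LIMSEQ_Suc])
      show "spread (\<mu>s (r k)) (distr \<Omega> borel (x k)) \<phi> < 1 / real (Suc k)" for k
      proof -
        have "spread (\<mu>s (r k)) (\<nu>s (r k)) \<phi> < 1 / real (Suc (r k))" by (intro small allI \<phi>)
        also have "\<dots> \<le> 1 / real (Suc k)"
          using seq_suble[OF r, of k] by (intro divide_left_mono) auto
        finally show ?thesis using xx by simp
      qed
    qed
    moreover note c = continuous_map_avg[OF T \<phi> \<nu>]
    have m: "avg \<nu> \<phi> \<in> borel_measurable \<mu>" by (rule measurable_continuous_map[OF c(1) pm(2)])
    have eq: "spread \<mu> \<nu> \<phi> = (\<integral>f. (avg \<nu> \<phi> f - (\<integral>g. avg \<nu> \<phi> g \<partial>\<mu>))\<^sup>2 \<partial>\<mu>)"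
      by (rule spread_eq_variance[OF pm(1) m c(2)])
    have i: "integrable \<mu> (avg \<nu> \<phi>)"
      by (rule integrable_const_bound[of _ 1]) (use m c(2) in auto)
    have i2: "integrable \<mu> (\<lambda>f. (avg \<nu> \<phi> f)\<^sup>2)"
      by (rule integrable_const_bound[of _ 1]) (use m c(2) in \<open>auto simp: abs_square_le_1\<close>)
    have i3: "integrable \<mu> (\<lambda>f. (avg \<nu> \<phi> f - (\<integral>g. avg \<nu> \<phi> g \<partial>\<mu>))\<^sup>2)"
      using i i2 by (simp add: power2_diff)
    have "(\<integral>f. (avg \<nu> \<phi> f - (\<integral>g. avg \<nu> \<phi> g \<partial>\<mu>))\<^sup>2 \<partial>\<mu>) \<ge> 0"
      by (rule Bochner_Integration.integral_nonneg) simp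
    ultimately have "(\<integral>f. (avg \<nu> \<phi> f - (\<integral>g. avg \<nu> \<phi> g \<partial>\<mu>))\<^sup>2 \<partial>\<mu>) = 0"
      using eq by linarith
    then show ?thesis
      using integral_nonneg_eq_0_iff_AE[OF i3] by simp
  qed
  from countable_determining_family[OF comp]
  obtain \<Phi> :: "('m \<Rightarrow> real) set" where \<Phi>': "countable \<Phi>"
    "\<forall>\<phi>\<in>\<Phi>. continuous_on UNIV \<phi> \<and> (\<forall>x. \<phi> x \<in> {0..1})"
    "\<forall>M N. prob_space M \<longrightarrow> prob_space N \<longrightarrow> sets M = sets borel \<longrightarrow> sets N = sets borel \<longrightarrow>
       (\<forall>\<phi>\<in>\<Phi>. (\<integral>x. \<phi> x \<partial>M) = (\<integral>x. \<phi> x \<partial>N)) \<longrightarrow> M = N"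
    by (elim exE conjE)
  note \<Phi>2 = \<Phi>'(2)[rule_format, THEN conjunct1] and \<Phi>3 = \<Phi>'(2)[rule_format, THEN conjunct2, rule_format]
  note \<Phi>4 = \<Phi>'(3)[rule_format]
  have ae: "AE f in \<mu>. \<forall>\<phi>\<in>\<Phi>. avg \<nu> \<phi> f = (\<integral>g. avg \<nu> \<phi> g \<partial>\<mu>)"
    unfolding AE_ball_countable[OF \<Phi>'(1)] by (intro ballI const \<Phi>2 \<Phi>3)
  have "\<exists>f. f \<in> space \<mu> \<and> (\<forall>\<phi>\<in>\<Phi>. avg \<nu> \<phi> f = (\<integral>g. avg \<nu> \<phi> g \<partial>\<mu>))"
  proof (rule ccontr)
    assume none: "\<not> ?thesis"
    have "AE f in \<mu>. False" using ae AE_space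
    proof eventually_elim
      case (elim f)
      show ?case
        by (rule notE[OF none], rule exI[of _ f], rule conjI[OF elim(2,1)])
    qed
    then show False using AE_False by simp
  qed
  then obtain f0 where "f0 \<in> space \<mu> \<and> (\<forall>\<phi>\<in>\<Phi>. avg \<nu> \<phi> f0 = (\<integral>g. avg \<nu> \<phi> g \<partial>\<mu>))" ..
  then have f0: "f0 \<in> topspace T" "\<And>\<phi>. \<phi> \<in> \<Phi> \<Longrightarrow> avg \<nu> \<phi> f0 = (\<integral>g. avg \<nu> \<phi> g \<partial>\<mu>)"
    using pm(3) by simp_all
  have mT: "f \<in> measurable \<nu> borel" if "f \<in> topspace T" for f
  proof -
    have "continuous_on UNIV f" by (rule uniform_evaluation_continuous[OF T that])
    then have "f \<in> measurable borel borel" by (rule borel_measurable_continuous_onI)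
    then show ?thesis using \<nu>(2) by (simp cong: measurable_cong_sets)
  qed
  have "AE f in \<mu>. distr \<nu> borel f = distr \<nu> borel f0"
    using ae AE_space
  proof eventually_elim
    case (elim f)
    have f: "f \<in> topspace T" using elim pm(3) by simp
    show ?case
    proof (rule \<Phi>4)
      show "prob_space (distr \<nu> borel f)" "prob_space (distr \<nu> borel f0)"
        using prob_space.prob_space_distr[OF \<nu>(1) mT[OF f]] prob_space.prob_space_distr[OF \<nu>(1) mT[OF f0(1)]] by auto
      fix \<phi> assume p: "\<phi> \<in> \<Phi>"
      have m: "\<phi> \<in> borel_measurable borel" using \<Phi>2[OF p] by (rule borel_measurable_continuous_onI)
      have "(\<integral>x. \<phi> x \<partial>distr \<nu> borel f) = avg \<nu> \<phi> f" "(\<integral>x. \<phi> x \<partial>distr \<nu> borel f0) = avg \<nu> \<phi> f0"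
        unfolding avg_def using integral_distr[OF mT[OF f] m] integral_distr[OF mT[OF f0(1)] m] by auto
      then show "(\<integral>x. \<phi> x \<partial>distr \<nu> borel f) = (\<integral>x. \<phi> x \<partial>distr \<nu> borel f0)"
        using elim f0(2)[OF p] p by simp
    qed auto
  qed
  moreover have "prob_space (distr \<nu> borel f0)"
    by (rule prob_space.prob_space_distr[OF \<nu>(1) mT[OF f0(1)]])
  ultimately have "\<exists>\<nu>1 \<nu>2 :: 'm measure. prob_space \<nu>1 \<and> sets \<nu>1 = sets borel \<and>
           prob_space \<nu>2 \<and> sets \<nu>2 = sets borel \<and> (AE f in \<mu>. distr \<nu>1 borel f = \<nu>2)"
    by (intro exI[of _ \<nu>] exI[of _ "distr \<nu> borel f0"] conjI \<nu> sets_distr)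
  with no[OF \<mu>] show False by (rule notE)
qed

section \<open>Tilting along a random composition\<close>

lemma abs_ln_le_one: "t \<in> {3/4..5/4} \<Longrightarrow> \<bar>ln t\<bar> \<le> (1::real)"
proof -
  assume t: "t \<in> {3/4..5/4}"
  then have "ln t \<le> t - 1" by (intro ln_le_minus_one) auto
  moreover have "ln (1 / t) \<le> 1 / t - 1" using t by (intro ln_le_minus_one) auto
  moreover have "1 / t \<le> 4 / 3" using t by (auto simp: field_simps)
  moreover have "ln (1 / t) = - ln t" using t by (simp add: ln_div)
  ultimately show ?thesis using t by auto
qed

lemma ln_one_plus_ge: "\<bar>u\<bar> \<le> 1/2 \<Longrightarrow> ln (1 + u) \<ge> u - 2 * u\<^sup>2" for u :: real
  using abs_ln_one_plus_x_minus_x_bound[of u] by (auto simp: abs_le_iff)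

lemma rand_comp_cong: "(\<And>k. k < n \<Longrightarrow> \<omega> k = \<omega>' k) \<Longrightarrow> rand_comp n \<omega> = rand_comp n \<omega>'"
  by (induction n) auto

text \<open>The assumption \<open>change\<close> says that \<open>J f\<close> is at most the Jacobian of \<open>f\<close> relative to \<open>m\<close>; equality in it
  is the change of variables formula.\<close>

locale random_maps =
  fixes X :: "('m::topological_space \<Rightarrow> 'm) measure" and m :: "'m measure"
    and J :: "('m \<Rightarrow> 'm) \<Rightarrow> 'm \<Rightarrow> real"
  assumes m_prob: "prob_space m" and m_sets: "sets m = sets borel"
    and eval: "(\<lambda>p. fst p (snd p)) \<in> measurable (X \<Otimes>\<^sub>M borel) borel"
    and J_measurable: "(\<lambda>p. J (fst p) (snd p)) \<in> borel_measurable (X \<Otimes>\<^sub>M borel)"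
    and J_pos: "f \<in> space X \<Longrightarrow> J f y > 0"
    and change: "f \<in> space X \<Longrightarrow> q \<in> borel_measurable borel \<Longrightarrow>
      (\<integral>\<^sup>+y. q (f y) * ennreal (J f y) \<partial>m) \<le> (\<integral>\<^sup>+y. q y \<partial>m)"
begin

lemma map_measurable: "f \<in> space X \<Longrightarrow> f \<in> measurable borel borel"
  using measurable_compose[OF measurable_Pair1' eval, of f] by simp

lemma avg_measurable:
  assumes "prob_space \<nu>" "sets \<nu> = sets borel" "\<phi> \<in> borel_measurable borel"
  shows "avg \<nu> \<phi> \<in> borel_measurable X"
proof -
  interpret prob_space \<nu> by fact
  note [measurable_cong] = assms(2)
  have "(\<lambda>p. \<phi> (fst p (snd p))) \<in> borel_measurable (X \<Otimes>\<^sub>M \<nu>)"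
    using measurable_compose[OF eval assms(3)] by measurable
  then show ?thesis unfolding avg_def[abs_def]
    by (intro borel_measurable_lebesgue_integral) (simp add: case_prod_beta)
qed

text \<open>The density of the tilted law of \<open>f\<close> given the image point \<open>y\<close>. Its mean over \<open>f\<close> is
  \<open>1\<close> for every fixed \<open>y\<close>. At \<open>y = f z\<close> with random \<open>f\<close> and \<open>z\<close> it is larger on average, because
  \<open>avg \<nu> \<phi> f\<close> is the mean of \<open>\<phi> (f z)\<close> over \<open>z\<close>.\<close>

lemma tilt_exists:
  assumes \<mu>: "prob_space \<mu>" "sets \<mu> = sets X" and \<nu>: "prob_space \<nu>" "sets \<nu> = sets borel"
    and \<phi>: "\<phi> \<in> borel_measurable borel" "\<And>x. \<phi> x \<in> {0..1}"
  shows "\<exists>t. t \<in> borel_measurable (X \<Otimes>\<^sub>M borel) \<and> (\<forall>p. t p \<in> {3/4..5/4}) \<and>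
    (\<forall>y. (\<integral>f. t (f, y) \<partial>\<mu>) = 1) \<and>
    (\<integral>f. (\<integral>z. ln (t (f, f z)) \<partial>\<nu>) \<partial>\<mu>) \<ge> spread \<mu> \<nu> \<phi> / 8"
proof -
  interpret \<mu>: prob_space \<mu> by fact
  interpret \<nu>: prob_space \<nu> by fact
  note [measurable_cong] = \<mu>(2) \<nu>(2)
  note [measurable] = \<phi>(1) avg_measurable[OF \<nu> \<phi>(1)]
  have sp: "space \<mu> = space X" by (rule sets_eq_imp_space_eq[OF \<mu>(2)])
  have phf: "(\<lambda>z. \<phi> (f z)) \<in> borel_measurable \<nu>" if "f \<in> space X" for f
    using measurable_compose[OF map_measurable[OF that] \<phi>(1)] by simp
  have iphf: "integrable \<nu> (\<lambda>z. \<phi> (f z))" if "f \<in> space X" for f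
    by (rule \<nu>.integrable_const_bound[of _ 1]) (use \<phi>(2) phf[OF that] in auto)
  have avg01: "avg \<nu> \<phi> f \<in> {0..1}" for f by (rule avg_unit[OF \<nu>(1) \<phi>(2)])
  have iavg: "integrable \<mu> (avg \<nu> \<phi>)"
    by (rule \<mu>.integrable_const_bound[of _ 1]) (use avg01 in auto)
  define c where "c = (\<integral>f. avg \<nu> \<phi> f \<partial>\<mu>)"
  have c01: "c \<in> {0..1}"
    using integral_mono[OF iavg, of "\<lambda>_. 1"] avg01
    by (auto simp: c_def \<mu>.prob_space intro!: integral_nonneg_AE)
  \<comment> \<open>The factor \<open>1/4\<close> keeps \<open>u\<close> small enough for the lower bound \<open>u - 2 * u\<^sup>2\<close> of \<open>ln (1 + u)\<close>,
    whose quadratic loss is then half of the linear gain.\<close>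
  define u where "u f y = (avg \<nu> \<phi> f - c) * (\<phi> y - c) / 4" for f y
  define t where "t p = 1 + u (fst p) (snd p)" for p
  have ub: "\<bar>u f y\<bar> \<le> 1/4" for f y
  proof -
    have "\<bar>avg \<nu> \<phi> f - c\<bar> * \<bar>\<phi> y - c\<bar> \<le> 1 * 1"
      using avg01[of f] \<phi>(2)[of y] c01 by (intro mult_mono) auto
    then show ?thesis by (simp add: u_def abs_mult)
  qed
  have t_range: "t p \<in> {3/4..5/4}" for p
    using ub[of "fst p" "snd p"] by (auto simp: t_def abs_le_iff)
  have t_meas[measurable]: "t \<in> borel_measurable (X \<Otimes>\<^sub>M borel)"
    unfolding t_def u_def by measurable
  have t_mean: "(\<integral>f. t (f, y) \<partial>\<mu>) = 1" for y
  proof -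
    have "(\<integral>f. t (f, y) \<partial>\<mu>) = (\<integral>f. 1 + (avg \<nu> \<phi> f - c) * ((\<phi> y - c) / 4) \<partial>\<mu>)"
      by (simp add: t_def u_def)
    also have "\<dots> = 1 + (c - c) * ((\<phi> y - c) / 4)"
      using iavg by (simp add: \<mu>.prob_space c_def)
    finally show ?thesis by simp
  qed
  have ev_m: "(\<lambda>p. t (fst p, fst p (snd p))) \<in> borel_measurable (X \<Otimes>\<^sub>M borel)"
    by (rule measurable_compose[OF measurable_Pair[OF measurable_fst eval] t_meas])
  have ev_m\<nu>: "(\<lambda>p. ln (t (fst p, fst p (snd p)))) \<in> borel_measurable (\<mu> \<Otimes>\<^sub>M \<nu>)"
    using ev_m by measurable
  have inner_meas: "(\<lambda>f. \<integral>z. ln (t (f, f z)) \<partial>\<nu>) \<in> borel_measurable \<mu>"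
    using ev_m\<nu> by (intro \<nu>.borel_measurable_lebesgue_integral) (simp add: case_prod_beta)
  have iln: "integrable \<nu> (\<lambda>z. ln (t (f, f z)))" if "f \<in> space X" for f
  proof (rule \<nu>.integrable_const_bound[of _ 1])
    show "AE z in \<nu>. norm (ln (t (f, f z))) \<le> 1" using abs_ln_le_one[OF t_range] by simp
    have "f \<in> space \<mu>" using that sp by simp
    from measurable_compose[OF measurable_Pair1'[OF this] ev_m\<nu>]
    show "(\<lambda>z. ln (t (f, f z))) \<in> borel_measurable \<nu>" by simp
  qed
  have inner_bd: "\<bar>\<integral>z. ln (t (f, f z)) \<partial>\<nu>\<bar> \<le> 1" if "f \<in> space X" for f
  proof -
    have "\<bar>\<integral>z. ln (t (f, f z)) \<partial>\<nu>\<bar> \<le> (\<integral>z. \<bar>ln (t (f, f z))\<bar> \<partial>\<nu>)" by (rule integral_abs_bound)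
    also have "\<dots> \<le> (\<integral>z. 1 \<partial>\<nu>)"
      using iln[OF that] abs_ln_le_one[OF t_range] by (intro integral_mono) auto
    finally show ?thesis by (simp add: \<nu>.prob_space)
  qed
  have inner_ge: "(\<integral>z. ln (t (f, f z)) \<partial>\<nu>) \<ge> (avg \<nu> \<phi> f - c)\<^sup>2 / 8" if f: "f \<in> space X" for f
  proof -
    let ?a = "avg \<nu> \<phi> f - c"
    have "(\<integral>z. ?a * (\<phi> (f z) - c) / 4 - ?a\<^sup>2 / 8 \<partial>\<nu>) \<le> (\<integral>z. ln (t (f, f z)) \<partial>\<nu>)"
    proof (rule integral_mono)
      show "integrable \<nu> (\<lambda>z. ?a * (\<phi> (f z) - c) / 4 - ?a\<^sup>2 / 8)" using iphf[OF f] by simp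
      show "integrable \<nu> (\<lambda>z. ln (t (f, f z)))" by (rule iln[OF f])
      fix z
      have "(u f (f z))\<^sup>2 = ?a\<^sup>2 * (\<phi> (f z) - c)\<^sup>2 / 16"
        by (simp add: u_def power_mult_distrib power_divide)
      also have "\<dots> \<le> ?a\<^sup>2 * 1 / 16"
        using \<phi>(2)[of "f z"] c01
        by (intro divide_right_mono mult_left_mono) (auto simp: abs_square_le_1)
      finally have "2 * (u f (f z))\<^sup>2 \<le> ?a\<^sup>2 / 8" by simp
      moreover have "ln (1 + u f (f z)) \<ge> u f (f z) - 2 * (u f (f z))\<^sup>2"
        using ub[of f "f z"] by (intro ln_one_plus_ge) simp
      ultimately show "?a * (\<phi> (f z) - c) / 4 - ?a\<^sup>2 / 8 \<le> ln (t (f, f z))"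
        by (simp add: t_def u_def)
    qed
    moreover have "(\<integral>z. ?a * (\<phi> (f z) - c) / 4 - ?a\<^sup>2 / 8 \<partial>\<nu>) = ?a * (avg \<nu> \<phi> f - c) / 4 - ?a\<^sup>2 / 8"
      using iphf[OF f] by (simp add: \<nu>.prob_space avg_def)
    ultimately show ?thesis by (simp add: power2_eq_square)
  qed
  have i2: "integrable \<mu> (\<lambda>f. (avg \<nu> \<phi> f - c)\<^sup>2)"
  proof (rule \<mu>.integrable_const_bound[of _ 1])
    have "\<bar>avg \<nu> \<phi> f - c\<bar> \<le> 1" for f using avg01[of f] c01 by auto
    then show "AE f in \<mu>. norm ((avg \<nu> \<phi> f - c)\<^sup>2) \<le> 1" by (simp add: abs_square_le_1)
  qed measurable
  have "spread \<mu> \<nu> \<phi> / 8 = (\<integral>f. (avg \<nu> \<phi> f - c)\<^sup>2 / 8 \<partial>\<mu>)"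
    using spread_eq_variance[OF \<mu>(1), of \<nu> \<phi>] avg01 by (simp add: c_def)
  also have "\<dots> \<le> (\<integral>f. (\<integral>z. ln (t (f, f z)) \<partial>\<nu>) \<partial>\<mu>)"
  proof (rule integral_mono)
    show "integrable \<mu> (\<lambda>f. (avg \<nu> \<phi> f - c)\<^sup>2 / 8)" using i2 by simp
    show "integrable \<mu> (\<lambda>f. \<integral>z. ln (t (f, f z)) \<partial>\<nu>)"
      by (rule \<mu>.integrable_const_bound[of _ 1]) (use inner_bd inner_meas sp in auto)
  qed (use inner_ge sp in auto)
  finally have "spread \<mu> \<nu> \<phi> / 8 \<le> (\<integral>f. (\<integral>z. ln (t (f, f z)) \<partial>\<nu>) \<partial>\<mu>)" .
  then show ?thesis using t_meas t_range t_mean by (intro exI[of _ t]) simp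
qed

text \<open>By the chain rule, the Jacobian of \<open>rand_comp n \<omega>\<close> at \<open>x\<close>.\<close>

definition J_comp :: "nat \<Rightarrow> (nat \<Rightarrow> 'm \<Rightarrow> 'm) \<Rightarrow> 'm \<Rightarrow> real" where
  "J_comp n \<omega> x = (\<Prod>k<n. J (\<omega> k) (rand_comp k \<omega> x))"

lemma J_comp_pos: "(\<And>k. k < n \<Longrightarrow> \<omega> k \<in> space X) \<Longrightarrow> J_comp n \<omega> x > 0"
  unfolding J_comp_def by (intro prod_pos) (auto intro: J_pos)

lemma J_comp_cong: "(\<And>k. k < n \<Longrightarrow> \<omega> k = \<omega>' k) \<Longrightarrow> J_comp n \<omega> = J_comp n \<omega>'"
  unfolding J_comp_def
  by (rule ext, rule prod.cong) (auto intro!: arg_cong2[where f=J] fun_cong[OF rand_comp_cong])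

lemma coordinate_pair_measurable:
  assumes "\<And>k. k < n \<Longrightarrow> sets (M k) = sets X" "{..<n} \<subseteq> I" "k < n"
    and "g \<in> measurable (Pi\<^sub>M I M \<Otimes>\<^sub>M borel) borel"
  shows "(\<lambda>p. (fst p k, g p)) \<in> measurable (Pi\<^sub>M I M \<Otimes>\<^sub>M borel) (X \<Otimes>\<^sub>M borel)"
proof (rule measurable_Pair[OF _ assms(4)])
  have "k \<in> I" using assms(2,3) by auto
  from measurable_compose[OF measurable_fst measurable_component_singleton[OF this, of M]]
  have "(\<lambda>p. fst p k) \<in> measurable (Pi\<^sub>M I M \<Otimes>\<^sub>M borel) (M k)" .
  also have "measurable (Pi\<^sub>M I M \<Otimes>\<^sub>M borel) (M k) = measurable (Pi\<^sub>M I M \<Otimes>\<^sub>M borel) X"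
    by (rule measurable_cong_sets[OF refl assms(1)[OF assms(3)]])
  finally show "(\<lambda>p. fst p k) \<in> measurable (Pi\<^sub>M I M \<Otimes>\<^sub>M borel) X" .
qed

lemma rand_comp_measurable:
  assumes "\<And>k. k < n \<Longrightarrow> sets (M k) = sets X" "{..<n} \<subseteq> I"
  shows "(\<lambda>p. rand_comp n (fst p) (snd p)) \<in> measurable (Pi\<^sub>M I M \<Otimes>\<^sub>M borel) borel"
  using assms
proof (induction n)
  case (Suc n)
  have "(\<lambda>p. rand_comp n (fst p) (snd p)) \<in> measurable (Pi\<^sub>M I M \<Otimes>\<^sub>M borel) borel"
    by (rule Suc.IH) (use Suc.prems in auto)
  from measurable_compose[OF coordinate_pair_measurable[where n="Suc n", OF Suc.prems(1) Suc.prems(2) lessI this] eval]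
  show ?case by simp
qed simp

lemma J_comp_measurable:
  assumes "\<And>k. k < n \<Longrightarrow> sets (M k) = sets X" "{..<n} \<subseteq> I"
  shows "(\<lambda>p. J_comp n (fst p) (snd p)) \<in> borel_measurable (Pi\<^sub>M I M \<Otimes>\<^sub>M borel)"
  unfolding J_comp_def
proof (rule borel_measurable_prod)
  fix k assume "k \<in> {..<n}"
  then have k: "k < n" by simp
  have "(\<lambda>p. rand_comp k (fst p) (snd p)) \<in> measurable (Pi\<^sub>M I M \<Otimes>\<^sub>M borel) borel"
    by (rule rand_comp_measurable) (use assms k in auto)
  from measurable_compose[OF coordinate_pair_measurable[OF assms k this] J_measurable]
  show "(\<lambda>p. J (fst p k) (rand_comp k (fst p) (snd p))) \<in> borel_measurable (Pi\<^sub>M I M \<Otimes>\<^sub>M borel)"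
    by simp
qed

lemma change_comp:
  assumes "\<And>k. k < n \<Longrightarrow> \<omega> k \<in> space X" and "q \<in> borel_measurable borel"
  shows "(\<integral>\<^sup>+x. q (rand_comp n \<omega> x) * ennreal (J_comp n \<omega> x) \<partial>m) \<le> (\<integral>\<^sup>+x. q x \<partial>m)"
  using assms
proof (induction n arbitrary: q)
  case (Suc n)
  let ?q = "\<lambda>y. q (\<omega> n y) * ennreal (J (\<omega> n) y)"
  have \<omega>n: "\<omega> n \<in> space X" using Suc.prems(1) by simp
  have "(\<lambda>y. J (\<omega> n) y) \<in> borel_measurable borel"
    using measurable_compose[OF measurable_Pair1'[OF \<omega>n] J_measurable] by simp
  moreover have "(\<lambda>y. q (\<omega> n y)) \<in> borel_measurable borel"
    using measurable_compose[OF map_measurable[OF \<omega>n] Suc.prems(2)] .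
  ultimately have qm: "?q \<in> borel_measurable borel" by simp
  have "J_comp n \<omega> x \<ge> 0" for x
    using J_comp_pos[of n \<omega> x] Suc.prems(1) by (simp add: less_imp_le)
  then have "(\<integral>\<^sup>+x. q (rand_comp (Suc n) \<omega> x) * ennreal (J_comp (Suc n) \<omega> x) \<partial>m)
      = (\<integral>\<^sup>+x. ?q (rand_comp n \<omega> x) * ennreal (J_comp n \<omega> x) \<partial>m)"
    using J_pos[OF \<omega>n] by (intro nn_integral_cong) (simp add: J_comp_def ennreal_mult' less_imp_le mult_ac prod_nonneg)
  also have "\<dots> \<le> (\<integral>\<^sup>+x. ?q x \<partial>m)"
    by (rule Suc.IH[OF _ qm]) (use Suc.prems(1) in simp)
  also have "\<dots> \<le> (\<integral>\<^sup>+x. q x \<partial>m)" by (rule change[OF \<omega>n Suc.prems(2)])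
  finally show ?case .
qed (simp add: J_comp_def)

text \<open>The total mass of \<open>m\<close> is \<open>1\<close>, so maps cannot expand volume everywhere.\<close>

lemma J_comp_lower_bound:
  assumes "\<And>k. k < n \<Longrightarrow> \<omega> k \<in> space X" and "\<And>x. a \<le> J_comp n \<omega> x"
  shows "a \<le> 1"
proof -
  interpret m: prob_space m by (rule m_prob)
  have "ennreal a = (\<integral>\<^sup>+x. ennreal a \<partial>m)" by (simp add: m.emeasure_space_1)
  also have "\<dots> \<le> (\<integral>\<^sup>+x. 1 * ennreal (J_comp n \<omega> x) \<partial>m)"
    using assms(2) by (intro nn_integral_mono) (simp add: ennreal_leI)
  also have "\<dots> \<le> (\<integral>\<^sup>+x. 1 \<partial>m)" using change_comp[of n \<omega> "\<lambda>_. 1"] assms(1) by simp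
  finally show ?thesis by (simp add: m.emeasure_space_1)
qed

end

lemma borel_measurable_pair_cong:
  assumes "f \<in> borel_measurable (X \<Otimes>\<^sub>M Y)" "sets M = sets X" "sets N = sets Y"
  shows "f \<in> borel_measurable (M \<Otimes>\<^sub>M N)"
  using assms(1) measurable_cong_sets[OF sets_pair_measure_cong[OF assms(2,3)] refl] by blast

lemma bounded_pair_integrable:
  fixes f :: "'a \<times> 'b \<Rightarrow> real"
  assumes "prob_space M" "prob_space N" "f \<in> borel_measurable (M \<Otimes>\<^sub>M N)"
    and bound: "\<forall>p\<in>space (M \<Otimes>\<^sub>M N). \<bar>f p\<bar> \<le> B"
  shows "integrable (M \<Otimes>\<^sub>M N) f"
    and "(\<lambda>x. \<integral>y. f (x, y) \<partial>N) \<in> borel_measurable M"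
    and "x \<in> space M \<Longrightarrow> integrable N (\<lambda>y. f (x, y))"
    and "x \<in> space M \<Longrightarrow> \<bar>\<integral>y. f (x, y) \<partial>N\<bar> \<le> B"
    and "integrable M (\<lambda>x. \<integral>y. f (x, y) \<partial>N)"
    and "(\<integral>y. (\<integral>x. f (x, y) \<partial>M) \<partial>N) = (\<integral>x. (\<integral>y. f (x, y) \<partial>N) \<partial>M)"
    and "(\<integral>x. (\<integral>y. f (x, y) \<partial>N) \<partial>M) = integral\<^sup>L (M \<Otimes>\<^sub>M N) f"
proof -
  interpret M: prob_space M by fact
  interpret N: prob_space N by fact
  interpret P: pair_prob_space M N ..
  show int: "integrable (M \<Otimes>\<^sub>M N) f"
    by (rule P.P.integrable_const_bound[of _ B]) (use assms(3) bound in \<open>auto intro!: AE_I2\<close>)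
  show m: "(\<lambda>x. \<integral>y. f (x, y) \<partial>N) \<in> borel_measurable M"
    using assms(3) by (intro N.borel_measurable_lebesgue_integral) simp
  have sec: "integrable N (\<lambda>y. f (x, y)) \<and> \<bar>\<integral>y. f (x, y) \<partial>N\<bar> \<le> B" if x: "x \<in> space M" for x
  proof
    show i: "integrable N (\<lambda>y. f (x, y))"
    proof (rule N.integrable_const_bound[of _ B])
      show "AE y in N. norm (f (x, y)) \<le> B"
        using bound x by (intro AE_I2) (simp add: space_pair_measure)
      show "(\<lambda>y. f (x, y)) \<in> borel_measurable N"
        by (rule measurable_compose[OF measurable_Pair1'[OF x] assms(3)])
    qed
    have "\<bar>\<integral>y. f (x, y) \<partial>N\<bar> \<le> (\<integral>y. \<bar>f (x, y)\<bar> \<partial>N)" by (rule integral_abs_bound)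
    also have "\<dots> \<le> (\<integral>y. B \<partial>N)"
      using i bound x by (intro integral_mono) (auto simp: space_pair_measure)
    finally show "\<bar>\<integral>y. f (x, y) \<partial>N\<bar> \<le> B" by (simp add: N.prob_space)
  qed
  then show "x \<in> space M \<Longrightarrow> integrable N (\<lambda>y. f (x, y))"
    and "x \<in> space M \<Longrightarrow> \<bar>\<integral>y. f (x, y) \<partial>N\<bar> \<le> B" by blast+
  show "integrable M (\<lambda>x. \<integral>y. f (x, y) \<partial>N)"
    by (rule M.integrable_const_bound[of _ B]) (use sec m in auto)
  show "(\<integral>y. (\<integral>x. f (x, y) \<partial>M) \<partial>N) = (\<integral>x. (\<integral>y. f (x, y) \<partial>N) \<partial>M)"
    by (rule P.Fubini_integral) (simp add: int)
  show "(\<integral>x. (\<integral>y. f (x, y) \<partial>N) \<partial>M) = integral\<^sup>L (M \<Otimes>\<^sub>M N) f"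
    by (rule P.integral_fst'[OF int])
qed

context random_maps
begin

text \<open>The weight \<open>P\<close> is the product of the tilts along the composition: step \<open>k\<close> is tilted for the law
  \<open>\<nu>\<close> of the point reached after \<open>k\<close> steps from a start with law \<open>m\<close>, and gains \<open>h\<close> in the mean of
  \<open>ln P\<close>. The weighted law of the end point, taken with the Jacobian, remains below \<open>m\<close>. The
  number \<open>8\<close> is the loss in the gain of a single tilt.\<close>

lemma tilted_chain:
  assumes \<mu>: "\<And>i. prob_space (\<mu> i)" "\<And>i. sets (\<mu> i) = sets X"
    and gap: "\<And>i \<nu>. i < n \<Longrightarrow> prob_space \<nu> \<Longrightarrow> sets \<nu> = sets borel \<Longrightarrow>
      \<exists>\<phi>. \<phi> \<in> borel_measurable borel \<and> (\<forall>x. \<phi> x \<in> {0..1}) \<and> spread (\<mu> i) \<nu> \<phi> \<ge> 8 * h"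
  shows "\<exists>P. P \<in> borel_measurable (Pi\<^sub>M {..<n} \<mu> \<Otimes>\<^sub>M borel) \<and>
    (\<forall>p. P p > 0 \<and> \<bar>ln (P p)\<bar> \<le> real n) \<and>
    (\<forall>q\<in>borel_measurable borel. (\<integral>\<^sup>+\<omega>. (\<integral>\<^sup>+x. q (rand_comp n \<omega> x) * ennreal (P (\<omega>, x) * J_comp n \<omega> x) \<partial>m) \<partial>Pi\<^sub>M {..<n} \<mu>)
       \<le> (\<integral>\<^sup>+x. q x \<partial>m)) \<and>
    (\<integral>\<omega>. (\<integral>x. ln (P (\<omega>, x)) \<partial>m) \<partial>Pi\<^sub>M {..<n} \<mu>) \<ge> real n * h"
  using gap
proof (induction n)
  case 0
  interpret prob_space m by (rule m_prob)
  show ?case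
    by (rule exI[of _ "\<lambda>_. 1"]) (simp add: J_comp_def PiM_empty nn_integral_count_space_finite)
next
  case (Suc n)
  note [measurable_cong] = m_sets
  have spX: "space (\<mu> i) = space X" for i by (rule sets_eq_imp_space_eq[OF \<mu>(2)])
  interpret m: prob_space m by (rule m_prob)
  interpret \<mu>n: prob_space "\<mu> n" by (rule \<mu>(1))
  interpret PP: product_prob_space \<mu> "{..<n}"
    by (simp add: product_prob_space_def product_prob_space_axioms_def product_sigma_finite_def \<mu>(1) prob_space_imp_sigma_finite)
  define S where "S = Pi\<^sub>M {..<n} \<mu>"
  define S' where "S' = Pi\<^sub>M {..<Suc n} \<mu>"
  have S'_insert: "S' = Pi\<^sub>M (insert n {..<n}) \<mu>" by (simp add: S'_def lessThan_Suc)
  have probS: "prob_space S" "prob_space S'"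
    unfolding S_def S'_def by (rule prob_space_PiM, rule \<mu>(1))+
  interpret S: prob_space S by fact
  interpret S': prob_space S' by fact
  obtain P where P: "P \<in> borel_measurable (S \<Otimes>\<^sub>M borel)" "\<forall>p. P p > 0 \<and> \<bar>ln (P p)\<bar> \<le> real n"
    and Pa: "\<forall>q\<in>borel_measurable borel. (\<integral>\<^sup>+\<omega>. (\<integral>\<^sup>+x. q (rand_comp n \<omega> x) * ennreal (P (\<omega>, x) * J_comp n \<omega> x) \<partial>m) \<partial>S)
       \<le> (\<integral>\<^sup>+x. q x \<partial>m)"
    and Pb: "(\<integral>\<omega>. (\<integral>x. ln (P (\<omega>, x)) \<partial>m) \<partial>S) \<ge> real n * h"
    using Suc.IH[OF Suc.prems] unfolding S_def by (auto simp only: less_SucI)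
  have Ppos: "P p > 0" for p using P(2) by blast
  have Fm: "(\<lambda>p. rand_comp n (fst p) (snd p)) \<in> measurable (S \<Otimes>\<^sub>M borel) borel"
    unfolding S_def by (rule rand_comp_measurable) (simp_all add: \<mu>(2))
  have Fm': "(\<lambda>p. rand_comp n (fst p) (snd p)) \<in> measurable (S' \<Otimes>\<^sub>M borel) borel"
    "(\<lambda>p. rand_comp (Suc n) (fst p) (snd p)) \<in> measurable (S' \<Otimes>\<^sub>M borel) borel"
    unfolding S'_def by (rule rand_comp_measurable; auto simp: \<mu>(2))+
  have Fmm: "(\<lambda>p. rand_comp n (fst p) (snd p)) \<in> measurable (S \<Otimes>\<^sub>M m) borel" using Fm by measurable
  have Fsec: "rand_comp n \<omega> \<in> measurable m borel" if "\<omega> \<in> space S" for \<omega>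
    using measurable_compose[OF measurable_Pair1'[OF that] Fmm] by simp
  have Jm: "(\<lambda>p. J_comp n (fst p) (snd p)) \<in> borel_measurable (S \<Otimes>\<^sub>M borel)"
    unfolding S_def by (rule J_comp_measurable) (simp_all add: \<mu>(2))
  have Jm': "(\<lambda>p. J_comp (Suc n) (fst p) (snd p)) \<in> borel_measurable (S' \<Otimes>\<^sub>M borel)"
    unfolding S'_def by (rule J_comp_measurable) (simp_all add: \<mu>(2))
  have inX: "\<omega> k \<in> space X" if "\<omega> \<in> space S" "k < n" for \<omega> k
    using that unfolding S_def by (auto simp: space_PiM spX PiE_iff)
  \<comment> \<open>The law of the current point, for which the next step is tilted.\<close>
  define \<nu> where "\<nu> = distr (S \<Otimes>\<^sub>M m) borel (\<lambda>p. rand_comp n (fst p) (snd p))"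
  interpret Sm: pair_prob_space S m ..
  have \<nu>: "prob_space \<nu>" "sets \<nu> = sets borel"
    unfolding \<nu>_def using Sm.P.prob_space_distr[OF Fmm] by auto
  from Suc.prems[OF lessI \<nu>] obtain \<phi> where \<phi>: "\<phi> \<in> borel_measurable borel" "\<forall>x. \<phi> x \<in> {0..1}"
      and sp: "spread (\<mu> n) \<nu> \<phi> \<ge> 8 * h"
    by (elim exE conjE)
  from tilt_exists[OF \<mu>(1) \<mu>(2) \<nu> \<phi>(1) \<phi>(2)[rule_format], of n]
  obtain t where t: "t \<in> borel_measurable (X \<Otimes>\<^sub>M borel)" "\<forall>p. t p \<in> {3/4..5/4}"
      "\<forall>y. (\<integral>f. t (f, y) \<partial>\<mu> n) = 1"
      and tb: "(\<integral>f. (\<integral>z. ln (t (f, f z)) \<partial>\<nu>) \<partial>\<mu> n) \<ge> spread (\<mu> n) \<nu> \<phi> / 8"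
    by (elim exE conjE)
  have t_pos: "t p > 0" for p using t(2)[rule_format, of p] by auto
  have lnt: "\<bar>ln (t p)\<bar> \<le> 1" for p by (rule abs_ln_le_one, rule t(2)[rule_format])
  define P' where "P' p = P (restrict (fst p) {..<n}, snd p) * t (fst p n, rand_comp (Suc n) (fst p) (snd p))" for p
  have P'1: "(\<lambda>p. P (restrict (fst p) {..<n}, snd p)) \<in> borel_measurable (S' \<Otimes>\<^sub>M borel)"
  proof -
    have "(\<lambda>\<omega>. restrict \<omega> {..<n}) \<in> measurable S' S"
      unfolding S_def S'_def by (rule measurable_restrict_subset) auto
    then have "(\<lambda>p. (restrict (fst p) {..<n}, snd p)) \<in> measurable (S' \<Otimes>\<^sub>M borel) (S \<Otimes>\<^sub>M borel)"
      by measurable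
    from measurable_compose[OF this P(1)] show ?thesis .
  qed
  have P'2: "(\<lambda>p. t (fst p n, rand_comp (Suc n) (fst p) (snd p))) \<in> borel_measurable (S' \<Otimes>\<^sub>M borel)"
  proof -
    have "(\<lambda>p. (fst p n, rand_comp (Suc n) (fst p) (snd p))) \<in> measurable (S' \<Otimes>\<^sub>M borel) (X \<Otimes>\<^sub>M borel)"
      unfolding S'_def
      by (rule coordinate_pair_measurable[where n="Suc n"]) (use Fm'(2) \<mu>(2) in \<open>simp_all add: S'_def\<close>)
    from measurable_compose[OF this t(1)] show ?thesis .
  qed
  have P'm: "P' \<in> borel_measurable (S' \<Otimes>\<^sub>M borel)"
    unfolding P'_def using P'1 P'2 by (rule borel_measurable_times)
  have P'pos: "P' p > 0" for p using Ppos t_pos by (simp add: P'_def)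
  have lnP': "ln (P' p) = ln (P (restrict (fst p) {..<n}, snd p)) + ln (t (fst p n, rand_comp (Suc n) (fst p) (snd p)))" for p
    unfolding P'_def by (rule ln_mult_pos[OF Ppos t_pos])
  have lnP'b: "\<bar>ln (P' p)\<bar> \<le> real (Suc n)" for p
  proof -
    have "\<bar>ln (P (restrict (fst p) {..<n}, snd p))\<bar> \<le> real n" using P(2) by blast
    from order_trans[OF abs_triangle_ineq add_mono[OF this lnt]]
    show ?thesis unfolding lnP' of_nat_Suc add.commute[of 1 "real n"] .
  qed
  have upd: "restrict (\<omega> (n := g)) {..<n} = \<omega>" "rand_comp n (\<omega> (n := g)) = rand_comp n \<omega>" "J_comp n (\<omega> (n := g)) = J_comp n \<omega>"
    if "\<omega> \<in> space S" for \<omega> g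
  proof -
    show "restrict (\<omega> (n := g)) {..<n} = \<omega>"
    proof (rule ext)
      fix k show "restrict (\<omega> (n := g)) {..<n} k = \<omega> k"
        using that unfolding S_def by (auto simp: space_PiM PiE_iff extensional_def restrict_def)
    qed
    show "rand_comp n (\<omega> (n := g)) = rand_comp n \<omega>" by (rule rand_comp_cong) simp
    show "J_comp n (\<omega> (n := g)) = J_comp n \<omega>" by (rule J_comp_cong) simp
  qed
  \<comment> \<open>The induction hypothesis for \<open>q'\<close> disposes of the older maps. The newest map is then averaged
    at a fixed image point, where its tilt has mean \<open>1\<close>.\<close>
  have a: "(\<integral>\<^sup>+\<omega>. (\<integral>\<^sup>+x. q (rand_comp (Suc n) \<omega> x) * ennreal (P' (\<omega>, x) * J_comp (Suc n) \<omega> x) \<partial>m) \<partial>S') \<le> (\<integral>\<^sup>+x. q x \<partial>m)"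
    if q: "q \<in> borel_measurable borel" for q
  proof -
    let ?H = "\<lambda>\<omega> x. q (rand_comp (Suc n) \<omega> x) * ennreal (P' (\<omega>, x) * J_comp (Suc n) \<omega> x)"
    define Q where "Q p = q (fst p (snd p)) * ennreal (t (fst p, fst p (snd p)) * J (fst p) (snd p))" for p
    have Qm: "Q \<in> borel_measurable (X \<Otimes>\<^sub>M borel)"
    proof -
      have "(\<lambda>p. q (fst p (snd p))) \<in> borel_measurable (X \<Otimes>\<^sub>M borel)" by (rule measurable_compose[OF eval q])
      moreover have "(\<lambda>p. t (fst p, fst p (snd p))) \<in> borel_measurable (X \<Otimes>\<^sub>M borel)"
        by (rule measurable_compose[OF measurable_Pair[OF measurable_fst eval] t(1)])
      ultimately show ?thesis unfolding Q_def using J_measurable by measurable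
    qed
    have Qm': "Q \<in> borel_measurable (\<mu> n \<Otimes>\<^sub>M m)"
      using Qm by (rule borel_measurable_pair_cong) (simp_all add: \<mu>(2) m_sets)
    have Qmb: "Q \<in> borel_measurable (\<mu> n \<Otimes>\<^sub>M borel)"
      using Qm by (rule borel_measurable_pair_cong) (simp_all add: \<mu>(2))
    interpret \<mu>m: pair_prob_space "\<mu> n" m ..
    define q' where "q' y = (\<integral>\<^sup>+g. Q (g, y) \<partial>\<mu> n)" for y
    have q'm: "q' \<in> borel_measurable borel"
    proof -
      have "(\<lambda>(y, g). Q (g, y)) \<in> borel_measurable (borel \<Otimes>\<^sub>M \<mu> n)"
        using measurable_compose[OF measurable_pair_swap' Qmb] by (simp add: case_prod_beta')
      then show ?thesis unfolding q'_def by (rule \<mu>n.borel_measurable_nn_integral)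
    qed
    have "(\<integral>\<^sup>+\<omega>. (\<integral>\<^sup>+x. ?H \<omega> x \<partial>m) \<partial>S')
       = (\<integral>\<^sup>+\<omega>. (\<integral>\<^sup>+g. (\<integral>\<^sup>+x. ?H (\<omega> (n := g)) x \<partial>m) \<partial>\<mu> n) \<partial>S)"
      unfolding S'_insert S_def
    proof (rule PP.product_nn_integral_insert)
      have "(\<lambda>p. q (rand_comp (Suc n) (fst p) (snd p)) * ennreal (P' p * J_comp (Suc n) (fst p) (snd p))) \<in> borel_measurable (S' \<Otimes>\<^sub>M borel)"
        using measurable_compose[OF Fm'(2) q] P'm Jm' by measurable
      then have "(\<lambda>p. q (rand_comp (Suc n) (fst p) (snd p)) * ennreal (P' p * J_comp (Suc n) (fst p) (snd p))) \<in> borel_measurable (S' \<Otimes>\<^sub>M m)"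
        by measurable
      then show "(\<lambda>\<omega>. \<integral>\<^sup>+x. ?H \<omega> x \<partial>m) \<in> borel_measurable (Pi\<^sub>M (insert n {..<n}) \<mu>)"
        unfolding S'_insert by (intro m.borel_measurable_nn_integral) (simp add: case_prod_beta')
    qed simp_all
    also have "\<dots> = (\<integral>\<^sup>+\<omega>. (\<integral>\<^sup>+x. q' (rand_comp n \<omega> x) * ennreal (P (\<omega>, x) * J_comp n \<omega> x) \<partial>m) \<partial>S)"
    proof (rule nn_integral_cong)
      fix \<omega> assume \<omega>: "\<omega> \<in> space S"
      let ?F = "rand_comp n \<omega>" and ?W = "\<lambda>x. ennreal (P (\<omega>, x) * J_comp n \<omega> x)"
      have pos: "P (\<omega>, x) * J_comp n \<omega> x \<ge> 0" for x
        using Ppos J_comp_pos[of n \<omega> x] inX[OF \<omega>] by (simp add: less_imp_le)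
      have "(\<integral>\<^sup>+g. (\<integral>\<^sup>+x. ?H (\<omega> (n := g)) x \<partial>m) \<partial>\<mu> n)
        = (\<integral>\<^sup>+g. (\<integral>\<^sup>+x. Q (g, ?F x) * ?W x \<partial>m) \<partial>\<mu> n)"
      proof (intro nn_integral_cong)
        fix g x assume "g \<in> space (\<mu> n)"
        then have Jg: "J g y > 0" for y using spX J_pos by simp
        have "P' (\<omega> (n := g), x) * J_comp (Suc n) (\<omega> (n := g)) x = (t (g, g (?F x)) * J g (?F x)) * (P (\<omega>, x) * J_comp n \<omega> x)"
        proof -
          have "J_comp (Suc n) (\<omega> (n := g)) x = J_comp n (\<omega> (n := g)) x * J g (rand_comp n (\<omega> (n := g)) x)"
            by (simp add: J_comp_def)
          then show ?thesis unfolding P'_def using upd[OF \<omega>, of g] by simp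
        qed
        then have "ennreal (P' (\<omega> (n := g), x) * J_comp (Suc n) (\<omega> (n := g)) x) = ennreal (t (g, g (?F x)) * J g (?F x)) * ?W x"
          using Jg[of "?F x"] t_pos[of "(g, g (?F x))"] pos[of x] by (simp add: ennreal_mult less_imp_le)
        moreover have "rand_comp (Suc n) (\<omega> (n := g)) x = g (?F x)" using upd(2)[OF \<omega>, of g] by simp
        ultimately show "?H (\<omega> (n := g)) x = Q (g, ?F x) * ?W x"
          by (simp add: Q_def mult.assoc)
      qed
      also have "\<dots> = (\<integral>\<^sup>+x. (\<integral>\<^sup>+g. Q (g, ?F x) * ?W x \<partial>\<mu> n) \<partial>m)"
      proof (rule \<mu>m.Fubini'[symmetric])
        have "(\<lambda>p. (fst p, ?F (snd p))) \<in> measurable (\<mu> n \<Otimes>\<^sub>M m) (\<mu> n \<Otimes>\<^sub>M borel)"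
          using Fsec[OF \<omega>] by measurable
        from measurable_compose[OF this Qmb]
        have 1: "(\<lambda>p. Q (fst p, ?F (snd p))) \<in> borel_measurable (\<mu> n \<Otimes>\<^sub>M m)" .
        have "?W \<in> borel_measurable m"
          using measurable_compose[OF measurable_Pair1'[OF \<omega>] P(1)] measurable_compose[OF measurable_Pair1'[OF \<omega>] Jm]
          by simp
        then show "(\<lambda>(g, x). Q (g, ?F x) * ?W x) \<in> borel_measurable (\<mu> n \<Otimes>\<^sub>M m)"
          using 1 by (simp add: case_prod_beta')
      qed
      also have "\<dots> = (\<integral>\<^sup>+x. q' (?F x) * ?W x \<partial>m)"
      proof (rule nn_integral_cong)
        fix x
        have "(\<lambda>g. Q (g, ?F x)) \<in> borel_measurable (\<mu> n)"
          by (rule measurable_compose[OF measurable_Pair2' Qmb]) simp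
        then show "(\<integral>\<^sup>+g. Q (g, ?F x) * ?W x \<partial>\<mu> n) = q' (?F x) * ?W x"
          unfolding q'_def by (rule nn_integral_multc)
      qed
      finally show "(\<integral>\<^sup>+g. (\<integral>\<^sup>+x. ?H (\<omega> (n := g)) x \<partial>m) \<partial>\<mu> n)
        = (\<integral>\<^sup>+x. q' (?F x) * ?W x \<partial>m)" .
    qed
    also have "\<dots> \<le> (\<integral>\<^sup>+y. q' y \<partial>m)" using Pa q'm by blast
    also have "\<dots> = (\<integral>\<^sup>+g. (\<integral>\<^sup>+y. Q (g, y) \<partial>m) \<partial>\<mu> n)"
      unfolding q'_def by (rule \<mu>m.Fubini[OF Qm'])
    also have "\<dots> \<le> (\<integral>\<^sup>+g. (\<integral>\<^sup>+y. q y * ennreal (t (g, y)) \<partial>m) \<partial>\<mu> n)"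
    proof (rule nn_integral_mono)
      fix g assume "g \<in> space (\<mu> n)"
      then have g: "g \<in> space X" by (simp add: spX)
      have "(\<lambda>y. t (g, y)) \<in> borel_measurable borel"
        by (rule measurable_compose[OF measurable_Pair1'[OF g] t(1)])
      then have qt: "(\<lambda>y. q y * ennreal (t (g, y))) \<in> borel_measurable borel" using q by simp
      have "(\<integral>\<^sup>+y. Q (g, y) \<partial>m) = (\<integral>\<^sup>+y. q (g y) * ennreal (t (g, g y)) * ennreal (J g y) \<partial>m)"
        using t_pos J_pos[OF g] by (intro nn_integral_cong) (simp add: Q_def ennreal_mult less_imp_le mult.assoc)
      also have "\<dots> \<le> (\<integral>\<^sup>+y. q y * ennreal (t (g, y)) \<partial>m)" by (rule change[OF g qt])
      finally show "(\<integral>\<^sup>+y. Q (g, y) \<partial>m) \<le> (\<integral>\<^sup>+y. q y * ennreal (t (g, y)) \<partial>m)" .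
    qed
    also have "\<dots> = (\<integral>\<^sup>+y. (\<integral>\<^sup>+g. q y * ennreal (t (g, y)) \<partial>\<mu> n) \<partial>m)"
    proof (rule \<mu>m.Fubini'[symmetric])
      have tm: "t \<in> borel_measurable (\<mu> n \<Otimes>\<^sub>M m)"
        using t(1) by (rule borel_measurable_pair_cong) (simp_all add: \<mu>(2) m_sets)
      have "(\<lambda>p. q (snd p)) \<in> borel_measurable (\<mu> n \<Otimes>\<^sub>M m)"
        by (rule measurable_compose[OF measurable_snd]) (use q in simp)
      then show "(\<lambda>(g, y). q y * ennreal (t (g, y))) \<in> borel_measurable (\<mu> n \<Otimes>\<^sub>M m)"
        using tm by (simp add: case_prod_beta')
    qed
    also have "\<dots> = (\<integral>\<^sup>+y. q y \<partial>m)"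
    proof (rule nn_integral_cong)
      fix y
      have tm: "(\<lambda>g. t (g, y)) \<in> borel_measurable (\<mu> n)"
        using measurable_compose[OF measurable_Pair2' t(1), of y] by (simp cong: measurable_cong_sets add: \<mu>(2))
      have ti: "integrable (\<mu> n) (\<lambda>g. t (g, y))"
      proof (rule \<mu>n.integrable_const_bound[of _ 2])
        have "norm (t (g, y)) \<le> 2" for g using t(2)[rule_format, of "(g, y)"] by simp
        then show "AE g in \<mu> n. norm (t (g, y)) \<le> 2" by simp
      qed (rule tm)
      have "(\<integral>\<^sup>+g. ennreal (t (g, y)) \<partial>\<mu> n) = ennreal (\<integral>g. t (g, y) \<partial>\<mu> n)"
        using ti t_pos by (intro nn_integral_eq_integral) (auto simp: less_imp_le)
      then have "(\<integral>\<^sup>+g. ennreal (t (g, y)) \<partial>\<mu> n) = 1" using t(3) by simp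
      then show "(\<integral>\<^sup>+g. q y * ennreal (t (g, y)) \<partial>\<mu> n) = q y"
        using tm by (subst nn_integral_cmult) auto
    qed
    finally show ?thesis .
  qed
  have b: "(\<integral>\<omega>. (\<integral>x. ln (P' (\<omega>, x)) \<partial>m) \<partial>S') \<ge> real (Suc n) * h"
  proof -
    define L where "L p = ln (t (fst p, fst p (snd p)))" for p
    have Lm: "L \<in> borel_measurable (X \<Otimes>\<^sub>M borel)"
      using measurable_compose[OF measurable_Pair[OF measurable_fst eval] t(1)] unfolding L_def by measurable
    have Lmb: "L \<in> borel_measurable (\<mu> n \<Otimes>\<^sub>M borel)"
      using Lm by (rule borel_measurable_pair_cong) (simp_all add: \<mu>(2))
    have Lb: "\<bar>L p\<bar> \<le> 1" for p unfolding L_def by (rule lnt)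
    have lnPm: "(\<lambda>p. ln (P p)) \<in> borel_measurable (S \<Otimes>\<^sub>M m)" "(\<lambda>p. ln (P' p)) \<in> borel_measurable (S' \<Otimes>\<^sub>M m)"
      using P(1) P'm by measurable
    note iP' = bounded_pair_integrable[OF probS(2) m_prob lnPm(2) ballI[OF lnP'b]]
    have Pbd: "\<bar>ln (P p)\<bar> \<le> real n" for p using P(2) by blast
    note iP = bounded_pair_integrable[OF probS(1) m_prob lnPm(1) ballI[OF Pbd]]
    define B where "B p = (\<integral>x. L (snd p, rand_comp n (fst p) x) \<partial>m)" for p
    have gLm: "(\<lambda>p. L (snd (fst p), rand_comp n (fst (fst p)) (snd p))) \<in> borel_measurable ((S \<Otimes>\<^sub>M \<mu> n) \<Otimes>\<^sub>M m)"
    proof -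
      have "(\<lambda>p. (fst (fst p), snd p)) \<in> measurable ((S \<Otimes>\<^sub>M \<mu> n) \<Otimes>\<^sub>M m) (S \<Otimes>\<^sub>M m)" by measurable
      from measurable_compose[OF this Fmm]
      have "(\<lambda>p. (snd (fst p), rand_comp n (fst (fst p)) (snd p))) \<in> measurable ((S \<Otimes>\<^sub>M \<mu> n) \<Otimes>\<^sub>M m) (\<mu> n \<Otimes>\<^sub>M borel)"
        by (intro measurable_Pair) simp_all
      from measurable_compose[OF this Lmb] show ?thesis .
    qed
    interpret S\<mu>: pair_prob_space S "\<mu> n" ..
    note iL = bounded_pair_integrable[OF S\<mu>.P.prob_space_axioms m_prob gLm ballI[OF Lb], simplified]
    have Bm: "B \<in> borel_measurable (S \<Otimes>\<^sub>M \<mu> n)" using iL(2) unfolding B_def[abs_def] .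
    have Bb: "\<forall>p\<in>space (S \<Otimes>\<^sub>M \<mu> n). \<bar>B p\<bar> \<le> 1" using iL(4) unfolding B_def by blast
    note iB = bounded_pair_integrable[OF probS(1) \<mu>(1) Bm Bb]
    have "(\<integral>\<omega>. (\<integral>x. ln (P' (\<omega>, x)) \<partial>m) \<partial>S') = (\<integral>\<omega>. (\<integral>g. (\<integral>x. ln (P' (\<omega> (n := g), x)) \<partial>m) \<partial>\<mu> n) \<partial>S)"
      unfolding S'_insert S_def
      by (rule PP.product_integral_insert) (use iP'(5) in \<open>simp_all add: S'_insert\<close>)
    also have "\<dots> = (\<integral>\<omega>. (\<integral>x. ln (P (\<omega>, x)) \<partial>m) + (\<integral>g. B (\<omega>, g) \<partial>\<mu> n) \<partial>S)"
    proof (rule Bochner_Integration.integral_cong[OF refl])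
      fix \<omega> assume \<omega>: "\<omega> \<in> space S"
      have "(\<integral>x. ln (P' (\<omega> (n := g), x)) \<partial>m) = (\<integral>x. ln (P (\<omega>, x)) \<partial>m) + B (\<omega>, g)" if g: "g \<in> space (\<mu> n)" for g
      proof -
        have p: "(\<omega>, g) \<in> space (S \<Otimes>\<^sub>M \<mu> n)" using \<omega> g by (simp add: space_pair_measure)
        have "ln (P' (\<omega> (n := g), x)) = ln (P (\<omega>, x)) + L (g, rand_comp n \<omega> x)" for x
          unfolding lnP' L_def using upd(1,2)[OF \<omega>, of g] by simp
        then show ?thesis
          unfolding B_def using iP(3)[OF \<omega>] iL(3)[OF p] by simp
      qed
      then have "(\<integral>g. (\<integral>x. ln (P' (\<omega> (n := g), x)) \<partial>m) \<partial>\<mu> n) = (\<integral>g. (\<integral>x. ln (P (\<omega>, x)) \<partial>m) + B (\<omega>, g) \<partial>\<mu> n)"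
        by (intro Bochner_Integration.integral_cong) simp_all
      also have "\<dots> = (\<integral>x. ln (P (\<omega>, x)) \<partial>m) + (\<integral>g. B (\<omega>, g) \<partial>\<mu> n)"
        using iB(3)[OF \<omega>] by (simp add: \<mu>n.prob_space)
      finally show "(\<integral>g. (\<integral>x. ln (P' (\<omega> (n := g), x)) \<partial>m) \<partial>\<mu> n) = (\<integral>x. ln (P (\<omega>, x)) \<partial>m) + (\<integral>g. B (\<omega>, g) \<partial>\<mu> n)" .
    qed
    also have "\<dots> = (\<integral>\<omega>. (\<integral>x. ln (P (\<omega>, x)) \<partial>m) \<partial>S) + (\<integral>\<omega>. (\<integral>g. B (\<omega>, g) \<partial>\<mu> n) \<partial>S)"
      by (rule Bochner_Integration.integral_add) (use iP(5) iB(5) in auto)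
    also have "(\<integral>\<omega>. (\<integral>g. B (\<omega>, g) \<partial>\<mu> n) \<partial>S) = (\<integral>g. (\<integral>\<omega>. B (\<omega>, g) \<partial>S) \<partial>\<mu> n)"
      using iB(6) by simp
    also have "\<dots> = (\<integral>g. (\<integral>z. ln (t (g, g z)) \<partial>\<nu>) \<partial>\<mu> n)"
    proof (rule Bochner_Integration.integral_cong[OF refl])
      fix g assume g: "g \<in> space (\<mu> n)"
      have Lg: "(\<lambda>z. L (g, z)) \<in> borel_measurable borel"
        by (rule measurable_compose[OF measurable_Pair1'[OF g] Lmb])
      have "(\<integral>z. L (g, z) \<partial>\<nu>) = (\<integral>p. L (g, rand_comp n (fst p) (snd p)) \<partial>(S \<Otimes>\<^sub>M m))"
        unfolding \<nu>_def by (rule integral_distr[OF Fmm Lg])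
      also have "\<dots> = (\<integral>\<omega>. (\<integral>x. L (g, rand_comp n \<omega> x) \<partial>m) \<partial>S)"
        using bounded_pair_integrable(7)[OF probS(1) m_prob measurable_compose[OF Fmm Lg] ballI[OF Lb]] by simp
      finally show "(\<integral>\<omega>. B (\<omega>, g) \<partial>S) = (\<integral>z. ln (t (g, g z)) \<partial>\<nu>)"
        unfolding B_def L_def by simp
    qed
    finally show ?thesis using Pb tb sp by (simp add: algebra_simps)
  qed
  show ?case
    using P'm P'pos lnP'b a b unfolding S'_def[symmetric] by (intro exI[of _ P']) blast
qed

text \<open>The product \<open>R\<close> of \<open>P\<close> and \<open>1 / N\<close> has mean at most \<open>1\<close>, because \<open>1 / N\<close> is below the
  Jacobian. Then \<open>ln R \<le> R - 1\<close> shows that the mean of \<open>ln N\<close> is at least the mean of \<open>ln P\<close>.\<close>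

lemma expected_log_growth:
  assumes \<mu>: "\<And>i. prob_space (\<mu> i)" "\<And>i. sets (\<mu> i) = sets X"
    and gap: "\<And>i \<nu>. i < n \<Longrightarrow> prob_space \<nu> \<Longrightarrow> sets \<nu> = sets borel \<Longrightarrow>
      \<exists>\<phi>. \<phi> \<in> borel_measurable borel \<and> (\<forall>x. \<phi> x \<in> {0..1}) \<and> spread (\<mu> i) \<nu> \<phi> \<ge> 8 * h"
    and N: "\<And>\<omega>. \<omega> \<in> space (Pi\<^sub>M {..<n} \<mu>) \<Longrightarrow> N \<omega> > 0"
      "\<And>\<omega> x. \<omega> \<in> space (Pi\<^sub>M {..<n} \<mu>) \<Longrightarrow> inverse (J_comp n \<omega> x) \<le> N \<omega>"
    and int: "integrable (Pi\<^sub>M {..<n} \<mu>) (\<lambda>\<omega>. ln (N \<omega>))"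
  shows "(\<integral>\<omega>. ln (N \<omega>) \<partial>Pi\<^sub>M {..<n} \<mu>) \<ge> real n * h"
proof -
  define S where "S = Pi\<^sub>M {..<n} \<mu>"
  note [measurable_cong] = m_sets
  interpret m: prob_space m by (rule m_prob)
  have probS: "prob_space S" unfolding S_def by (rule prob_space_PiM, rule \<mu>(1))
  interpret S: prob_space S by fact
  have "\<exists>P. P \<in> borel_measurable (Pi\<^sub>M {..<n} \<mu> \<Otimes>\<^sub>M borel) \<and>
    (\<forall>p. P p > 0 \<and> \<bar>ln (P p)\<bar> \<le> real n) \<and>
    (\<forall>q\<in>borel_measurable borel. (\<integral>\<^sup>+\<omega>. (\<integral>\<^sup>+x. q (rand_comp n \<omega> x) * ennreal (P (\<omega>, x) * J_comp n \<omega> x) \<partial>m) \<partial>Pi\<^sub>M {..<n} \<mu>)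
       \<le> (\<integral>\<^sup>+x. q x \<partial>m)) \<and>
    (\<integral>\<omega>. (\<integral>x. ln (P (\<omega>, x)) \<partial>m) \<partial>Pi\<^sub>M {..<n} \<mu>) \<ge> real n * h"
    by (rule tilted_chain[OF \<mu>], rule gap)
  then obtain P where P: "P \<in> borel_measurable (S \<Otimes>\<^sub>M borel)" "\<forall>p. P p > 0 \<and> \<bar>ln (P p)\<bar> \<le> real n"
    and Pa: "\<forall>q\<in>borel_measurable borel. (\<integral>\<^sup>+\<omega>. (\<integral>\<^sup>+x. q (rand_comp n \<omega> x) * ennreal (P (\<omega>, x) * J_comp n \<omega> x) \<partial>m) \<partial>S)
       \<le> (\<integral>\<^sup>+x. q x \<partial>m)"
    and Pb: "(\<integral>\<omega>. (\<integral>x. ln (P (\<omega>, x)) \<partial>m) \<partial>S) \<ge> real n * h"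
    unfolding S_def by (elim exE conjE)
  have Ppos: "P p > 0" for p using P(2) by blast
  have spX: "space (\<mu> i) = space X" for i by (rule sets_eq_imp_space_eq[OF \<mu>(2)])
  have inX: "\<omega> k \<in> space X" if "\<omega> \<in> space S" "k < n" for \<omega> k
    using that unfolding S_def by (auto simp: space_PiM spX PiE_iff)
  have Jp: "J_comp n \<omega> x > 0" if "\<omega> \<in> space S" for \<omega> x by (rule J_comp_pos) (rule inX[OF that])
  have Npos: "N \<omega> > 0" if "\<omega> \<in> space S" for \<omega> using N(1) that by (simp add: S_def)
  have NJ: "1 / N \<omega> \<le> J_comp n \<omega> x" if "\<omega> \<in> space S" for \<omega> x
    using N(2)[of \<omega> x] Jp[OF that, of x] Npos[OF that] that by (simp add: S_def field_simps)
  have N1: "1 / N \<omega> \<le> 1" if \<omega>: "\<omega> \<in> space S" for \<omega>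
    by (rule J_comp_lower_bound[OF inX[OF \<omega>] NJ[OF \<omega>]])
  define N' where "N' \<omega> = exp (- ln (N \<omega>))" for \<omega>
  have N': "N' \<omega> = 1 / N \<omega>" if "\<omega> \<in> space S" for \<omega>
    using Npos[OF that] by (simp add: N'_def exp_minus field_simps)
  have intS: "integrable S (\<lambda>\<omega>. ln (N \<omega>))" using int by (simp add: S_def)
  have N'm: "N' \<in> borel_measurable S" using borel_measurable_integrable[OF intS] unfolding N'_def by simp
  have Pm: "P \<in> borel_measurable (S \<Otimes>\<^sub>M m)" using P(1) by measurable
  define R where "R p = P p * N' (fst p)" for p
  have Rm: "R \<in> borel_measurable (S \<Otimes>\<^sub>M m)" unfolding R_def using Pm N'm by measurable
  have Pexp: "P p \<le> exp (real n)" for p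
    using P(2)[rule_format, of p] exp_le_cancel_iff[of "ln (P p)" "real n"] by (auto simp: abs_le_iff)
  have Rb: "\<bar>R p\<bar> \<le> exp (real n)" and R0: "R p > 0" if "p \<in> space (S \<Otimes>\<^sub>M m)" for p
  proof -
    have w: "fst p \<in> space S" using that by (auto simp: space_pair_measure)
    have "P p * N' (fst p) \<le> exp (real n) * 1"
      using Pexp[of p] N'[OF w] N1[OF w] Ppos Npos[OF w] by (intro mult_mono) (auto simp: less_imp_le)
    moreover show "R p > 0" using Ppos N'[OF w] Npos[OF w] by (simp add: R_def)
    ultimately show "\<bar>R p\<bar> \<le> exp (real n)" by (simp add: R_def)
  qed
  have Rball: "\<forall>p\<in>space (S \<Otimes>\<^sub>M m). \<bar>R p\<bar> \<le> exp (real n)" using Rb by blast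
  note iR = bounded_pair_integrable[OF probS m_prob Rm Rball]
  have lnPm: "(\<lambda>p. ln (P p)) \<in> borel_measurable (S \<Otimes>\<^sub>M m)" using Pm by measurable
  have Pbd: "\<bar>ln (P p)\<bar> \<le> real n" for p using P(2) by blast
  note iP = bounded_pair_integrable[OF probS m_prob lnPm ballI[OF Pbd]]
  have "(\<integral>\<omega>. (\<integral>x. R (\<omega>, x) \<partial>m) \<partial>S) \<le> 1"
  proof -
    have "ennreal (\<integral>\<omega>. (\<integral>x. R (\<omega>, x) \<partial>m) \<partial>S) = (\<integral>\<^sup>+\<omega>. ennreal (\<integral>x. R (\<omega>, x) \<partial>m) \<partial>S)"
    proof (rule nn_integral_eq_integral[symmetric, OF iR(5)])
      show "AE \<omega> in S. 0 \<le> (\<integral>x. R (\<omega>, x) \<partial>m)"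
      proof (rule AE_I2)
        fix \<omega> assume "\<omega> \<in> space S"
        then show "0 \<le> (\<integral>x. R (\<omega>, x) \<partial>m)"
          using R0 by (intro integral_nonneg_AE AE_I2) (simp add: space_pair_measure less_imp_le)
      qed
    qed
    also have "\<dots> = (\<integral>\<^sup>+\<omega>. (\<integral>\<^sup>+x. ennreal (R (\<omega>, x)) \<partial>m) \<partial>S)"
    proof (rule nn_integral_cong)
      fix \<omega> assume \<omega>: "\<omega> \<in> space S"
      show "ennreal (\<integral>x. R (\<omega>, x) \<partial>m) = (\<integral>\<^sup>+x. ennreal (R (\<omega>, x)) \<partial>m)"
        using \<omega> R0 by (intro nn_integral_eq_integral[symmetric, OF iR(3)[OF \<omega>]] AE_I2) (simp add: space_pair_measure less_imp_le)
    qed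
    also have "\<dots> \<le> (\<integral>\<^sup>+\<omega>. (\<integral>\<^sup>+x. 1 * ennreal (P (\<omega>, x) * J_comp n \<omega> x) \<partial>m) \<partial>S)"
    proof (intro nn_integral_mono)
      fix \<omega> x assume \<omega>: "\<omega> \<in> space S"
      have "P (\<omega>, x) * N' \<omega> \<le> P (\<omega>, x) * J_comp n \<omega> x"
        using NJ[OF \<omega>, of x] N'[OF \<omega>] Ppos by (intro mult_left_mono) (auto simp: less_imp_le)
      then show "ennreal (R (\<omega>, x)) \<le> 1 * ennreal (P (\<omega>, x) * J_comp n \<omega> x)"
        by (simp add: R_def ennreal_leI)
    qed
    also have "\<dots> \<le> (\<integral>\<^sup>+x. 1 \<partial>m)" using Pa by (rule bspec) simp
    finally show ?thesis by (simp add: m.emeasure_space_1)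
  qed
  moreover have "(\<integral>\<omega>. (\<integral>x. ln (P (\<omega>, x)) \<partial>m) - ln (N \<omega>) \<partial>S) \<le> (\<integral>\<omega>. (\<integral>x. R (\<omega>, x) \<partial>m) - 1 \<partial>S)"
  proof (rule integral_mono)
    fix \<omega> assume \<omega>: "\<omega> \<in> space S"
    have "(\<integral>x. ln (P (\<omega>, x)) - ln (N \<omega>) \<partial>m) \<le> (\<integral>x. R (\<omega>, x) - 1 \<partial>m)"
    proof (rule integral_mono)
      fix x assume "x \<in> space m"
      then have r: "R (\<omega>, x) > 0" using \<omega> R0 by (simp add: space_pair_measure)
      have "ln (R (\<omega>, x)) = ln (P (\<omega>, x)) - ln (N \<omega>)"
        using ln_divide_pos[OF Ppos Npos[OF \<omega>]] by (simp add: R_def N'[OF \<omega>])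
      then show "ln (P (\<omega>, x)) - ln (N \<omega>) \<le> R (\<omega>, x) - 1" using ln_le_minus_one[OF r] by simp
    qed (use iP(3)[OF \<omega>] iR(3)[OF \<omega>] in auto)
    then show "(\<integral>x. ln (P (\<omega>, x)) \<partial>m) - ln (N \<omega>) \<le> (\<integral>x. R (\<omega>, x) \<partial>m) - 1"
      using iP(3)[OF \<omega>] iR(3)[OF \<omega>] by (simp add: m.prob_space)
  qed (use iP(5) iR(5) intS in auto)
  ultimately show ?thesis
    using Pb iP(5) iR(5) intS by (simp add: S.prob_space S_def[symmetric])
qed

end

section \<open>Change of variables in coordinates\<close>

text \<open>The change of variables theorem for \<open>real^'n\<close> asks for a well-ordered index type \<open>'n\<close>. Every
  finite type has a copy with a well-order, to which coordinates can be transported.\<close>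

datatype 'a wo = Wo (unWo: 'a)

definition idx :: "'a::finite \<Rightarrow> nat" where
  "idx = (SOME f. inj f)"

lemma inj_idx: "inj (idx :: 'a::finite \<Rightarrow> nat)"
  unfolding idx_def using finite_imp_inj_to_nat_seg[of "UNIV :: 'a set"] by (metis finite someI_ex)

instance wo :: (finite) finite
proof
  have "(UNIV :: 'a wo set) = range Wo" by (metis surjI wo.collapse)
  then show "finite (UNIV :: 'a wo set)" by (metis finite finite_imageI)
qed

instantiation wo :: (finite) wellorder
begin

definition less_eq_wo :: "'a wo \<Rightarrow> 'a wo \<Rightarrow> bool" where
  "less_eq_wo a b \<longleftrightarrow> idx (unWo a) \<le> idx (unWo b)"

definition less_wo :: "'a wo \<Rightarrow> 'a wo \<Rightarrow> bool" where
  "less_wo a b \<longleftrightarrow> idx (unWo a) < idx (unWo b)"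

instance
proof
  fix x y :: "'a wo"
  show "x = y" if "x \<le> y" "y \<le> x"
    using that injD[OF inj_idx] unfolding less_eq_wo_def by (metis antisym wo.expand)
  fix P :: "'a wo \<Rightarrow> bool" and a
  assume "\<And>x. (\<And>y. y < x \<Longrightarrow> P y) \<Longrightarrow> P x"
  then show "P a"
    by (rule measure_induct_rule[of "\<lambda>x. idx (unWo x)"]) (simp add: less_wo_def)
qed (auto simp: less_eq_wo_def less_wo_def)

end

definition to_wo :: "real^'n \<Rightarrow> real^'n wo" where "to_wo x = (\<chi> i. x $ unWo i)"
definition of_wo :: "real^'n wo \<Rightarrow> real^'n" where "of_wo x = (\<chi> i. x $ Wo i)"

lemma of_to_wo[simp]: "of_wo (to_wo x) = x" "to_wo (of_wo y) = y"
  by (simp_all add: of_wo_def to_wo_def vec_eq_iff)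

lemma linear_wo: "linear (to_wo :: real^'n::finite \<Rightarrow> _)" "linear (of_wo :: real^'n::finite wo \<Rightarrow> _)"
  by (rule linearI; simp add: to_wo_def of_wo_def vec_eq_iff)+

lemma wo_measurable[measurable]:
  "(to_wo :: real^'n::finite \<Rightarrow> _) \<in> borel_measurable borel" "(of_wo :: real^'n::finite wo \<Rightarrow> _) \<in> borel_measurable borel"
  using linear_wo by (auto intro!: borel_measurable_continuous_onI linear_continuous_on linear_conv_bounded_linear[THEN iffD1])

lemma lborel_of_wo: "distr lborel borel (of_wo :: real^'n::finite wo \<Rightarrow> _) = lborel"
proof (rule lborel_eqI[symmetric])
  fix l u :: "real^'n" assume lu: "\<And>b. b \<in> Basis \<Longrightarrow> l \<bullet> b \<le> u \<bullet> b"
  have le: "l $ i \<le> u $ i" for i using lu[of "axis i 1"] by (simp add: inner_axis axis_in_Basis_iff)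
  have pre: "(of_wo :: real^'n wo \<Rightarrow> _) -` box l u = box (to_wo l) (to_wo u)"
  proof (rule set_eqI)
    fix x :: "real^'n wo"
    have "(\<forall>i. l $ i < x $ Wo i \<and> x $ Wo i < u $ i) \<longleftrightarrow> (\<forall>j. l $ unWo j < x $ j \<and> x $ j < u $ unWo j)"
      by (metis wo.collapse wo.sel)
    then show "x \<in> of_wo -` box l u \<longleftrightarrow> x \<in> box (to_wo l) (to_wo u)"
      by (simp add: mem_box_cart of_wo_def to_wo_def)
  qed
  have prodB: "(\<Prod>b\<in>Basis. w \<bullet> b) = (\<Prod>i\<in>UNIV. w $ i)" for w :: "real^'k::finite"
  proof -
    have B: "(Basis :: (real^'k) set) = range (\<lambda>i. axis i 1)" by (auto simp: Basis_vec_def)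
    show ?thesis unfolding B by (subst prod.reindex) (auto simp: inj_on_def axis_eq_axis inner_axis)
  qed
  have "emeasure (distr lborel borel of_wo) (box l u) = emeasure lborel (box (to_wo l) (to_wo u))"
    by (subst emeasure_distr) (auto simp: pre)
  also have "\<dots> = (\<Prod>b\<in>Basis. (to_wo u - to_wo l) \<bullet> b)"
  proof (rule emeasure_lborel_box)
    fix b :: "real^'n wo" assume "b \<in> Basis"
    then obtain i where "b = axis i 1" by (auto simp: Basis_vec_def)
    then show "to_wo l \<bullet> b \<le> to_wo u \<bullet> b" using le by (simp add: inner_axis to_wo_def)
  qed
  also have "(\<Prod>b\<in>Basis. (to_wo u - to_wo l) \<bullet> b) = (\<Prod>b\<in>Basis. (u - l) \<bullet> b)"
    unfolding prodB
    by (rule prod.reindex_bij_witness[of _ Wo unWo]) (auto simp: to_wo_def)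
  finally show "emeasure (distr lborel borel of_wo) (box l u) = (\<Prod>b\<in>Basis. (u - l) \<bullet> b)" .
qed simp

lemma det_wo:
  fixes A :: "real^'n::finite^'n"
  shows "det (\<chi> i j. A $ unWo i $ unWo j :: real^'n wo^'n wo) = det A"
proof -
  have bijW: "bij_betw Wo (UNIV :: 'n set) UNIV" by (rule bij_betwI[of _ _ _ unWo]) auto
  have sgn: "sign (\<lambda>x. Wo (p (unWo x))) = sign p" if "p permutes (UNIV :: 'n set)" for p
  proof -
    interpret permutes_bij_finite p UNIV UNIV Wo unWo "\<lambda>x. if x \<in> UNIV then Wo (p (unWo x)) else x"
      by unfold_locales (use that bijW in auto)
    show ?thesis using sign_p' by simp
  qed
  have "det A = (\<Sum>p | p permutes UNIV. of_int (sign p) * (\<Prod>i\<in>UNIV. A $ i $ p i))"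
    by (simp add: det_def)
  also have "\<dots> = (\<Sum>p | p permutes (UNIV :: 'n wo set). of_int (sign p) * (\<Prod>i\<in>UNIV. A $ unWo i $ unWo (p i)))"
  proof (rule sum.reindex_bij_witness[of _ "\<lambda>p x. unWo (p (Wo x))" "\<lambda>p x. Wo (p (unWo x))"])
    fix p assume p: "p \<in> {p. p permutes (UNIV :: 'n set)}"
    show "of_int (sign (\<lambda>x. Wo (p (unWo x)))) * (\<Prod>i\<in>UNIV. A $ unWo i $ unWo (Wo (p (unWo i)))) =
       of_int (sign p) * (\<Prod>i\<in>UNIV. A $ i $ p i)"
    proof -
      have "(\<Prod>i\<in>UNIV. A $ unWo i $ p (unWo i)) = (\<Prod>i\<in>UNIV. A $ i $ p i)"
        by (rule prod.reindex_bij_witness[of _ Wo unWo]) auto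
      then show ?thesis using sgn p by simp
    qed
    have "bij p" using p by (simp add: permutes_bij)
    then have "bij (Wo \<circ> p \<circ> unWo)"
      using bijW by (intro bij_comp bij_betwI[of unWo UNIV UNIV Wo]) auto
    then show "(\<lambda>x. Wo (p (unWo x))) \<in> {p. p permutes UNIV}" unfolding comp_def by (auto intro: bij_imp_permutes)
  next
    fix p assume p: "p \<in> {p. p permutes (UNIV :: 'n wo set)}"
    then have "bij p" by (simp add: permutes_bij)
    then have "bij (unWo \<circ> p \<circ> Wo)"
      using bijW by (intro bij_comp bij_betwI[of unWo UNIV UNIV Wo]) auto
    then show "(\<lambda>x. unWo (p (Wo x))) \<in> {p. p permutes UNIV}" unfolding comp_def by (auto intro: bij_imp_permutes)
  qed auto
  finally show ?thesis by (simp add: det_def)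
qed

lemma matrix_wo:
  fixes f :: "real^'n::finite \<Rightarrow> real^'n"
  shows "matrix (\<lambda>x. to_wo (f (of_wo x))) = (\<chi> i j. matrix f $ unWo i $ unWo j)"
proof -
  have "of_wo (axis j 1) = axis (unWo j) (1::real)" for j :: "'n wo"
    unfolding of_wo_def axis_def vec_eq_iff by (auto; metis wo.collapse wo.sel)
  then show ?thesis by (simp add: matrix_def to_wo_def)
qed

text \<open>Both sides integrate \<open>q\<close> against a measure on the image side. On a Borel set \<open>B\<close> the two measures
  agree by the formula for the volume of the image of \<open>S \<inter> L -` B\<close>.\<close>

lemma nn_change_of_variables_wo:
  fixes L :: "real^'n::{finite,wellorder} \<Rightarrow> real^'n::_"
  assumes S: "S \<in> sets borel" and der: "\<And>x. x \<in> S \<Longrightarrow> (L has_derivative L' x) (at x)"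
    and inj: "inj_on L S" and LS: "L ` S \<in> sets borel" "bounded (L ` S)"
    and dm: "(\<lambda>x. indicator S x * ennreal \<bar>det (matrix (L' x))\<bar>) \<in> borel_measurable borel"
    and q: "q \<in> borel_measurable borel"
  shows "(\<integral>\<^sup>+x. indicator S x * (q (L x) * ennreal \<bar>det (matrix (L' x))\<bar>) \<partial>lborel) = (\<integral>\<^sup>+y. indicator (L ` S) y * q y \<partial>lborel)"
proof -
  define L0 where "L0 x = (if x \<in> S then L x else 0)" for x
  have "continuous_on S L"
    by (rule continuous_at_imp_continuous_on) (use der has_derivative_continuous in blast)
  then have L0: "L0 \<in> borel_measurable borel"
    unfolding L0_def using S by (intro borel_measurable_continuous_on_if) auto
  let ?d = "\<lambda>x. indicator S x * ennreal \<bar>det (matrix (L' x))\<bar>"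
  have "distr (density lborel ?d) borel L0 = density lborel (indicator (L ` S))"
  proof (rule measure_eqI)
    fix B assume "B \<in> sets (distr (density lborel ?d) borel L0)"
    then have B: "B \<in> sets borel" by simp
    define D where "D = S \<inter> L0 -` B"
    have D: "D \<in> sets borel" unfolding D_def using S measurable_sets[OF L0 B] by auto
    have LD: "L ` D = L ` S \<inter> B" by (auto simp: D_def L0_def)
    have LDb: "L ` D \<in> sets borel" unfolding LD using LS(1) B by auto
    have LDm: "L ` D \<in> lmeasurable"
      by (rule bounded_set_imp_lmeasurable) (use LS(2) LD LDb in \<open>auto intro: bounded_subset\<close>)
    have "((\<lambda>x. \<bar>det (matrix (L' x))\<bar>) has_integral measure lebesgue (L ` D)) D"
      by (rule has_measure_differentiable_image[THEN iffD1])
         (use D der inj LDm in \<open>auto simp: D_def intro: has_derivative_at_withinI inj_on_subset\<close>)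
    then have int: "(\<integral>\<^sup>+x. indicator D x * \<bar>det (matrix (L' x))\<bar> \<partial>lborel) = ennreal (measure lebesgue (L ` D))"
      by (intro nn_integral_has_integral_lebesgue) auto
    have "emeasure (distr (density lborel ?d) borel L0) B = emeasure (density lborel ?d) (L0 -` B)"
      using L0 B by (subst emeasure_distr) auto
    also have "\<dots> = (\<integral>\<^sup>+x. ?d x * indicator (L0 -` B) x \<partial>lborel)"
      using dm measurable_sets[OF L0 B] by (intro emeasure_density) auto
    also have "\<dots> = (\<integral>\<^sup>+x. indicator D x * \<bar>det (matrix (L' x))\<bar> \<partial>lborel)"
      by (intro nn_integral_cong) (auto simp: D_def indicator_def)
    also have "\<dots> = ennreal (measure lebesgue (L ` D))"
      by (rule int)
    also have "\<dots> = emeasure lebesgue (L ` D)"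
      by (rule emeasure_eq_ennreal_measure[symmetric]) (rule fmeasurableD2[OF LDm])
    also have "\<dots> = emeasure lborel (L ` S \<inter> B)" using LDb LD by simp
    also have "\<dots> = emeasure (density lborel (indicator (L ` S))) B"
    proof -
      have "emeasure (density lborel (indicator (L ` S))) B = (\<integral>\<^sup>+x. indicator (L ` S) x * indicator B x \<partial>lborel)"
        using LS(1) B by (intro emeasure_density) auto
      also have "\<dots> = (\<integral>\<^sup>+x. indicator (L ` S \<inter> B) x \<partial>lborel)" by (simp only: indicator_inter_arith)
      also have "\<dots> = emeasure lborel (L ` S \<inter> B)" using LS(1) B by (intro nn_integral_indicator) auto
      finally show ?thesis by (rule sym)
    qed
    finally show "emeasure (distr (density lborel ?d) borel L0) B = emeasure (density lborel (indicator (L ` S))) B" .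
  qed simp
  then have "(\<integral>\<^sup>+y. q y \<partial>distr (density lborel ?d) borel L0) = (\<integral>\<^sup>+y. q y \<partial>density lborel (indicator (L ` S)))" by simp
  moreover have "(\<integral>\<^sup>+y. q y \<partial>density lborel (indicator (L ` S))) = (\<integral>\<^sup>+y. indicator (L ` S) y * q y \<partial>lborel)"
    using LS(1) q by (intro nn_integral_density) auto
  moreover have "(\<integral>\<^sup>+y. q y \<partial>distr (density lborel ?d) borel L0) = (\<integral>\<^sup>+x. ?d x * q (L0 x) \<partial>lborel)"
    using L0 q dm by (simp add: nn_integral_distr nn_integral_density)
  moreover have "(\<integral>\<^sup>+x. ?d x * q (L0 x) \<partial>lborel) = (\<integral>\<^sup>+x. indicator S x * (q (L x) * ennreal \<bar>det (matrix (L' x))\<bar>) \<partial>lborel)"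
    by (intro nn_integral_cong) (simp add: L0_def indicator_def mult_ac)
  ultimately show ?thesis by simp
qed

lemma nn_change_of_variables:
  fixes L :: "real^'n::finite \<Rightarrow> real^'n"
  assumes S: "S \<in> sets borel" and der: "\<And>x. x \<in> S \<Longrightarrow> (L has_derivative L' x) (at x)"
    and inj: "inj_on L S" and LS: "L ` S \<in> sets borel" "bounded (L ` S)"
    and dm: "(\<lambda>x. indicator S x * ennreal \<bar>det (matrix (L' x))\<bar>) \<in> borel_measurable borel"
    and q: "q \<in> borel_measurable borel"
  shows "(\<integral>\<^sup>+x. indicator S x * (q (L x) * ennreal \<bar>det (matrix (L' x))\<bar>) \<partial>lborel) = (\<integral>\<^sup>+y. indicator (L ` S) y * q y \<partial>lborel)"
proof -
  define S2 where "S2 = of_wo -` S"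
  define L2 where "L2 x = to_wo (L (of_wo x))" for x
  define L2' where "L2' x v = to_wo (L' (of_wo x) (of_wo v))" for x v
  have blin: "bounded_linear (to_wo :: real^'n \<Rightarrow> _)" "bounded_linear (of_wo :: real^'n wo \<Rightarrow> _)"
    using linear_wo linear_conv_bounded_linear by blast+
  have img: "L2 ` S2 = of_wo -` (L ` S)"
  proof -
    have "y \<in> L2 ` S2" if "of_wo y = L x" "x \<in> S" for x y
    proof (rule image_eqI[of _ _ "to_wo x"])
      have "y = to_wo (of_wo y)" by simp
      then show "y = L2 (to_wo x)" unfolding that(1) L2_def by simp
    qed (use that in \<open>simp add: S2_def\<close>)
    then show ?thesis by (auto simp: S2_def L2_def)
  qed
  have det2: "det (matrix (L2' x)) = det (matrix (L' (of_wo x)))" for x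
    unfolding L2'_def by (simp add: matrix_wo det_wo)
  have q2: "(\<lambda>y. q (of_wo y)) \<in> borel_measurable borel" using q by measurable
  have ob: "(of_wo :: real^'n wo \<Rightarrow> _) \<in> measurable lborel borel" by simp
  have "(\<integral>\<^sup>+x. indicator S2 x * (q (of_wo (L2 x)) * ennreal \<bar>det (matrix (L2' x))\<bar>) \<partial>lborel)
      = (\<integral>\<^sup>+y. indicator (L2 ` S2) y * q (of_wo y) \<partial>lborel)"
  proof (rule nn_change_of_variables_wo[OF _ _ _ _ _ _ q2])
    show "S2 \<in> sets borel" unfolding S2_def using measurable_sets[OF wo_measurable(2) S] by simp
    show "(L2 has_derivative L2' x) (at x)" if "x \<in> S2" for x
    proof -
      have "(L has_derivative L' (of_wo x)) (at (of_wo x))" using der that by (simp add: S2_def)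
      from has_derivative_compose[OF bounded_linear_imp_has_derivative[OF blin(2)] this]
      have "((\<lambda>x. L (of_wo x)) has_derivative (\<lambda>v. L' (of_wo x) (of_wo v))) (at x)" .
      from bounded_linear.has_derivative[OF blin(1) this]
      show ?thesis unfolding L2_def L2'_def .
    qed
    show "inj_on L2 S2"
    proof (rule inj_onI)
      fix x y assume *: "x \<in> S2" "y \<in> S2" "L2 x = L2 y"
      then have "L (of_wo x) = L (of_wo y)" unfolding L2_def by (metis of_to_wo(1))
      then have "of_wo x = of_wo y" using inj * by (auto simp: S2_def dest: inj_onD)
      then show "x = y" by (metis of_to_wo(2))
    qed
    show "L2 ` S2 \<in> sets borel" unfolding img using measurable_sets[OF wo_measurable(2) LS(1)] by simp
    have "x \<in> to_wo ` (L ` S)" if "of_wo x \<in> L ` S" for x :: "real^'n wo"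
      by (rule image_eqI[of _ _ "of_wo x"]) (use that in simp_all)
    then have "L2 ` S2 = to_wo ` (L ` S)" unfolding img by auto
    then show "bounded (L2 ` S2)" using bounded_linear_image[OF LS(2) blin(1)] by simp
    have "(\<lambda>x. indicator S (of_wo x) * ennreal \<bar>det (matrix (L' (of_wo x)))\<bar>) \<in> borel_measurable borel"
      by (rule measurable_compose[OF wo_measurable(2) dm])
    then show "(\<lambda>x. indicator S2 x * ennreal \<bar>det (matrix (L2' x))\<bar>) \<in> borel_measurable borel"
      by (simp add: det2 S2_def indicator_def)
  qed
  moreover have "(\<integral>\<^sup>+y. indicator (L2 ` S2) y * q (of_wo y) \<partial>lborel) = (\<integral>\<^sup>+y. indicator (L ` S) y * q y \<partial>lborel)"
  proof -
    have "(\<integral>\<^sup>+y. indicator (L ` S) y * q y \<partial>lborel) = (\<integral>\<^sup>+y. indicator (L ` S) y * q y \<partial>distr lborel borel of_wo)"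
      by (simp add: lborel_of_wo)
    also have "\<dots> = (\<integral>\<^sup>+y. indicator (L ` S) (of_wo y) * q (of_wo y) \<partial>lborel)"
      using LS(1) q by (intro nn_integral_distr) auto
    finally show ?thesis unfolding img by (simp add: indicator_def)
  qed
  moreover have "(\<integral>\<^sup>+x. indicator S2 x * (q (of_wo (L2 x)) * ennreal \<bar>det (matrix (L2' x))\<bar>) \<partial>lborel)
      = (\<integral>\<^sup>+x. indicator S x * (q (L x) * ennreal \<bar>det (matrix (L' x))\<bar>) \<partial>lborel)"
  proof -
    have cont: "continuous_on S L"
      by (rule continuous_at_imp_continuous_on) (use der has_derivative_continuous in blast)
    define L0 where "L0 x = (if x \<in> S then L x else 0)" for x
    have L0: "L0 \<in> borel_measurable borel"
      unfolding L0_def using S cont by (intro borel_measurable_continuous_on_if) auto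
    have "(\<lambda>x. q (L0 x) * (indicator S x * ennreal \<bar>det (matrix (L' x))\<bar>)) \<in> borel_measurable borel"
      using measurable_compose[OF L0 q] dm by measurable
    moreover have "q (L0 x) * (indicator S x * ennreal \<bar>det (matrix (L' x))\<bar>) = indicator S x * (q (L x) * ennreal \<bar>det (matrix (L' x))\<bar>)" for x
      by (simp add: L0_def indicator_def)
    ultimately have m: "(\<lambda>x. indicator S x * (q (L x) * ennreal \<bar>det (matrix (L' x))\<bar>)) \<in> borel_measurable borel" by simp
    have "(\<integral>\<^sup>+x. indicator S x * (q (L x) * ennreal \<bar>det (matrix (L' x))\<bar>) \<partial>lborel)
      = (\<integral>\<^sup>+x. indicator S x * (q (L x) * ennreal \<bar>det (matrix (L' x))\<bar>) \<partial>distr lborel borel of_wo)"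
      by (simp add: lborel_of_wo)
    also have "\<dots> = (\<integral>\<^sup>+x. indicator S (of_wo x) * (q (L (of_wo x)) * ennreal \<bar>det (matrix (L' (of_wo x)))\<bar>) \<partial>lborel)"
      by (rule nn_integral_distr) (use ob m in auto)
    finally show ?thesis by (simp add: det2 L2_def S2_def indicator_def)
  qed
  ultimately show ?thesis by simp
qed

section \<open>Jacobians in charts\<close>

lemma continuous_on_det:
  fixes M :: "'a::topological_space \<Rightarrow> real^'n::finite^'n"
  assumes "\<And>i j. continuous_on S (\<lambda>x. M x $ i $ j)"
  shows "continuous_on S (\<lambda>x. det (M x))"
  unfolding det_def by (intro continuous_intros assms)

text \<open>The determinant does not vanish on the segment from the identity to \<open>P\<close>, which consists of
  positive definite matrices.\<close>

lemma det_pos_definite: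
  fixes P :: "real^'n::finite^'n"
  assumes pos: "\<And>v. v \<noteq> 0 \<Longrightarrow> v \<bullet> (P *v v) > 0"
  shows "det P > 0"
proof -
  define Q where "Q t = t *\<^sub>R P + (1 - t) *\<^sub>R (mat 1 :: real^'n^'n)" for t
  have Qpos: "v \<bullet> (Q t *v v) > 0" if "v \<noteq> 0" "t \<in> {0..1}" for v t
  proof -
    have "v \<bullet> (Q t *v v) = t * (v \<bullet> (P *v v)) + (1 - t) * (v \<bullet> v)"
      by (simp add: Q_def matrix_vector_mult_add_rdistrib scaleR_matrix_vector_assoc[symmetric] inner_add_right)
    moreover have "t * (v \<bullet> (P *v v)) + (1 - t) * (v \<bullet> v) > 0"
    proof (cases "t = 0")
      case True
      then show ?thesis using that(1) by simp
    next
      case False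
      then have "t * (v \<bullet> (P *v v)) > 0" using that pos[OF that(1)] by simp
      moreover have "(1 - t) * (v \<bullet> v) \<ge> 0" using that by simp
      ultimately show ?thesis by linarith
    qed
    ultimately show ?thesis by simp
  qed
  have nz: "det (Q t) \<noteq> 0" if "t \<in> {0..1}" for t
  proof -
    have "v = 0" if "Q t *v v = 0" for v
    proof (rule ccontr)
      assume "v \<noteq> 0"
      from Qpos[OF this \<open>t \<in> {0..1}\<close>] show False using that by simp
    qed
    then have "\<exists>B. B ** Q t = mat 1" unfolding matrix_left_invertible_ker by simp
    then show ?thesis by (simp add: invertible_left_inverse[symmetric] invertible_det_nz)
  qed
  have "continuous_on {0..1} (\<lambda>t. det (Q t))"
    unfolding Q_def by (intro continuous_on_det) (simp, intro continuous_intros)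
  moreover have "det (Q 0) = 1" "Q 1 = P" by (simp_all add: Q_def)
  ultimately show ?thesis
  proof (rule_tac ccontr)
    assume *: "continuous_on {0..1} (\<lambda>t. det (Q t))" "det (Q 0) = 1" "Q 1 = P" "\<not> det P > 0"
    have "\<exists>t\<ge>0. t \<le> 1 \<and> det (Q t) = 0"
      by (rule IVT2') (use * in auto)
    then show False using nz by auto
  qed
qed

lemma Ck_on_1:
  "Ck_on 1 S f \<longleftrightarrow> (\<forall>x\<in>S. f differentiable (at x)) \<and> (\<forall>v. continuous_on S (\<lambda>x. frechet_derivative f (at x) v))"
  unfolding One_nat_def by simp

locale closed_riemannian =
  fixes A :: "('m::{t2_space, second_countable_topology}, 'n::finite) chart set"
    and G :: "('m, 'n) chart \<Rightarrow> 'm \<Rightarrow> real^'n^'n"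
  assumes manifold: "closed_riemannian_manifold A G"
begin

lemma compact_manifold: "compact (UNIV :: 'm set)"
  using manifold by (simp add: closed_riemannian_manifold_def)

lemma chartD:
  assumes "c \<in> A"
  shows "open (fst c)" "open (snd c ` fst c)" "continuous_on (fst c) (snd c)"
    "continuous_on (snd c ` fst c) (chart_inv c)"
    "p \<in> fst c \<Longrightarrow> chart_inv c (snd c p) = p"
    "x \<in> snd c ` fst c \<Longrightarrow> chart_inv c x \<in> fst c"
    "x \<in> snd c ` fst c \<Longrightarrow> snd c (chart_inv c x) = x"
proof -
  have "is_chart c" using manifold assms by (simp add: closed_riemannian_manifold_def smooth_atlas_def)
  then have *: "open (fst c)" "open (snd c ` fst c)" and h: "homeomorphism (fst c) (snd c ` fst c) (snd c) (chart_inv c)"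
    by (simp_all add: is_chart_def)
  show "open (fst c)" "open (snd c ` fst c)" by fact+
  show "continuous_on (fst c) (snd c)" "continuous_on (snd c ` fst c) (chart_inv c)"
    using h by (simp_all add: homeomorphism_def)
  show "p \<in> fst c \<Longrightarrow> chart_inv c (snd c p) = p" using homeomorphism_apply1[OF h] .
  show "x \<in> snd c ` fst c \<Longrightarrow> snd c (chart_inv c x) = x" using homeomorphism_apply2[OF h] .
  show "x \<in> snd c ` fst c \<Longrightarrow> chart_inv c x \<in> fst c" using h by (auto simp: homeomorphism_def)
qed

lemma chart_exists: "\<exists>c\<in>A. p \<in> fst c"
proof -
  have "(\<Union>c\<in>A. fst c) = UNIV" using manifold by (simp add: closed_riemannian_manifold_def smooth_atlas_def)
  then show ?thesis by blast
qed

lemma chart_at: "chart_at A p \<in> A" "p \<in> fst (chart_at A p)"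
proof -
  have "\<exists>c. c \<in> A \<and> p \<in> fst c" using chart_exists by blast
  from someI_ex[OF this] show "chart_at A p \<in> A" "p \<in> fst (chart_at A p)" unfolding chart_at_def by auto
qed

text \<open>Pointwise differentiability passes to compositions at once, whatever chart is used in between,
  and it is all that the chain rule for Jacobians needs.\<close>

definition diff_map :: "('m \<Rightarrow> 'm) \<Rightarrow> bool" where
  "diff_map f \<longleftrightarrow> continuous_on UNIV f \<and> (\<forall>c\<in>A. \<forall>d\<in>A. \<forall>p. p \<in> fst c \<longrightarrow> f p \<in> fst d \<longrightarrow>
     local_rep c d f differentiable (at (snd c p)))"

lemma C1_diff_map: "C1_map A f \<Longrightarrow> diff_map f"
  unfolding diff_map_def
proof (intro conjI ballI allI impI)
  assume f: "C1_map A f"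
  show "continuous_on UNIV f" using f by (simp add: C1_map_def)
  fix c d p assume cd: "c \<in> A" "d \<in> A" "p \<in> fst c" "f p \<in> fst d"
  have "Ck_on 1 (snd c ` (fst c \<inter> f -` fst d)) (local_rep c d f)"
    using f cd by (simp add: C1_map_def)
  then have "\<forall>x\<in>snd c ` (fst c \<inter> f -` fst d). local_rep c d f differentiable (at x)"
    unfolding Ck_on_1 by (rule conjunct1)
  then show "local_rep c d f differentiable (at (snd c p))" using cd by simp
qed

lemma diff_map_cont: "diff_map f \<Longrightarrow> continuous_on UNIV f"
  by (simp add: diff_map_def)

lemma Diff1D: "f \<in> Diff1 A \<Longrightarrow> bij f" "f \<in> Diff1 A \<Longrightarrow> C1_map A f" "f \<in> Diff1 A \<Longrightarrow> C1_map A (inv f)"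
  by (simp_all add: Diff1_def)

lemma local_rep_has_derivative:
  assumes "diff_map f" "c \<in> A" "d \<in> A" "p \<in> fst c" "f p \<in> fst d"
  shows "(local_rep c d f has_derivative local_deriv c d f p) (at (snd c p))"
proof -
  have "local_rep c d f differentiable (at (snd c p))" using assms by (simp add: diff_map_def)
  then show ?thesis unfolding local_deriv_def by (simp add: frechet_derivative_works)
qed

lemma open_local_domain:
  assumes f: "continuous_on UNIV f" and "c \<in> A" "d \<in> A"
  shows "open {x \<in> snd c ` fst c. f (chart_inv c x) \<in> fst d}"
proof -
  have "continuous_on (snd c ` fst c) (\<lambda>x. f (chart_inv c x))"
    by (rule continuous_on_compose2[OF f chartD(4)[OF assms(2)]]) simp
  from continuous_open_preimage[OF this chartD(2)[OF assms(2)] chartD(1)[OF assms(3)]]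
  show ?thesis by (simp add: Int_def vimage_def)
qed

lemma local_rep_chain:
  assumes f: "diff_map f" and g: "diff_map g" and c: "c \<in> A" "d \<in> A" "e \<in> A"
    and p: "p \<in> fst c" "f p \<in> fst d" "g (f p) \<in> fst e"
  shows "(local_rep c e (g \<circ> f) has_derivative (\<lambda>v. local_deriv d e g (f p) (local_deriv c d f p v))) (at (snd c p))"
proof -
  have df: "(local_rep c d f has_derivative local_deriv c d f p) (at (snd c p))"
    by (rule local_rep_has_derivative[OF f c(1,2) p(1,2)])
  have "local_rep c d f (snd c p) = snd d (f p)"
    using chartD(5)[OF c(1) p(1)] by (simp add: local_rep_def)
  then have dg: "(local_rep d e g has_derivative local_deriv d e g (f p)) (at (local_rep c d f (snd c p)))"
    using local_rep_has_derivative[OF g c(2,3) p(2,3)] by simp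
  have "((\<lambda>x. local_rep d e g (local_rep c d f x)) has_derivative (\<lambda>v. local_deriv d e g (f p) (local_deriv c d f p v))) (at (snd c p))"
    by (rule has_derivative_compose[OF df dg])
  then show ?thesis
  proof (rule has_derivative_transform_within_open[OF _ open_local_domain[OF diff_map_cont[OF f] c(1,2)]])
    show "snd c p \<in> {x \<in> snd c ` fst c. f (chart_inv c x) \<in> fst d}"
      using p chartD(5)[OF c(1) p(1)] by simp
    fix x assume "x \<in> {x \<in> snd c ` fst c. f (chart_inv c x) \<in> fst d}"
    then show "local_rep d e g (local_rep c d f x) = local_rep c e (g \<circ> f) x"
      using chartD(5)[OF c(2)] by (simp add: local_rep_def)
  qed
qed

lemma diff_map_comp: "diff_map f \<Longrightarrow> diff_map g \<Longrightarrow> diff_map (g \<circ> f)"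
  unfolding diff_map_def[of "g \<circ> f"]
proof (intro conjI ballI allI impI)
  assume f: "diff_map f" and g: "diff_map g"
  show "continuous_on UNIV (g \<circ> f)"
    using diff_map_cont[OF f] diff_map_cont[OF g] by (intro continuous_on_compose) (auto intro: continuous_on_subset)
  fix c e p assume ce: "c \<in> A" "e \<in> A" "p \<in> fst c" "(g \<circ> f) p \<in> fst e"
  from chart_exists[of "f p"] obtain d where d: "d \<in> A" "f p \<in> fst d" by (elim bexE)
  have "g (f p) \<in> fst e" using ce(4) by simp
  from local_rep_chain[OF f g ce(1) d(1) ce(2) ce(3) d(2) this]
  show "local_rep c e (g \<circ> f) differentiable at (snd c p)" by (rule differentiableI)
qed

lemma local_deriv_chain:
  assumes "diff_map f" "diff_map g" "c \<in> A" "d \<in> A" "e \<in> A" "p \<in> fst c" "f p \<in> fst d" "g (f p) \<in> fst e"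
  shows "matrix (local_deriv c e (g \<circ> f) p) = matrix (local_deriv d e g (f p)) ** matrix (local_deriv c d f p)"
proof -
  have "local_deriv c e (g \<circ> f) p = (\<lambda>v. local_deriv d e g (f p) (local_deriv c d f p v))"
    unfolding local_deriv_def[of c e] by (rule frechet_derivative_at[symmetric, OF local_rep_chain[OF assms]])
  moreover have "linear (local_deriv c d f p)" "linear (local_deriv d e g (f p))"
    by (rule has_derivative_linear[OF local_rep_has_derivative]; use assms in simp)+
  ultimately show ?thesis using matrix_compose[of "local_deriv c d f p" "local_deriv d e g (f p)"] by (simp add: comp_def)
qed

lemma diff_map_id: "diff_map id"
  unfolding diff_map_def
proof (intro conjI ballI allI impI)
  show "continuous_on UNIV (id :: 'm \<Rightarrow> 'm)" by (simp add: id_def continuous_on_id)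
  fix c d p assume cd: "c \<in> A" "d \<in> A" and p: "p \<in> fst c" "id p \<in> fst d"
  have "smooth_on (snd c ` (fst c \<inter> fst d)) (local_rep c d id)"
    using manifold cd by (simp add: closed_riemannian_manifold_def smooth_atlas_def)
  then have "Ck_on 1 (snd c ` (fst c \<inter> fst d)) (local_rep c d id)" by (simp only: smooth_on_def)
  then show "local_rep c d id differentiable at (snd c p)" using p unfolding Ck_on_1 by simp
qed

text \<open>The density of the Riemannian volume in the chart \<open>c\<close>.\<close>

definition vol :: "('m, 'n) chart \<Rightarrow> 'm \<Rightarrow> real" where
  "vol c p = sqrt (det (G c p))"

lemma det_G_pos:
  assumes "c \<in> A" "p \<in> fst c"
  shows "det (G c p) > 0"
proof (rule det_pos_definite)
  have "\<forall>c\<in>A. \<forall>p\<in>fst c. transpose (G c p) = G c p \<and> (\<forall>v. v \<noteq> 0 \<longrightarrow> v \<bullet> (G c p *v v) > 0)"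
    using manifold unfolding closed_riemannian_manifold_def riemannian_metric_def by (elim conjE)
  from bspec[OF bspec[OF this assms(1)] assms(2)]
  show "v \<noteq> 0 \<Longrightarrow> v \<bullet> (G c p *v v) > 0" for v by simp
qed

lemma vol_pos: "c \<in> A \<Longrightarrow> p \<in> fst c \<Longrightarrow> vol c p > 0"
  using det_G_pos by (simp add: vol_def)

lemma vol_change:
  assumes "c \<in> A" "d \<in> A" "p \<in> fst c" "p \<in> fst d"
  shows "vol c p = \<bar>det (matrix (local_deriv c d id p))\<bar> * vol d p"
proof -
  let ?T = "local_deriv c d id p" and ?M = "matrix (local_deriv c d id p)"
  have lin: "linear ?T"
    by (rule has_derivative_linear[OF local_rep_has_derivative[OF diff_map_id]]) (use assms in auto)
  have T: "?T v = ?M *v v" for v using matrix_works[OF linear_matrix_vector_mul_eq[THEN iffD2, OF lin]] by simp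
  have tr: "u \<bullet> (G c p *v v) = ?T u \<bullet> (G d p *v ?T v)" for u v
  proof -
    have "\<forall>c\<in>A. \<forall>d\<in>A. \<forall>p\<in>fst c \<inter> fst d. \<forall>u v.
        u \<bullet> (G c p *v v) = local_deriv c d id p u \<bullet> (G d p *v local_deriv c d id p v)"
      using manifold unfolding closed_riemannian_manifold_def riemannian_metric_def by (elim conjE)
    from bspec[OF bspec[OF bspec[OF this assms(1)] assms(2)], of p] show ?thesis using assms(3,4) by simp
  qed
  have "G c p = transpose ?M ** G d p ** ?M"
  proof (subst matrix_eq, rule allI)
    fix v
    have "u \<bullet> (G c p *v v) = u \<bullet> ((transpose ?M ** G d p ** ?M) *v v)" for u
    proof -
      have "u \<bullet> (G c p *v v) = (?M *v u) \<bullet> (G d p *v (?M *v v))" using tr T by simp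
      also have "\<dots> = (u v* transpose ?M) \<bullet> (G d p *v (?M *v v))" by simp
      also have "\<dots> = u \<bullet> (transpose ?M *v (G d p *v (?M *v v)))" by (rule dot_lmul_matrix)
      finally show ?thesis by (simp add: matrix_vector_mul_assoc matrix_mul_assoc)
    qed
    then show "G c p *v v = (transpose ?M ** G d p ** ?M) *v v" by (rule vector_eq_ldot[THEN iffD1, OF allI])
  qed
  then have "det (G c p) = (det ?M)\<^sup>2 * det (G d p)"
    by (simp add: det_mul power2_eq_square)
  then show ?thesis by (simp add: vol_def real_sqrt_mult)
qed

text \<open>By the transformation rules for the metric and for derivatives, any charts compute the
  Jacobian.\<close>

lemma Jac_chart:
  assumes f: "diff_map f" and c: "c \<in> A" "d \<in> A" "p \<in> fst c" "f p \<in> fst d"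
  shows "Jac A G f p = vol d (f p) / vol c p * \<bar>det (matrix (local_deriv c d f p))\<bar>"
proof -
  let ?c = "chart_at A p" and ?d = "chart_at A (f p)"
  note cA = chart_at[of p] and dA = chart_at[of "f p"]
  have "matrix (local_deriv ?c d (f \<circ> id) p) = matrix (local_deriv c d f (id p)) ** matrix (local_deriv ?c c id p)"
    by (rule local_deriv_chain[OF diff_map_id f]) (use c cA dA in auto)
  then have 1: "matrix (local_deriv ?c d f p) = matrix (local_deriv c d f p) ** matrix (local_deriv ?c c id p)" by simp
  have "matrix (local_deriv ?c ?d (id \<circ> f) p) = matrix (local_deriv d ?d id (f p)) ** matrix (local_deriv ?c d f p)"
    by (rule local_deriv_chain[OF f diff_map_id]) (use c cA dA in auto)
  then have "matrix (local_deriv ?c ?d f p) = matrix (local_deriv d ?d id (f p)) ** (matrix (local_deriv c d f p) ** matrix (local_deriv ?c c id p))"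
    using 1 by simp
  then have D: "\<bar>det (matrix (local_deriv ?c ?d f p))\<bar> = \<bar>det (matrix (local_deriv d ?d id (f p)))\<bar> * \<bar>det (matrix (local_deriv c d f p))\<bar> * \<bar>det (matrix (local_deriv ?c c id p))\<bar>"
    by (simp add: det_mul abs_mult)
  have vc: "vol ?c p = \<bar>det (matrix (local_deriv ?c c id p))\<bar> * vol c p"
    by (rule vol_change[OF cA(1) c(1) cA(2) c(3)])
  have vd: "vol d (f p) = \<bar>det (matrix (local_deriv d ?d id (f p)))\<bar> * vol ?d (f p)"
    by (rule vol_change[OF c(2) dA(1) c(4) dA(2)])
  have pos: "vol ?c p > 0" "vol c p > 0" using vol_pos cA c by auto
  have nz: "\<bar>det (matrix (local_deriv ?c c id p))\<bar> \<noteq> 0" using vc pos by auto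
  have "Jac A G f p = vol ?d (f p) / vol ?c p * \<bar>det (matrix (local_deriv ?c ?d f p))\<bar>"
    unfolding Jac_def Let_def vol_def ..
  also have "\<dots> = vol d (f p) / vol c p * \<bar>det (matrix (local_deriv c d f p))\<bar>"
    unfolding D vc vd using nz by simp
  finally show ?thesis .
qed

lemma Jac_nonneg: "diff_map f \<Longrightarrow> Jac A G f p \<ge> 0"
  using Jac_chart[OF _ chart_at(1) chart_at(1) chart_at(2) chart_at(2), of f p]
    vol_pos[OF chart_at, of p] vol_pos[OF chart_at, of "f p"] by simp

lemma Jac_chain:
  assumes "diff_map f" "diff_map g"
  shows "Jac A G (g \<circ> f) p = Jac A G g (f p) * Jac A G f p"
proof -
  let ?c = "chart_at A p" and ?d = "chart_at A (f p)" and ?e = "chart_at A (g (f p))"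
  note c = chart_at[of p] chart_at[of "f p"] chart_at[of "g (f p)"]
  have "Jac A G (g \<circ> f) p = vol ?e (g (f p)) / vol ?c p * \<bar>det (matrix (local_deriv ?c ?e (g \<circ> f) p))\<bar>"
    using Jac_chart[OF diff_map_comp[OF assms], of ?c ?e p] c by simp
  moreover have "matrix (local_deriv ?c ?e (g \<circ> f) p) = matrix (local_deriv ?d ?e g (f p)) ** matrix (local_deriv ?c ?d f p)"
    by (rule local_deriv_chain[OF assms]) (use c in auto)
  moreover have "Jac A G g (f p) = vol ?e (g (f p)) / vol ?d (f p) * \<bar>det (matrix (local_deriv ?d ?e g (f p)))\<bar>"
    by (rule Jac_chart[OF assms(2)]) (use c in auto)
  moreover have "Jac A G f p = vol ?d (f p) / vol ?c p * \<bar>det (matrix (local_deriv ?c ?d f p))\<bar>"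
    by (rule Jac_chart[OF assms(1)]) (use c in auto)
  moreover have "vol ?d (f p) \<noteq> 0" using vol_pos[OF c(3,4)] by simp
  ultimately show ?thesis by (simp add: det_mul abs_mult)
qed

lemma Jac_id: "Jac A G id p = 1"
proof -
  let ?c = "chart_at A p"
  note c = chart_at[of p]
  have "local_deriv ?c ?c id p = (\<lambda>v. v)"
    unfolding local_deriv_def
  proof (rule frechet_derivative_at[symmetric])
    show "(local_rep ?c ?c id has_derivative (\<lambda>v. v)) (at (snd ?c p))"
    proof (rule has_derivative_transform_within_open[OF has_derivative_ident chartD(2)[OF c(1)]])
      show "snd ?c p \<in> snd ?c ` fst ?c" using c(2) by simp
      show "x = local_rep ?c ?c id x" if "x \<in> snd ?c ` fst ?c" for x
        using chartD(7)[OF c(1) that] by (simp add: local_rep_def)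
    qed
  qed
  then have "matrix (local_deriv ?c ?c id p) = mat 1" using matrix_id_mat_1 by (simp add: id_def)
  then show ?thesis using Jac_chart[OF diff_map_id, of ?c ?c p] c vol_pos[OF c] by simp
qed

lemma Jac_pos:
  assumes "f \<in> Diff1 A"
  shows "Jac A G f p > 0"
proof -
  note D = Diff1D[OF assms]
  have "inv f \<circ> f = id" using D(1) by (simp add: bij_is_inj)
  then have "Jac A G (inv f) (f p) * Jac A G f p = 1"
    using Jac_chain[OF C1_diff_map[OF D(2)] C1_diff_map[OF D(3)], of p] Jac_id by simp
  then have "Jac A G f p \<noteq> 0" by auto
  then show ?thesis using Jac_nonneg[OF C1_diff_map[OF D(2)], of p] by simp
qed

lemma continuous_on_G:
  assumes "c \<in> A"
  shows "continuous_on (fst c) (\<lambda>p. det (G c p))"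
proof -
  have "smooth_on (snd c ` fst c) (\<lambda>x. G c (chart_inv c x))"
    using manifold assms by (simp add: closed_riemannian_manifold_def riemannian_metric_def)
  then have "Ck_on 0 (snd c ` fst c) (\<lambda>x. G c (chart_inv c x))" by (simp only: smooth_on_def)
  then have cG: "continuous_on (snd c ` fst c) (\<lambda>x. G c (chart_inv c x))" by simp
  have "continuous_on (fst c) (\<lambda>p. G c (chart_inv c (snd c p)))"
    by (rule continuous_on_compose2[OF cG chartD(3)[OF assms]]) simp
  then have "continuous_on (fst c) (\<lambda>p. G c p)"
    by (rule continuous_on_eq) (simp add: chartD(5)[OF assms])
  then show ?thesis by (intro continuous_on_det continuous_intros)
qed

lemma continuous_on_vol: "c \<in> A \<Longrightarrow> continuous_on (fst c) (vol c)"
  unfolding vol_def[abs_def] by (intro continuous_on_real_sqrt continuous_on_G)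

lemma continuous_on_local_det:
  assumes f: "C1_map A f" and c: "c \<in> A" "d \<in> A"
  shows "continuous_on (snd c ` (fst c \<inter> f -` fst d)) (\<lambda>x. det (matrix (frechet_derivative (local_rep c d f) (at x))))"
proof (rule continuous_on_det)
  fix i j
  have "Ck_on 1 (snd c ` (fst c \<inter> f -` fst d)) (local_rep c d f)"
    using f c by (simp add: C1_map_def)
  then have "continuous_on (snd c ` (fst c \<inter> f -` fst d)) (\<lambda>x. frechet_derivative (local_rep c d f) (at x) (axis j 1))"
    unfolding Ck_on_1 by blast
  then have "continuous_on (snd c ` (fst c \<inter> f -` fst d)) (\<lambda>x. frechet_derivative (local_rep c d f) (at x) (axis j 1) $ i)"
    by (intro continuous_intros)
  then show "continuous_on (snd c ` (fst c \<inter> f -` fst d)) (\<lambda>x. matrix (frechet_derivative (local_rep c d f) (at x)) $ i $ j)"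
    by (simp add: matrix_def)
qed

lemma continuous_Jac:
  assumes f: "C1_map A f"
  shows "continuous_on UNIV (Jac A G f)"
proof -
  have fc: "continuous_on UNIV f" using f by (simp add: C1_map_def)
  have "isCont (Jac A G f) p" for p
  proof -
    let ?c = "chart_at A p" and ?d = "chart_at A (f p)"
    note c = chart_at[of p] chart_at[of "f p"]
    define U where "U = fst ?c \<inter> f -` fst ?d"
    have U: "open U" "p \<in> U"
      unfolding U_def using chartD(1)[OF c(1)] open_vimage[OF chartD(1)[OF c(3)] fc] c by auto
    have sub: "U \<subseteq> fst ?c" by (auto simp: U_def)
    have 1: "continuous_on U (\<lambda>q. det (matrix (local_deriv ?c ?d f q)))"
      unfolding local_deriv_def
      by (rule continuous_on_compose2[OF continuous_on_local_det[OF f c(1,3)] continuous_on_subset[OF chartD(3)[OF c(1)] sub]])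
         (simp add: U_def)
    have 2: "continuous_on U (\<lambda>q. vol ?d (f q))"
      by (rule continuous_on_compose2[OF continuous_on_vol[OF c(3)] continuous_on_subset[OF fc]]) (auto simp: U_def)
    have 3: "continuous_on U (vol ?c)" by (rule continuous_on_subset[OF continuous_on_vol[OF c(1)] sub])
    have nz: "\<forall>q\<in>U. vol ?c q \<noteq> 0" using vol_pos[OF c(1)] sub by (auto simp: less_le)
    have "continuous_on U (\<lambda>q. vol ?d (f q) / vol ?c q * \<bar>det (matrix (local_deriv ?c ?d f q))\<bar>)"
      by (intro continuous_on_mult continuous_on_divide 2 3 nz continuous_on_rabs 1)
    then have "continuous_on U (Jac A G f)"
    proof (rule continuous_on_eq)
      fix q assume "q \<in> U"
      then show "vol ?d (f q) / vol ?c q * \<bar>det (matrix (local_deriv ?c ?d f q))\<bar> = Jac A G f q"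
        using Jac_chart[OF C1_diff_map[OF f] c(1,3)] by (simp add: U_def)
    qed
    then show ?thesis using U continuous_on_eq_continuous_at by blast
  qed
  then show ?thesis by (simp add: continuous_at_imp_continuous_on)
qed

lemma inverse_Jac_bounded:
  assumes "f \<in> Diff1 A"
  shows "bdd_above (range (\<lambda>p. inverse (Jac A G f p)))"
proof -
  have "continuous_on UNIV (\<lambda>p. inverse (Jac A G f p))"
    using Jac_pos[OF assms] by (intro continuous_on_inverse continuous_Jac Diff1D(2)[OF assms]) (auto simp: less_le)
  from compact_continuous_image[OF this compact_manifold] show ?thesis
    by (intro bounded_imp_bdd_above[OF compact_imp_bounded])
qed

end

section \<open>The Riemannian volume\<close>

context closed_riemannian
begin

text \<open>On such pieces the volume is a finite sum of Lebesgue integrals. The bounds make the total mass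
  finite, and the open piece makes it positive.\<close>

definition volume_partition :: "nat \<Rightarrow> (nat \<Rightarrow> ('m, 'n) chart) \<Rightarrow> (nat \<Rightarrow> 'm set) \<Rightarrow> bool" where
  "volume_partition r c V \<longleftrightarrow> 0 < r \<and> open (V 0) \<and> V 0 \<noteq> {} \<and> (\<Union>i<r. V i) = UNIV \<and>
     (\<forall>i<r. \<forall>j<r. i \<noteq> j \<longrightarrow> V i \<inter> V j = {}) \<and>
     (\<forall>i<r. c i \<in> A \<and> V i \<in> sets borel \<and> V i \<subseteq> fst (c i) \<and> bounded (snd (c i) ` V i) \<and>
        (\<exists>B. \<forall>p\<in>V i. vol (c i) p \<le> B))"

lemma volume_partition_exists: "\<exists>r c V. volume_partition r c V"
proof -
  define good where "good c W \<longleftrightarrow> c \<in> A \<and> open W \<and> W \<subseteq> fst c \<and> bounded (snd c ` W) \<and> (\<exists>B. \<forall>p\<in>W. vol c p \<le> B)"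
    for c and W :: "'m set"
  have "\<exists>W. good (chart_at A p) W \<and> p \<in> W" for p
  proof -
    let ?c = "chart_at A p"
    note c = chart_at[of p]
    have "snd ?c p \<in> snd ?c ` fst ?c" using c(2) by simp
    from bspec[OF open_contains_cball[THEN iffD1, OF chartD(2)[OF c(1)]] this]
    obtain e where e: "e > 0" "cball (snd ?c p) e \<subseteq> snd ?c ` fst ?c" by auto
    define W where "W = fst ?c \<inter> snd ?c -` ball (snd ?c p) e"
    have 1: "open W" unfolding W_def
      by (rule continuous_open_preimage[OF chartD(3)[OF c(1)] chartD(1)[OF c(1)]]) simp
    have img: "snd ?c ` W \<subseteq> cball (snd ?c p) e" by (auto simp: W_def)
    have 2: "bounded (snd ?c ` W)" using bounded_subset[OF bounded_cball img] .
    have cv: "continuous_on (snd ?c ` fst ?c) (\<lambda>x. vol ?c (chart_inv ?c x))"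
      by (rule continuous_on_compose2[OF continuous_on_vol[OF c(1)] chartD(4)[OF c(1)]]) (use chartD(6)[OF c(1)] in auto)
    have "compact ((\<lambda>x. vol ?c (chart_inv ?c x)) ` cball (snd ?c p) e)"
      by (rule compact_continuous_image[OF continuous_on_subset[OF cv e(2)] compact_cball])
    from bounded_imp_bdd_above[OF compact_imp_bounded[OF this]]
    obtain B where B: "\<forall>x\<in>cball (snd ?c p) e. vol ?c (chart_inv ?c x) \<le> B"
      unfolding bdd_above_def Set.ball_simps(9) by (elim exE)
    have 3: "\<forall>q\<in>W. vol ?c q \<le> B"
    proof
      fix q assume q: "q \<in> W"
      then have "snd ?c q \<in> cball (snd ?c p) e" using img by blast
      from bspec[OF B this] show "vol ?c q \<le> B" using chartD(5)[OF c(1), of q] q by (simp add: W_def)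
    qed
    have "p \<in> W" using c(2) e(1) by (simp add: W_def)
    moreover have "good ?c W" unfolding good_def using c(1) 1 2 3 by (auto simp: W_def)
    ultimately show ?thesis by blast
  qed
  then have "\<forall>p. \<exists>W. good (chart_at A p) W \<and> p \<in> W" ..
  from choice[OF this] obtain W where "\<forall>p. good (chart_at A p) (W p) \<and> p \<in> W p" by (elim exE)
  then have W: "good (chart_at A p) (W p)" "p \<in> W p" for p by simp_all
  have oW: "open (W p)" for p using W(1)[of p] by (simp add: good_def)
  obtain F where F: "finite F" "UNIV \<subseteq> (\<Union>p\<in>F. W p)"
    by (rule compactE_image[OF compact_manifold, of UNIV W]) (use oW W(2) in auto)
  obtain ps where ps: "set ps = F" using finite_list[OF F(1)] by (elim exE)
  define r where "r = length ps"
  define V where "V i = W (ps ! i) - (\<Union>j<i. W (ps ! j))" for i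
  define c where "c i = chart_at A (ps ! i)" for i
  have "F \<noteq> {}" using F(2) by auto
  then have r: "0 < r" using ps by (auto simp: r_def)
  have "x \<in> (\<Union>i<r. V i)" for x
  proof -
    obtain p where p: "p \<in> F" "x \<in> W p" using F(2) by auto
    then obtain i where "i < length ps" "ps ! i = p" using ps in_set_conv_nth[of p ps] by auto
    then have ex: "\<exists>i. i < r \<and> x \<in> W (ps ! i)" using p(2) unfolding r_def by (intro exI[of _ i]) simp
    define k where "k = (LEAST i. i < r \<and> x \<in> W (ps ! i))"
    have i: "k < r" "x \<in> W (ps ! k)" using LeastI_ex[OF ex] unfolding k_def[symmetric] by simp_all
    have "x \<notin> W (ps ! j)" if "j < k" for j
      using not_less_Least[of j "\<lambda>i. i < r \<and> x \<in> W (ps ! i)"] that i(1) unfolding k_def[symmetric] by auto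
    then have "x \<in> V k" using i(2) unfolding V_def by auto
    then show ?thesis using i(1) by auto
  qed
  then have cover: "(\<Union>i<r. V i) = UNIV" by auto
  have disj: "V i \<inter> V j = {}" if "i \<noteq> j" for i j
    using that by (cases i j rule: linorder_cases) (auto simp: V_def)
  have VW: "V i \<subseteq> W (ps ! i)" for i by (auto simp: V_def)
  have "c i \<in> A \<and> V i \<in> sets borel \<and> V i \<subseteq> fst (c i) \<and> bounded (snd (c i) ` V i) \<and> (\<exists>B. \<forall>p\<in>V i. vol (c i) p \<le> B)" for i
  proof (intro conjI)
    note g = W(1)[of "ps ! i", folded c_def, unfolded good_def]
    show "c i \<in> A" using g by simp
    show "V i \<in> sets borel" unfolding V_def using oW by (intro sets.Diff sets.finite_UN) auto
    show "V i \<subseteq> fst (c i)" using g VW by blast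
    have "bounded (snd (c i) ` W (ps ! i))" using g by simp
    then show "bounded (snd (c i) ` V i)" by (rule bounded_subset) (rule image_mono[OF VW])
    from g obtain B where "\<forall>p\<in>W (ps ! i). vol (c i) p \<le> B" by auto
    then show "\<exists>B. \<forall>p\<in>V i. vol (c i) p \<le> B" using VW by blast
  qed
  moreover have "open (V 0)" "V 0 \<noteq> {}" using oW W(2) by (auto simp: V_def)
  ultimately have "volume_partition r c V"
    unfolding volume_partition_def using r cover disj by blast
  then show ?thesis by blast
qed

text \<open>The inverse of a chart, made a Borel map on the whole space.\<close>

definition chart_inv0 :: "('m, 'n) chart \<Rightarrow> real^'n \<Rightarrow> 'm" where
  "chart_inv0 c x = (if x \<in> snd c ` fst c then chart_inv c x else undefined)"

lemma chart_inv0_measurable: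
  assumes "c \<in> A"
  shows "chart_inv0 c \<in> measurable borel borel"
  unfolding chart_inv0_def[abs_def]
  by (rule borel_measurable_continuous_on_if) (use chartD(2,4)[OF assms] in auto)

lemma chart_image_measurable:
  assumes c: "c \<in> A" and D: "D \<in> sets borel" "D \<subseteq> fst c"
  shows "snd c ` D \<in> sets borel"
proof -
  have "snd c ` D = snd c ` fst c \<inter> (chart_inv0 c -` D \<inter> space borel)"
  proof (rule set_eqI)
    fix x
    show "x \<in> snd c ` D \<longleftrightarrow> x \<in> snd c ` fst c \<inter> (chart_inv0 c -` D \<inter> space borel)"
    proof (cases "x \<in> snd c ` fst c")
      case True
      then obtain p where p: "p \<in> fst c" "x = snd c p" by blast
      have "x \<in> snd c ` D \<longleftrightarrow> p \<in> D"
      proof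
        assume "x \<in> snd c ` D"
        then obtain q where q: "x = snd c q" "q \<in> D" by (elim imageE)
        have "q \<in> fst c" using q(2) D(2) by (rule rev_subsetD)
        then have "chart_inv c x = q" unfolding q(1) by (rule chartD(5)[OF c])
        moreover have "chart_inv c x = p" unfolding p(2) by (rule chartD(5)[OF c p(1)])
        ultimately show "p \<in> D" using q(2) by metis
      qed (use p in blast)
      moreover have "chart_inv0 c x = p" using p chartD(5)[OF c p(1)] by (simp add: chart_inv0_def)
      ultimately show ?thesis using True by simp
    next
      case False
      then show ?thesis using D(2) by blast
    qed
  qed
  moreover have "snd c ` fst c \<in> sets borel" using chartD(2)[OF c] by simp
  ultimately show ?thesis using measurable_sets[OF chart_inv0_measurable[OF c] D(1)] by auto
qed

text \<open>The function on coordinates whose Lebesgue integral over \<open>snd c ` V\<close> is the integral of \<open>q\<close> over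
  \<open>V\<close>.\<close>

definition local_density :: "('m, 'n) chart \<Rightarrow> ('m \<Rightarrow> ennreal) \<Rightarrow> real^'n \<Rightarrow> ennreal" where
  "local_density c q x = (if x \<in> snd c ` fst c then q (chart_inv c x) * ennreal (vol c (chart_inv c x)) else 0)"

lemma local_density_measurable:
  assumes c: "c \<in> A" and q: "q \<in> borel_measurable borel"
  shows "local_density c q \<in> borel_measurable borel"
proof -
  have cv: "continuous_on (snd c ` fst c) (\<lambda>x. vol c (chart_inv c x))"
    by (rule continuous_on_compose2[OF continuous_on_vol[OF c] chartD(4)[OF c]]) (use chartD(6)[OF c] in auto)
  have "(\<lambda>x. if x \<in> snd c ` fst c then vol c (chart_inv c x) else 0) \<in> borel_measurable borel"
    by (rule borel_measurable_continuous_on_if) (use cv chartD(2)[OF c] in auto)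
  moreover have "(\<lambda>x. q (chart_inv0 c x)) \<in> borel_measurable borel"
    by (rule measurable_compose[OF chart_inv0_measurable[OF c] q])
  ultimately have "(\<lambda>x. q (chart_inv0 c x) * ennreal (if x \<in> snd c ` fst c then vol c (chart_inv c x) else 0)) \<in> borel_measurable borel"
    by measurable
  moreover have "(\<lambda>x. q (chart_inv0 c x) * ennreal (if x \<in> snd c ` fst c then vol c (chart_inv c x) else 0)) = local_density c q"
    by (rule ext) (simp add: local_density_def chart_inv0_def)
  ultimately show ?thesis by simp
qed

text \<open>The pieces are put side by side in the product of a finite index set with \<open>real^'n\<close>, and the
  measure there is transported by the inverse charts.\<close>

lemma volume_measure_exists:
  assumes P: "volume_partition r c V"
  shows "\<exists>M. sets M = sets (borel :: 'm measure) \<and> (\<forall>q\<in>borel_measurable borel.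
    (\<integral>\<^sup>+y. q y \<partial>M) = (\<Sum>i<r. \<integral>\<^sup>+x. indicator (snd (c i) ` V i) x * local_density (c i) q x \<partial>lborel))"
proof -
  have cA: "c i \<in> A" "V i \<in> sets borel" "V i \<subseteq> fst (c i)" if "i < r" for i
    using P that by (simp_all add: volume_partition_def)
  define N where "N = count_space {..<r} \<Otimes>\<^sub>M (lborel :: (real^'n) measure)"
  define w where "w p = indicator (snd (c (fst p)) ` V (fst p)) (snd p) * local_density (c (fst p)) (\<lambda>_. 1) (snd p)" for p
  define T where "T p = chart_inv0 (c (fst p)) (snd p)" for p
  have pieces: "f \<in> measurable N K" if "\<And>i. i < r \<Longrightarrow> (\<lambda>x. f (i, x)) \<in> measurable borel K" for f K
    unfolding N_def by (rule measurable_pair_measure_countable1) (use that in auto)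
  have im: "snd (c i) ` V i \<in> sets borel" if "i < r" for i
    by (rule chart_image_measurable[OF cA[OF that]])
  have w: "w \<in> borel_measurable N"
  proof (rule pieces)
    fix i assume i: "i < r"
    have "local_density (c i) (\<lambda>_. 1) \<in> borel_measurable borel" by (rule local_density_measurable[OF cA(1)[OF i]]) simp
    then show "(\<lambda>x. w (i, x)) \<in> borel_measurable borel"
      unfolding w_def using im[OF i] by simp
  qed
  have T: "T \<in> measurable N borel"
    by (rule pieces) (simp add: T_def chart_inv0_measurable cA(1))
  define M where "M = distr (density N w) borel T"
  have "(\<integral>\<^sup>+y. q y \<partial>M) = (\<Sum>i<r. \<integral>\<^sup>+x. indicator (snd (c i) ` V i) x * local_density (c i) q x \<partial>lborel)"
    if q: "q \<in> borel_measurable borel" for q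
  proof -
    have qT: "(\<lambda>p. q (T p)) \<in> borel_measurable N" by (rule measurable_compose[OF T q])
    have "(\<integral>\<^sup>+y. q y \<partial>M) = (\<integral>\<^sup>+p. q (T p) \<partial>density N w)"
      unfolding M_def by (rule nn_integral_distr) (use T q in auto)
    also have "\<dots> = (\<integral>\<^sup>+p. w p * q (T p) \<partial>N)" by (rule nn_integral_density[OF w qT])
    also have "\<dots> = (\<integral>\<^sup>+i. (\<integral>\<^sup>+x. w (i, x) * q (T (i, x)) \<partial>lborel) \<partial>count_space {..<r})"
      unfolding N_def by (rule lborel.nn_integral_fst[symmetric]) (use w qT in \<open>simp add: N_def\<close>)
    also have "\<dots> = (\<Sum>i<r. \<integral>\<^sup>+x. w (i, x) * q (T (i, x)) \<partial>lborel)"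
      by (rule nn_integral_count_space_finite) simp
    also have "\<dots> = (\<Sum>i<r. \<integral>\<^sup>+x. indicator (snd (c i) ` V i) x * local_density (c i) q x \<partial>lborel)"
      by (intro sum.cong nn_integral_cong refl)
         (simp add: w_def T_def local_density_def chart_inv0_def mult_ac)
    finally show ?thesis .
  qed
  moreover have "sets M = sets borel" by (simp add: M_def)
  ultimately show ?thesis by blast
qed

text \<open>On the part \<open>E i j\<close> of \<open>V i\<close> that \<open>f\<close> maps into \<open>V j\<close> this is the change of variables formula in
  coordinates. For fixed \<open>j\<close> the images of these parts are disjoint subsets of \<open>V j\<close>.\<close>

lemma volume_change:
  assumes P: "volume_partition r c V" and f: "f \<in> Diff1 A" and q: "q \<in> borel_measurable borel"
  shows "(\<Sum>i<r. \<integral>\<^sup>+x. indicator (snd (c i) ` V i) x * local_density (c i) (\<lambda>y. q (f y) * ennreal (Jac A G f y)) x \<partial>lborel)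
     \<le> (\<Sum>i<r. \<integral>\<^sup>+x. indicator (snd (c i) ` V i) x * local_density (c i) q x \<partial>lborel)"
proof -
  let ?qJ = "\<lambda>y. q (f y) * ennreal (Jac A G f y)"
  let ?di = "\<lambda>i. local_density (c i) ?qJ" and ?dj = "\<lambda>j. local_density (c j) q"
  have cA: "c i \<in> A" "V i \<in> sets borel" "V i \<subseteq> fst (c i)" "bounded (snd (c i) ` V i)" if "i < r" for i
    using P that by (simp_all add: volume_partition_def)
  have cover: "(\<Union>i<r. V i) = UNIV" and disj: "\<And>i j. i < r \<Longrightarrow> j < r \<Longrightarrow> i \<noteq> j \<Longrightarrow> V i \<inter> V j = {}"
    using P by (simp_all add: volume_partition_def)
  note D = Diff1D[OF f]
  note df = C1_diff_map[OF D(2)]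
  have fc: "continuous_on UNIV f" "continuous_on UNIV (inv f)" using D(2,3) by (simp_all add: C1_map_def)
  have fm: "f \<in> measurable borel borel" "inv f \<in> measurable borel borel"
    using fc by (auto intro: borel_measurable_continuous_onI)
  define E where "E i j = V i \<inter> f -` V j" for i j
  have E: "E i j \<in> sets borel" if "i < r" "j < r" for i j
    unfolding E_def using cA(2)[OF that(1)] measurable_sets[OF fm(1) cA(2)[OF that(2)]] by auto
  let ?E = "\<lambda>i j. snd (c i) ` E i j" and ?F = "\<lambda>i j. snd (c j) ` f ` E i j"
  let ?L = "\<lambda>i j. local_rep (c i) (c j) f"
  have img: "?L i j ` (?E i j) = snd (c j) ` (f ` E i j)" if "i < r" for i j
  proof -
    have "?L i j (snd (c i) p) = snd (c j) (f p)" if "p \<in> E i j" for p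
      using chartD(5)[OF cA(1)[OF \<open>i < r\<close>], of p] cA(3)[OF \<open>i < r\<close>] that by (auto simp: local_rep_def E_def)
    then show ?thesis unfolding image_image by (rule image_cong[OF refl])
  qed
  have fE: "f ` E i j \<in> sets borel" "f ` E i j \<subseteq> V j" if "i < r" "j < r" for i j
  proof -
    have "f ` E i j = inv f -` E i j" using D(1) by (simp add: bij_vimage_eq_inv_image bij_imp_bij_inv inv_inv_eq)
    then show "f ` E i j \<in> sets borel" using measurable_sets[OF fm(2) E[OF that]] by simp
    show "f ` E i j \<subseteq> V j" by (auto simp: E_def)
  qed
  have term_eq: "(\<integral>\<^sup>+x. indicator (?E i j) x * ?di i x \<partial>lborel)
     = (\<integral>\<^sup>+y. indicator (?F i j) y * ?dj j y \<partial>lborel)"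
    if i: "i < r" and j: "j < r" for i j
  proof -
    let ?S = "?E i j"
    let ?L' = "\<lambda>x. frechet_derivative (?L i j) (at x)"
    have Ei: "p \<in> fst (c i)" "f p \<in> fst (c j)" if "p \<in> E i j" for p
      using that cA(3)[OF i] cA(3)[OF j] by (auto simp: E_def)
    have S: "?S \<in> sets borel"
      by (rule chart_image_measurable[OF cA(1)[OF i] E[OF i j]]) (use Ei in auto)
    have "(\<integral>\<^sup>+x. indicator ?S x * (?dj j (?L i j x) * ennreal \<bar>det (matrix (?L' x))\<bar>) \<partial>lborel)
      = (\<integral>\<^sup>+y. indicator (?L i j ` ?S) y * ?dj j y \<partial>lborel)"
    proof (rule nn_change_of_variables[OF S])
      show "(?L i j has_derivative ?L' x) (at x)" if "x \<in> ?S" for x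
      proof -
        from that obtain p where p: "p \<in> E i j" "x = snd (c i) p" by blast
        show ?thesis using local_rep_has_derivative[OF df cA(1)[OF i] cA(1)[OF j] Ei[OF p(1)]]
          unfolding p(2) local_deriv_def .
      qed
      show "inj_on (?L i j) ?S"
      proof (rule inj_onI)
        fix x y assume x: "x \<in> ?S" and y: "y \<in> ?S" and eq: "?L i j x = ?L i j y"
        from x obtain p where p: "p \<in> E i j" "x = snd (c i) p" by blast
        from y obtain p' where p': "p' \<in> E i j" "y = snd (c i) p'" by blast
        have "snd (c j) (f p) = snd (c j) (f p')"
          using eq p p' chartD(5)[OF cA(1)[OF i] Ei(1)[OF p(1)]] chartD(5)[OF cA(1)[OF i] Ei(1)[OF p'(1)]]
          by (simp add: local_rep_def)
        then have "f p = f p'"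
          using chartD(5)[OF cA(1)[OF j] Ei(2)[OF p(1)]] chartD(5)[OF cA(1)[OF j] Ei(2)[OF p'(1)]] by metis
        then have "p = p'" using D(1) by (meson bij_is_inj injD)
        then show "x = y" using p p' by simp
      qed
      show "?L i j ` ?S \<in> sets borel" unfolding img[OF i]
        by (rule chart_image_measurable[OF cA(1)[OF j] fE(1)[OF i j]]) (use fE(2)[OF i j] cA(3)[OF j] in blast)
      show "bounded (?L i j ` ?S)" unfolding img[OF i]
        by (rule bounded_subset[OF cA(4)[OF j]]) (rule image_mono[OF fE(2)[OF i j]])
      show "?dj j \<in> borel_measurable borel" by (rule local_density_measurable[OF cA(1)[OF j] q])
      let ?O = "snd (c i) ` (fst (c i) \<inter> f -` fst (c j))"
      have O: "open ?O"
      proof -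
        have "?O = {x \<in> snd (c i) ` fst (c i). f (chart_inv (c i) x) \<in> fst (c j)}"
          using chartD(5)[OF cA(1)[OF i]] by auto
        then show ?thesis using open_local_domain[OF fc(1) cA(1)[OF i] cA(1)[OF j]] by simp
      qed
      have "(\<lambda>x. if x \<in> ?O then det (matrix (?L' x)) else 0) \<in> borel_measurable borel"
        by (rule borel_measurable_continuous_on_if) (use O continuous_on_local_det[OF D(2) cA(1)[OF i] cA(1)[OF j]] in auto)
      then have "(\<lambda>x. indicator ?S x * ennreal \<bar>if x \<in> ?O then det (matrix (?L' x)) else 0\<bar>) \<in> borel_measurable borel"
        using S by measurable
      moreover have "indicator ?S x * ennreal \<bar>if x \<in> ?O then det (matrix (?L' x)) else 0\<bar> = indicator ?S x * ennreal \<bar>det (matrix (?L' x))\<bar>" for x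
      proof (cases "x \<in> ?S")
        case True
        then have "x \<in> ?O" using Ei by auto
        then show ?thesis by simp
      qed simp
      ultimately show "(\<lambda>x. indicator ?S x * ennreal \<bar>det (matrix (?L' x))\<bar>) \<in> borel_measurable borel" by simp
    qed
    moreover have "indicator ?S x * (?dj j (?L i j x) * ennreal \<bar>det (matrix (?L' x))\<bar>)
      = indicator ?S x * ?di i x" for x
    proof (cases "x \<in> ?S")
      case True
      then obtain p where p: "p \<in> E i j" "x = snd (c i) p" by blast
      note e = Ei[OF p(1)]
      have inv: "chart_inv (c i) x = p" using chartD(5)[OF cA(1)[OF i] e(1)] p(2) by simp
      have L: "?L i j x = snd (c j) (f p)" using inv by (simp add: local_rep_def)
      have "?dj j (?L i j x) = q (f p) * ennreal (vol (c j) (f p))"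
        unfolding L local_density_def using e(2) chartD(5)[OF cA(1)[OF j] e(2)] by simp
      moreover have "?di i x = q (f p) * ennreal (Jac A G f p) * ennreal (vol (c i) p)"
        unfolding local_density_def using e(1) inv p(2) by simp
      moreover have "ennreal (Jac A G f p) * ennreal (vol (c i) p) = ennreal (vol (c j) (f p)) * ennreal \<bar>det (matrix (?L' x))\<bar>"
      proof -
        have vp: "vol (c i) p > 0" "vol (c j) (f p) > 0" using vol_pos cA(1) i j e by auto
        have "Jac A G f p = vol (c j) (f p) / vol (c i) p * \<bar>det (matrix (?L' x))\<bar>"
          using Jac_chart[OF df cA(1)[OF i] cA(1)[OF j] e] unfolding local_deriv_def p(2) .
        then have "Jac A G f p * vol (c i) p = vol (c j) (f p) * \<bar>det (matrix (?L' x))\<bar>"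
          using vp by simp
        then show ?thesis using vp Jac_nonneg[OF df, of p] by (simp add: ennreal_mult[symmetric])
      qed
      ultimately show ?thesis by (simp add: mult.assoc)
    qed simp
    ultimately show ?thesis by (simp add: img[OF i])
  qed
  have lm: "local_density (c i) q' \<in> borel_measurable lborel" if "i < r" "q' \<in> borel_measurable borel" for i q'
    using local_density_measurable[OF cA(1)[OF that(1)] that(2)] by simp
  have Jm: "?qJ \<in> borel_measurable borel"
    using measurable_compose[OF fm(1) q] borel_measurable_continuous_onI[OF continuous_Jac[OF D(2)]] by measurable
  have Sm: "?E i j \<in> sets borel" if "i < r" "j < r" for i j
    by (rule chart_image_measurable[OF cA(1)[OF that(1)] E[OF that]]) (use cA(3)[OF that(1)] in \<open>auto simp: E_def\<close>)
  have fSm: "?F i j \<in> sets borel" if "i < r" "j < r" for i j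
    by (rule chart_image_measurable[OF cA(1)[OF that(2)] fE(1)[OF that]]) (use fE(2)[OF that] cA(3)[OF that(2)] in blast)
  have inj: "x = y" if "i < r" "x \<in> V i" "y \<in> V i" "snd (c i) x = snd (c i) y" for i x y
    using chartD(5)[OF cA(1)[OF that(1)], of x] chartD(5)[OF cA(1)[OF that(1)], of y] that cA(3)[OF that(1)] by (metis subsetD)
  have "(\<Sum>i<r. \<integral>\<^sup>+x. indicator (snd (c i) ` V i) x * ?di i x \<partial>lborel)
    = (\<Sum>i<r. \<Sum>j<r. \<integral>\<^sup>+x. indicator (?E i j) x * ?di i x \<partial>lborel)"
  proof (rule sum.cong[OF refl])
    fix i assume "i \<in> {..<r}"
    then have i: "i < r" by simp
    have ind: "indicator (snd (c i) ` V i) x = (\<Sum>j<r. indicator (?E i j) x :: ennreal)" for x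
    proof (rule indicator_UN_disjoint[of "{..<r}" "\<lambda>j. ?E i j" x, THEN trans[rotated]])
      show "disjoint_family_on (\<lambda>j. ?E i j) {..<r}"
        unfolding disjoint_family_on_def
      proof (intro ballI impI)
        fix j k assume jk: "j \<in> {..<r}" "k \<in> {..<r}" "j \<noteq> k"
        show "?E i j \<inter> snd (c i) ` E i k = {}"
        proof (rule ccontr)
          assume "\<not> ?thesis"
          then obtain x y where xy: "x \<in> E i j" "y \<in> E i k" "snd (c i) x = snd (c i) y" by blast
          then have "x = y" using inj[OF i, of x y] by (simp add: E_def)
          then show False using xy disj[of j k] jk by (auto simp: E_def)
        qed
      qed
      have "x \<in> (\<Union>j<r. E i j)" if "x \<in> V i" for x
      proof -
        have "f x \<in> (\<Union>j<r. V j)" unfolding cover by simp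
        then show ?thesis using that by (auto simp: E_def)
      qed
      then have "V i \<subseteq> (\<Union>j<r. E i j)" by blast
      moreover have "(\<Union>j<r. E i j) \<subseteq> V i" by (auto simp: E_def)
      ultimately have "V i = (\<Union>j<r. E i j)" by (rule equalityI)
      then show "indicator (snd (c i) ` V i) x = (indicator (\<Union>j<r. ?E i j) x :: ennreal)"
        by (simp add: image_UN)
    qed simp
    have "(\<integral>\<^sup>+x. indicator (snd (c i) ` V i) x * ?di i x \<partial>lborel)
      = (\<integral>\<^sup>+x. (\<Sum>j<r. indicator (?E i j) x * ?di i x) \<partial>lborel)"
      by (simp only: ind sum_distrib_right)
    also have "\<dots> = (\<Sum>j<r. \<integral>\<^sup>+x. indicator (?E i j) x * ?di i x \<partial>lborel)"
      using Sm[OF i] lm[OF i Jm] by (intro nn_integral_sum) auto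
    finally show "(\<integral>\<^sup>+x. indicator (snd (c i) ` V i) x * ?di i x \<partial>lborel)
      = (\<Sum>j<r. \<integral>\<^sup>+x. indicator (?E i j) x * ?di i x \<partial>lborel)" .
  qed
  also have "\<dots> = (\<Sum>i<r. \<Sum>j<r. \<integral>\<^sup>+y. indicator (?F i j) y * ?dj j y \<partial>lborel)"
    by (intro sum.cong refl term_eq) auto
  also have "\<dots> = (\<Sum>j<r. \<Sum>i<r. \<integral>\<^sup>+y. indicator (?F i j) y * ?dj j y \<partial>lborel)"
    by (rule sum.swap)
  also have "\<dots> \<le> (\<Sum>j<r. \<integral>\<^sup>+y. indicator (snd (c j) ` V j) y * ?dj j y \<partial>lborel)"
  proof (rule sum_mono)
    fix j assume "j \<in> {..<r}"
    then have j: "j < r" by simp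
    have ind: "(\<Sum>i<r. indicator (?F i j) y) \<le> (indicator (snd (c j) ` V j) y :: ennreal)" for y
    proof -
      have "(\<Sum>i<r. indicator (?F i j) y) = (indicator (\<Union>i<r. ?F i j) y :: ennreal)"
      proof (rule indicator_UN_disjoint[symmetric])
        show "disjoint_family_on (\<lambda>i. ?F i j) {..<r}"
          unfolding disjoint_family_on_def
        proof (intro ballI impI)
          fix i k assume ik: "i \<in> {..<r}" "k \<in> {..<r}" "i \<noteq> k"
          show "?F i j \<inter> snd (c j) ` f ` E k j = {}"
          proof (rule ccontr)
            assume "\<not> ?thesis"
            then obtain x y where xy: "x \<in> E i j" "y \<in> E k j" "snd (c j) (f x) = snd (c j) (f y)" by blast
            then have "f x = f y" using inj[OF j, of "f x" "f y"] by (simp add: E_def)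
            then have "x = y" using D(1) by (meson bij_is_inj injD)
            then show False using xy disj[of i k] ik by (auto simp: E_def)
          qed
        qed
      qed simp
      also have "\<dots> \<le> indicator (snd (c j) ` V j) y"
      proof -
        have "(\<Union>i<r. ?F i j) \<subseteq> snd (c j) ` V j"
          using fE(2) j by (auto simp: E_def)
        then have "y \<in> (\<Union>i<r. ?F i j) \<Longrightarrow> y \<in> snd (c j) ` V j" by (rule subsetD)
        then show ?thesis unfolding indicator_def by (simp only: if_True if_False of_bool_def split: if_split) simp
      qed
      finally show ?thesis .
    qed
    have "(\<Sum>i<r. \<integral>\<^sup>+y. indicator (?F i j) y * ?dj j y \<partial>lborel)
       = (\<integral>\<^sup>+y. (\<Sum>i<r. indicator (?F i j) y * ?dj j y) \<partial>lborel)"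
      using fSm[OF _ j] lm[OF j q] by (intro nn_integral_sum[symmetric]) auto
    also have "\<dots> \<le> (\<integral>\<^sup>+y. indicator (snd (c j) ` V j) y * ?dj j y \<partial>lborel)"
      unfolding sum_distrib_right[symmetric] using ind by (intro nn_integral_mono mult_right_mono) auto
    finally show "(\<Sum>i<r. \<integral>\<^sup>+y. indicator (?F i j) y * ?dj j y \<partial>lborel)
      \<le> (\<integral>\<^sup>+y. indicator (snd (c j) ` V j) y * ?dj j y \<partial>lborel)" .
  qed
  finally show ?thesis .
qed

lemma normalized_volume_exists:
  "\<exists>m :: 'm measure. prob_space m \<and> sets m = sets borel \<and>
    (\<forall>f\<in>Diff1 A. \<forall>q\<in>borel_measurable borel. (\<integral>\<^sup>+y. q (f y) * ennreal (Jac A G f y) \<partial>m) \<le> (\<integral>\<^sup>+y. q y \<partial>m))"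
proof -
  from volume_partition_exists obtain r c V where P: "volume_partition r c V" by (elim exE)
  have cA: "c i \<in> A" "V i \<in> sets borel" "V i \<subseteq> fst (c i)" "bounded (snd (c i) ` V i)" "\<exists>B. \<forall>p\<in>V i. vol (c i) p \<le> B" if "i < r" for i
    using P that by (simp_all add: volume_partition_def)
  have r0: "0 < r" "open (V 0)" "V 0 \<noteq> {}" using P by (simp_all add: volume_partition_def)
  from volume_measure_exists[OF P] obtain M where M: "sets M = sets (borel :: 'm measure)"
    and int: "\<forall>q\<in>borel_measurable borel.
    (\<integral>\<^sup>+y. q y \<partial>M) = (\<Sum>i<r. \<integral>\<^sup>+x. indicator (snd (c i) ` V i) x * local_density (c i) q x \<partial>lborel)"
    by (elim exE conjE)
  have spM: "space M = UNIV" using sets_eq_imp_space_eq[OF M] by simp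
  define t where "t = emeasure M (space M)"
  have "t = (\<integral>\<^sup>+y. 1 \<partial>M)" by (simp add: t_def)
  also have "\<dots> = (\<Sum>i<r. \<integral>\<^sup>+x. indicator (snd (c i) ` V i) x * local_density (c i) (\<lambda>_. 1) x \<partial>lborel)"
    using int by (rule bspec) simp
  finally have t: "t = (\<Sum>i<r. \<integral>\<^sup>+x. indicator (snd (c i) ` V i) x * local_density (c i) (\<lambda>_. 1) x \<partial>lborel)" .
  have im: "snd (c i) ` V i \<in> sets borel" if "i < r" for i
    by (rule chart_image_measurable[OF cA(1-3)[OF that]])
  have ld: "local_density (c i) (\<lambda>_. 1) (snd (c i) p) = ennreal (vol (c i) p)" if "i < r" "p \<in> V i" for i p
  proof -
    have "p \<in> fst (c i)" using cA(3)[OF that(1)] that(2) by blast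
    then show ?thesis using chartD(5)[OF cA(1)[OF that(1)]] by (simp add: local_density_def)
  qed
  have fin: "(\<integral>\<^sup>+x. indicator (snd (c i) ` V i) x * local_density (c i) (\<lambda>_. 1) x \<partial>lborel) < \<infinity>" if i: "i < r" for i
  proof -
    from cA(5)[OF i] obtain B where B: "\<forall>p\<in>V i. vol (c i) p \<le> B" by (elim exE)
    have "(\<integral>\<^sup>+x. indicator (snd (c i) ` V i) x * local_density (c i) (\<lambda>_. 1) x \<partial>lborel)
      \<le> (\<integral>\<^sup>+x. ennreal B * indicator (snd (c i) ` V i) x \<partial>lborel)"
    proof (rule nn_integral_mono)
      fix x
      show "indicator (snd (c i) ` V i) x * local_density (c i) (\<lambda>_. 1) x \<le> ennreal B * indicator (snd (c i) ` V i) x"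
      proof (cases "x \<in> snd (c i) ` V i")
        case True
        then obtain p where p: "p \<in> V i" "x = snd (c i) p" by blast
        then show ?thesis using ld[OF i p(1)] B by (simp add: ennreal_leI)
      qed simp
    qed
    also have "\<dots> = ennreal B * emeasure lborel (snd (c i) ` V i)"
      using im[OF i] by (intro nn_integral_cmult_indicator) simp
    also have "\<dots> < \<infinity>" using emeasure_bounded_finite[OF cA(4)[OF i]] by (simp add: ennreal_mult_less_top)
    finally show ?thesis .
  qed
  have tfin: "t < \<infinity>" unfolding t using fin by (simp add: less_top[symmetric])
  have tpos: "t \<noteq> 0"
  proof
    assume "t = 0"
    then have z: "(\<integral>\<^sup>+x. indicator (snd (c 0) ` V 0) x * local_density (c 0) (\<lambda>_. 1) x \<partial>lborel) = 0"
      unfolding t using r0(1) by simp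
    have lm: "local_density (c 0) (\<lambda>_. 1) \<in> borel_measurable borel"
      by (rule local_density_measurable[OF cA(1)[OF r0(1)]]) simp
    have "AE x in lborel. indicator (snd (c 0) ` V 0) x * local_density (c 0) (\<lambda>_. 1) x = 0"
      using z im[OF r0(1)] lm by (subst (asm) nn_integral_0_iff_AE) auto
    then have "AE x in lborel. x \<notin> snd (c 0) ` V 0"
    proof eventually_elim
      case (elim x)
      show ?case
      proof
        assume x: "x \<in> snd (c 0) ` V 0"
        then obtain p where p: "p \<in> V 0" "x = snd (c 0) p" by blast
        then have "vol (c 0) p > 0" using vol_pos[OF cA(1)[OF r0(1)]] cA(3)[OF r0(1)] by blast
        then show False using elim x ld[OF r0(1) p(1)] p(2) by simp
      qed
    qed
    then have "emeasure lborel (snd (c 0) ` V 0) = 0"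
      using im[OF r0(1)] by (subst (asm) AE_iff_measurable[OF _ refl]) auto
    then have null: "snd (c 0) ` V 0 \<in> null_sets lborel" using im[OF r0(1)] by (simp add: null_sets_def)
    have "snd (c 0) ` V 0 = snd (c 0) ` fst (c 0) \<inter> chart_inv (c 0) -` V 0"
    proof (rule set_eqI)
      fix x
      show "x \<in> snd (c 0) ` V 0 \<longleftrightarrow> x \<in> snd (c 0) ` fst (c 0) \<inter> chart_inv (c 0) -` V 0"
        using cA(3)[OF r0(1)] chartD(5,7)[OF cA(1)[OF r0(1)]] by (auto simp: image_iff subset_iff; metis)
    qed
    then have "open (snd (c 0) ` V 0)"
      using continuous_open_preimage[OF chartD(4,2)[OF cA(1)[OF r0(1)]] r0(2)] by simp
    then have "\<not> negligible (snd (c 0) ` V 0)" using open_not_negligible r0(3) by blast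
    moreover have "negligible (snd (c 0) ` V 0)"
      using null null_sets_completionI negligible_iff_null_sets by blast
    ultimately show False by simp
  qed
  define m where "m = scale_measure (inverse t) M"
  have "emeasure m (space m) = inverse t * t" by (simp add: m_def t_def space_scale_measure)
  also have "\<dots> = 1" using tfin tpos by (subst mult.commute) (simp add: ennreal_divide_self divide_ennreal_def[symmetric])
  finally have "prob_space m" by (rule prob_spaceI)
  moreover have "sets m = sets borel" by (simp add: m_def M)
  moreover have "(\<integral>\<^sup>+y. q (f y) * ennreal (Jac A G f y) \<partial>m) \<le> (\<integral>\<^sup>+y. q y \<partial>m)"
    if f: "f \<in> Diff1 A" and q: "q \<in> borel_measurable borel" for f q
  proof -
    note D = Diff1D[OF f]
    have "f \<in> measurable borel borel" using D(2) by (auto simp: C1_map_def intro: borel_measurable_continuous_onI)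
    then have Jm: "(\<lambda>y. q (f y) * ennreal (Jac A G f y)) \<in> borel_measurable borel"
      using measurable_compose[OF _ q] borel_measurable_continuous_onI[OF continuous_Jac[OF D(2)]] by measurable
    have "(\<integral>\<^sup>+y. q (f y) * ennreal (Jac A G f y) \<partial>M) \<le> (\<integral>\<^sup>+y. q y \<partial>M)"
      using int[rule_format, OF Jm] int[rule_format, OF q] volume_change[OF P f q] by simp
    moreover have "q \<in> borel_measurable M" "(\<lambda>y. q (f y) * ennreal (Jac A G f y)) \<in> borel_measurable M"
      using q Jm by (simp_all cong: measurable_cong_sets add: M)
    ultimately show ?thesis
      unfolding m_def by (simp add: nn_integral_scale_measure mult_left_mono)
  qed
  ultimately show ?thesis by blast
qed

end

section \<open>The group of diffeomorphisms\<close>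

lemma norm_matrix_le:
  fixes M :: "real^'k::finite^'k"
  assumes "\<And>i j. \<bar>M $ i $ j\<bar> \<le> e"
  shows "norm M \<le> real CARD('k) * (real CARD('k) * e)"
proof -
  have "norm (M $ i) \<le> real CARD('k) * e" for i
  proof -
    have "norm (M $ i) \<le> (\<Sum>j\<in>UNIV. \<bar>M $ i $ j\<bar>)" by (rule norm_le_l1_cart)
    also have "\<dots> \<le> (\<Sum>j\<in>(UNIV::'k set). e)" by (intro sum_mono assms)
    finally show ?thesis by simp
  qed
  then have "(\<Sum>i\<in>UNIV. norm (M $ i)) \<le> (\<Sum>i\<in>(UNIV::'k set). real CARD('k) * e)" by (intro sum_mono)
  moreover have "norm M \<le> (\<Sum>i\<in>UNIV. norm (M $ i))" unfolding norm_vec_def by (rule L2_set_le_sum) simp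
  ultimately show ?thesis by simp
qed

context closed_riemannian
begin

lemma topspace_Diff1: "topspace (Diff1_topology A) = Diff1 A"
proof -
  have "f \<in> topspace (C1_topology A)" if f: "f \<in> Diff1 A" for f
  proof -
    obtain c where c: "c \<in> A" using chart_exists by blast
    have "f \<in> C1_nbhd A f c c {} 1" using Diff1D(2)[OF f] by (simp add: C1_nbhd_def)
    moreover have "C1_nbhd A f c c {} 1 \<in> {C1_nbhd A f c d C e | f c d C e. C1_map A f \<and> c \<in> A \<and> d \<in> A \<and> compact C \<and>
        C \<subseteq> fst c \<and> f ` C \<subseteq> fst d \<and> e > 0}"
      using Diff1D(2)[OF f] c by (intro CollectI exI conjI refl) auto
    ultimately show ?thesis unfolding C1_topology_def topology_generated_by_topspace by (rule UnionI[rotated])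
  qed
  then show ?thesis by (auto simp: Diff1_topology_def)
qed

lemma openin_C1_nbhd:
  assumes "C1_map A f" "c \<in> A" "d \<in> A" "compact C" "C \<subseteq> fst c" "f ` C \<subseteq> fst d" "e > 0"
  shows "openin (Diff1_topology A) (C1_nbhd A f c d C e \<inter> Diff1 A)"
proof -
  have "openin (C1_topology A) (C1_nbhd A f c d C e)"
    unfolding C1_topology_def openin_topology_generated_by_iff
    by (rule generate_topology_on.Basis, rule CollectI, rule exI[of _ f], rule exI[of _ c], rule exI[of _ d],
        rule exI[of _ C], rule exI[of _ e]) (use assms in simp)
  then show ?thesis unfolding Diff1_topology_def openin_subtopology by blast
qed

lemma mem_C1_nbhd:
  assumes "C1_map A f" "f ` C \<subseteq> fst d" "e > 0"
  shows "f \<in> C1_nbhd A f c d C e"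
proof -
  have "onorm (\<lambda>v. local_deriv c d f p v - local_deriv c d f p v) = 0" for p
    by (simp add: onorm_zero)
  then show ?thesis using assms by (simp add: C1_nbhd_def)
qed

text \<open>Near \<open>p\<close>, closeness of values is closeness in one chart around \<open>f p\<close>, which \<open>C1_nbhd\<close> controls
  on a compact neighbourhood of \<open>p\<close>.\<close>

lemma local_uniform_evaluation:
  fixes \<phi> :: "'m \<Rightarrow> real"
  assumes f: "f \<in> Diff1 A" and \<phi>: "continuous_on UNIV \<phi>" and e: "e > 0"
  shows "\<exists>W N. openin (Diff1_topology A) W \<and> f \<in> W \<and> open N \<and> p \<in> N \<and> (\<forall>g\<in>W. \<forall>x\<in>N. \<bar>\<phi> (g x) - \<phi> (f x)\<bar> \<le> e)"
proof -
  let ?c = "chart_at A p" and ?d = "chart_at A (f p)"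
  note c = chart_at[of p] and d = chart_at[of "f p"]
  note C1 = Diff1D(2)[OF f]
  have fc: "continuous_on UNIV f" using C1 by (simp add: C1_map_def)
  define y0 where "y0 = snd ?d (f p)"
  have y0: "y0 \<in> snd ?d ` fst ?d" using d(2) by (simp add: y0_def)
  have \<psi>: "continuous_on (snd ?d ` fst ?d) (\<lambda>y. \<phi> (chart_inv ?d y))"
    by (rule continuous_on_compose2[OF \<phi> chartD(4)[OF d(1)]]) simp
  have "isCont (\<lambda>y. \<phi> (chart_inv ?d y)) y0"
    using continuous_on_eq_continuous_at[OF chartD(2)[OF d(1)]] \<psi> y0 by blast
  then obtain s where s: "s > 0" "\<forall>y. dist y y0 < s \<longrightarrow> dist (\<phi> (chart_inv ?d y)) (\<phi> (chart_inv ?d y0)) < e / 2"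
    unfolding continuous_at_eps_delta using e by (metis half_gt_zero)
  define \<delta> where "\<delta> = s / 2"
  have \<delta>: "\<delta> > 0" using s(1) by (simp add: \<delta>_def)
  have near: "\<bar>\<phi> q - \<phi> (f p)\<bar> \<le> e / 2" if "q \<in> fst ?d" "norm (snd ?d q - y0) < 2 * \<delta>" for q
  proof -
    have "dist (snd ?d q) y0 < s" using that(2) by (simp add: \<delta>_def dist_norm)
    then have "dist (\<phi> (chart_inv ?d (snd ?d q))) (\<phi> (chart_inv ?d y0)) < e / 2" using s(2) by blast
    then show ?thesis
      unfolding y0_def chartD(5)[OF d(1) that(1)] chartD(5)[OF d(1) d(2)] by (simp add: dist_real_def)
  qed
  let ?O1 = "{x \<in> snd ?c ` fst ?c. f (chart_inv ?c x) \<in> fst ?d}"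
  have O1: "open ?O1" by (rule open_local_domain[OF fc c(1) d(1)])
  have "continuous_on ?O1 (\<lambda>x. f (chart_inv ?c x))"
    by (rule continuous_on_compose2[OF fc continuous_on_subset[OF chartD(4)[OF c(1)]]]) auto
  then have "continuous_on ?O1 (\<lambda>x. snd ?d (f (chart_inv ?c x)))"
    by (rule continuous_on_compose2[OF chartD(3)[OF d(1)]]) auto
  from continuous_open_preimage[OF this O1 open_ball[of y0 \<delta>]]
  have O2: "open (?O1 \<inter> (\<lambda>x. snd ?d (f (chart_inv ?c x))) -` ball y0 \<delta>)" .
  let ?O2 = "?O1 \<inter> (\<lambda>x. snd ?d (f (chart_inv ?c x))) -` ball y0 \<delta>"
  have "snd ?c p \<in> ?O2"
    using c(2) d(2) chartD(5)[OF c(1) c(2)] \<delta> by (simp add: y0_def)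
  from bspec[OF open_contains_cball[THEN iffD1, OF O2] this]
  obtain \<rho> where \<rho>: "\<rho> > 0" "cball (snd ?c p) \<rho> \<subseteq> ?O2" by auto
  have sub: "cball (snd ?c p) \<rho> \<subseteq> snd ?c ` fst ?c" using \<rho>(2) by blast
  define C where "C = chart_inv ?c ` cball (snd ?c p) \<rho>"
  have C: "compact C" unfolding C_def
    by (rule compact_continuous_image[OF continuous_on_subset[OF chartD(4)[OF c(1)] sub] compact_cball])
  have Cc: "C \<subseteq> fst ?c" unfolding C_def using sub chartD(6)[OF c(1)] by blast
  have Cf: "f ` C \<subseteq> fst ?d" unfolding C_def using \<rho>(2) by blast
  have Cb: "norm (snd ?d (f x) - y0) < \<delta>" if "x \<in> C" for x
  proof -
    from that obtain z where z: "z \<in> cball (snd ?c p) \<rho>" "x = chart_inv ?c z" unfolding C_def by blast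
    then have "snd ?d (f x) \<in> ball y0 \<delta>" using \<rho>(2) by blast
    then show ?thesis by (simp add: dist_norm norm_minus_commute)
  qed
  define N where "N = fst ?c \<inter> snd ?c -` ball (snd ?c p) \<rho>"
  have N: "open N" "p \<in> N"
    unfolding N_def using continuous_open_preimage[OF chartD(3)[OF c(1)] chartD(1)[OF c(1)] open_ball] c(2) \<rho>(1) by auto
  have NC: "x \<in> C" if "x \<in> N" for x
  proof -
    have "snd ?c x \<in> cball (snd ?c p) \<rho>" "x \<in> fst ?c" using that by (auto simp: N_def)
    then show ?thesis unfolding C_def using chartD(5)[OF c(1), of x] by (metis image_eqI)
  qed
  define W where "W = C1_nbhd A f ?c ?d C \<delta> \<inter> Diff1 A"
  have W: "openin (Diff1_topology A) W" "f \<in> W"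
    unfolding W_def using openin_C1_nbhd[OF C1 c(1) d(1) C Cc Cf \<delta>] mem_C1_nbhd[OF C1 Cf \<delta>] f by auto
  have "\<bar>\<phi> (g x) - \<phi> (f x)\<bar> \<le> e" if g: "g \<in> W" and x: "x \<in> N" for g x
  proof -
    have xC: "x \<in> C" by (rule NC[OF x])
    have gd: "g x \<in> fst ?d" "norm (snd ?d (g x) - snd ?d (f x)) < \<delta>"
      using g xC by (auto simp: W_def C1_nbhd_def)
    have fd: "f x \<in> fst ?d" using Cf xC by blast
    have "norm (snd ?d (g x) - y0) \<le> norm (snd ?d (g x) - snd ?d (f x)) + norm (snd ?d (f x) - y0)"
      by (rule order_trans[OF _ norm_triangle_ineq]) simp
    then have "norm (snd ?d (g x) - y0) < 2 * \<delta>" using gd(2) Cb[OF xC] by linarith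
    from near[OF gd(1) this] have 1: "\<bar>\<phi> (g x) - \<phi> (f p)\<bar> \<le> e / 2" .
    have "norm (snd ?d (f x) - y0) < 2 * \<delta>" using Cb[OF xC] \<delta> by linarith
    from near[OF fd this] have 2: "\<bar>\<phi> (f x) - \<phi> (f p)\<bar> \<le> e / 2" .
    have "\<bar>\<phi> (g x) - \<phi> (f x)\<bar> \<le> \<bar>\<phi> (g x) - \<phi> (f p)\<bar> + \<bar>\<phi> (f x) - \<phi> (f p)\<bar>" by linarith
    then show ?thesis using 1 2 by linarith
  qed
  then show ?thesis using W N by blast
qed

lemma uniform_evaluation_Diff1: "uniform_evaluation (Diff1_topology A)"
  unfolding uniform_evaluation_def topspace_Diff1
proof (intro conjI ballI allI impI)
  show "continuous_on UNIV f" if "f \<in> Diff1 A" for f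
    using Diff1D(2)[OF that] by (simp add: C1_map_def)
  fix f and \<phi> :: "'m \<Rightarrow> real" and e :: real
  assume f: "f \<in> Diff1 A" and e: "e > 0" and \<phi>: "continuous_on UNIV \<phi>"
  have "\<forall>p. \<exists>WN. openin (Diff1_topology A) (fst WN) \<and> f \<in> fst WN \<and> open (snd WN) \<and> p \<in> snd WN \<and>
      (\<forall>g\<in>fst WN. \<forall>x\<in>snd WN. \<bar>\<phi> (g x) - \<phi> (f x)\<bar> \<le> e)"
  proof
    fix p
    from local_uniform_evaluation[OF f \<phi> e, of p]
    obtain W N where "openin (Diff1_topology A) W \<and> f \<in> W \<and> open N \<and> p \<in> N \<and> (\<forall>g\<in>W. \<forall>x\<in>N. \<bar>\<phi> (g x) - \<phi> (f x)\<bar> \<le> e)"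
      by (elim exE)
    then show "\<exists>WN. openin (Diff1_topology A) (fst WN) \<and> f \<in> fst WN \<and> open (snd WN) \<and> p \<in> snd WN \<and>
      (\<forall>g\<in>fst WN. \<forall>x\<in>snd WN. \<bar>\<phi> (g x) - \<phi> (f x)\<bar> \<le> e)"
      by (intro exI[of _ "(W, N)"]) simp
  qed
  from choice[OF this] obtain K where K: "\<forall>p. openin (Diff1_topology A) (fst (K p)) \<and> f \<in> fst (K p) \<and> open (snd (K p)) \<and> p \<in> snd (K p) \<and>
      (\<forall>g\<in>fst (K p). \<forall>x\<in>snd (K p). \<bar>\<phi> (g x) - \<phi> (f x)\<bar> \<le> e)" by (elim exE)
  have "open (snd (K p))" "p \<in> snd (K p)" for p using K by simp_all
  then have cov: "\<And>p. p \<in> UNIV \<Longrightarrow> open (snd (K p))" "UNIV \<subseteq> (\<Union>p\<in>UNIV. snd (K p))" by blast+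
  obtain F where F: "finite F" "UNIV \<subseteq> (\<Union>p\<in>F. snd (K p))"
    by (rule compactE_image[OF compact_manifold cov])
  have "F \<noteq> {}" using F(2) by auto
  define W where "W = (\<Inter>p\<in>F. fst (K p))"
  have "openin (Diff1_topology A) W"
    unfolding W_def using K by (intro openin_INT2 F(1) \<open>F \<noteq> {}\<close>) simp
  moreover have "f \<in> W" using K by (simp add: W_def)
  moreover have "\<bar>\<phi> (g x) - \<phi> (f x)\<bar> \<le> e" if "g \<in> W" for g x
  proof -
    have "x \<in> (\<Union>p\<in>F. snd (K p))" using F(2) by blast
    then obtain p where p: "p \<in> F" "x \<in> snd (K p)" by (elim UN_E)
    moreover have "g \<in> fst (K p)" using that p(1) by (simp add: W_def)
    ultimately show ?thesis using K by simp
  qed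
  ultimately show "\<exists>W. openin (Diff1_topology A) W \<and> f \<in> W \<and> (\<forall>g\<in>W. \<forall>x. \<bar>\<phi> (g x) - \<phi> (f x)\<bar> \<le> e)" by blast
qed

text \<open>In charts around \<open>y\<close> and \<open>f y\<close> the Jacobian at \<open>y\<close> is a continuous function \<open>H\<close> of the
  coordinates of \<open>f y\<close> and of the matrix of the derivative. Both are controlled by \<open>C1_nbhd\<close> for the
  compact set \<open>{y}\<close>.\<close>

lemma continuous_map_Jac: "continuous_map (Diff1_topology A) euclideanreal (\<lambda>f. Jac A G f y)"
proof -
  have "openin (Diff1_topology A) {f \<in> Diff1 A. Jac A G f y \<in> U}" if U: "open U" for U
  proof (subst openin_subopen, rule ballI)
    fix f assume "f \<in> {f \<in> Diff1 A. Jac A G f y \<in> U}"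
    then have f: "f \<in> Diff1 A" and fU: "Jac A G f y \<in> U" by auto
    let ?c = "chart_at A y" and ?d = "chart_at A (f y)"
    note c = chart_at[of y] and d = chart_at[of "f y"]
    note C1 = Diff1D(2)[OF f]
    define H where "H p = vol ?d (chart_inv ?d (fst p)) / vol ?c y * \<bar>det (snd p)\<bar>" for p :: "(real^'n) \<times> (real^'n^'n)"
    have JH: "Jac A G g y = H (snd ?d (g y), matrix (local_deriv ?c ?d g y))" if "g \<in> Diff1 A" "g y \<in> fst ?d" for g
      using Jac_chart[OF C1_diff_map[OF Diff1D(2)[OF that(1)]] c(1) d(1) c(2) that(2)] chartD(5)[OF d(1) that(2)]
      by (simp add: H_def)
    have Sopen: "open ((snd ?d ` fst ?d) \<times> (UNIV :: (real^'n^'n) set))"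
      using chartD(2)[OF d(1)] by (intro open_Times) auto
    have cH: "continuous_on ((snd ?d ` fst ?d) \<times> UNIV) H"
    proof -
      have cv: "continuous_on (snd ?d ` fst ?d) (\<lambda>x. vol ?d (chart_inv ?d x))"
        by (rule continuous_on_compose2[OF continuous_on_vol[OF d(1)] chartD(4)[OF d(1)]]) (use chartD(6)[OF d(1)] in auto)
      have "continuous_on ((snd ?d ` fst ?d) \<times> (UNIV :: (real^'n^'n) set)) (\<lambda>p. vol ?d (chart_inv ?d (fst p)))"
        by (rule continuous_on_compose2[OF cv continuous_on_fst[OF continuous_on_id]]) auto
      moreover have "continuous_on ((snd ?d ` fst ?d) \<times> (UNIV :: (real^'n^'n) set)) (\<lambda>p. det (snd p))"
        by (intro continuous_on_det continuous_intros)
      moreover have "vol ?c y \<noteq> 0" using vol_pos[OF c] by simp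
      ultimately show ?thesis unfolding H_def[abs_def]
        by (intro continuous_on_mult continuous_on_divide continuous_on_const continuous_on_rabs) auto
    qed
    define z0 where "z0 = (snd ?d (f y), matrix (local_deriv ?c ?d f y))"
    have z0: "z0 \<in> (snd ?d ` fst ?d) \<times> UNIV" using d(2) by (simp add: z0_def)
    have "isCont H z0" using continuous_on_eq_continuous_at[OF Sopen] cH z0 by blast
    moreover have "H z0 \<in> U" using JH[OF f d(2)] fU by (simp add: z0_def)
    ultimately have "\<forall>\<^sub>F z in at z0. H z \<in> U" using U topological_tendstoD unfolding isCont_def by blast
    then obtain \<delta> where \<delta>: "\<delta> > 0" "\<forall>z. z \<noteq> z0 \<and> dist z z0 < \<delta> \<longrightarrow> H z \<in> U"
      unfolding eventually_at by auto
    define k where "k = 1 + real CARD('n) * real CARD('n)"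
    define e where "e = \<delta> / (2 * k)"
    have k: "k > 0" by (simp add: k_def add_pos_nonneg)
    have e: "e > 0" using \<delta>(1) k by (simp add: e_def)
    define W where "W = C1_nbhd A f ?c ?d {y} e \<inter> Diff1 A"
    have fy: "f ` {y} \<subseteq> fst ?d" using d(2) by simp
    have W: "openin (Diff1_topology A) W" "f \<in> W"
      unfolding W_def using openin_C1_nbhd[OF C1 c(1) d(1) _ _ fy e] mem_C1_nbhd[OF C1 fy e] f c(2) by auto
    have "Jac A G g y \<in> U" if g: "g \<in> W" for g
    proof -
      have gD: "g \<in> Diff1 A" and gy: "g y \<in> fst ?d" and g1: "norm (snd ?d (g y) - snd ?d (f y)) < e"
        and g2: "onorm (\<lambda>v. local_deriv ?c ?d g y v - local_deriv ?c ?d f y v) < e"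
        using g by (auto simp: W_def C1_nbhd_def)
      define z where "z = (snd ?d (g y), matrix (local_deriv ?c ?d g y))"
      let ?T = "\<lambda>v. local_deriv ?c ?d g y v - local_deriv ?c ?d f y v"
      have blT: "bounded_linear ?T"
        using local_rep_has_derivative[OF C1_diff_map[OF Diff1D(2)[OF gD]] c(1) d(1) c(2) gy]
          local_rep_has_derivative[OF C1_diff_map[OF C1] c(1) d(1) c(2) d(2)]
        by (intro bounded_linear_sub has_derivative_bounded_linear)
      have ent: "\<bar>(snd z - snd z0) $ i $ j\<bar> \<le> e" for i j
      proof -
        have "\<bar>(snd z - snd z0) $ i $ j\<bar> = \<bar>?T (axis j 1) $ i\<bar>" by (simp add: z_def z0_def matrix_def)
        also have "\<dots> \<le> norm (?T (axis j 1))" by (rule component_le_norm_cart)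
        also have "\<dots> \<le> onorm ?T * norm (axis j (1::real))" by (rule onorm[OF blT])
        finally show ?thesis using g2 by simp
      qed
      have "dist z z0 = norm (z - z0)" by (rule dist_norm)
      also have "\<dots> \<le> norm (fst (z - z0)) + norm (snd (z - z0))" by (metis norm_Pair_le prod.collapse)
      also have "\<dots> \<le> e + real CARD('n) * (real CARD('n) * e)"
        using g1 norm_matrix_le[of "snd z - snd z0" e, OF ent] by (intro add_mono) (auto simp: z_def z0_def)
      also have "\<dots> = k * e" by (simp add: k_def algebra_simps)
      also have "\<dots> = \<delta> / 2" using k by (simp add: e_def)
      also have "\<dots> < \<delta>" using \<delta>(1) by simp
      finally have "z \<noteq> z0 \<longrightarrow> H z \<in> U" using spec[OF \<delta>(2), of z] by blast
      then have "H z \<in> U" using \<open>H z0 \<in> U\<close> by (cases "z = z0") simp_all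
      then show ?thesis using JH[OF gD gy] by (simp add: z_def)
    qed
    then have "W \<subseteq> {f \<in> Diff1 A. Jac A G f y \<in> U}" by (auto simp: W_def)
    then show "\<exists>W. openin (Diff1_topology A) W \<and> f \<in> W \<and> W \<subseteq> {f \<in> Diff1 A. Jac A G f y \<in> U}"
      using W by blast
  qed
  then show ?thesis by (simp add: continuous_map_def topspace_Diff1)
qed

text \<open>Evaluation and Jacobian are continuous in the map and in the point separately.\<close>

lemma random_maps_Diff1:
  assumes "prob_space m" "sets m = sets borel"
    and "\<forall>f\<in>Diff1 A. \<forall>q\<in>borel_measurable borel. (\<integral>\<^sup>+y. q (f y) * ennreal (Jac A G f y) \<partial>m) \<le> (\<integral>\<^sup>+y. q y \<partial>m)"
  shows "random_maps (borel_of (Diff1_topology A)) m (Jac A G)"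
proof (unfold random_maps_def, intro conjI allI impI)
  let ?X = "borel_of (Diff1_topology A)"
  have sp: "space ?X = Diff1 A" by (simp add: borel_of_space topspace_Diff1)
  show "prob_space m" "sets m = sets borel" by fact+
  have "(\<lambda>(f, y). Jac A G f y) \<in> borel_measurable (?X \<Otimes>\<^sub>M borel)"
  proof (rule measurable_separately_continuous[OF compact_manifold])
    show "(\<lambda>f. Jac A G f y) \<in> borel_measurable ?X" for y
      by (rule measurable_continuous_map[OF continuous_map_Jac refl])
    show "continuous_on UNIV (Jac A G f)" if "f \<in> space ?X" for f
      using that continuous_Jac[OF Diff1D(2)] by (simp add: sp)
  qed
  then show "(\<lambda>p. Jac A G (fst p) (snd p)) \<in> borel_measurable (?X \<Otimes>\<^sub>M borel)" by (simp add: case_prod_beta')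
  show "(\<lambda>p. fst p (snd p)) \<in> measurable (?X \<Otimes>\<^sub>M borel) borel"
  proof (rule measurable_if_continuous_tests[OF compact_manifold])
    fix \<phi> :: "'m \<Rightarrow> real" assume \<phi>: "continuous_on UNIV \<phi>"
    have "(\<lambda>(f, y). \<phi> (f y)) \<in> borel_measurable (?X \<Otimes>\<^sub>M borel)"
    proof (rule measurable_separately_continuous[OF compact_manifold])
      show "(\<lambda>f. \<phi> (f y)) \<in> borel_measurable ?X" for y
        by (rule measurable_continuous_map[OF continuous_map_sup_Lipschitz[OF uniform_evaluation_Diff1 \<phi>, where C=1] refl]) simp
      show "continuous_on UNIV (\<lambda>y. \<phi> (f y))" if "f \<in> space ?X" for f
      proof -
        have "continuous_on UNIV f" using Diff1D(2)[of f] that by (simp add: sp C1_map_def)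
        then show ?thesis by (rule continuous_on_compose2[OF \<phi>]) simp
      qed
    qed
    then show "(\<lambda>p. \<phi> (fst p (snd p))) \<in> borel_measurable (?X \<Otimes>\<^sub>M borel)" by (simp add: case_prod_beta')
  qed
  show "Jac A G f y > 0" if "f \<in> space ?X" for f y using that Jac_pos by (simp add: sp)
  show "(\<integral>\<^sup>+y. q (f y) * ennreal (Jac A G f y) \<partial>m) \<le> (\<integral>\<^sup>+y. q y \<partial>m)"
    if "f \<in> space ?X" "q \<in> borel_measurable borel" for f q
    using assms(3) that by (simp add: sp)
qed

end

section \<open>Growth of the maximal contraction\<close>

text \<open>A supremum over a countable dense set is measurable in a parameter, while the points of a
  manifold are too many.\<close>

lemma cSup_dense:
  fixes h :: "'a::topological_space \<Rightarrow> real"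
  assumes h: "continuous_on UNIV h" and bdd: "bdd_above (range h)"
    and D: "\<And>S. open S \<Longrightarrow> S \<noteq> {} \<Longrightarrow> \<exists>d\<in>D. d \<in> S" and "D \<noteq> {}"
  shows "(SUP x. h x) = (SUP x\<in>D. h x)"
proof (rule antisym)
  have bddD: "bdd_above (h ` D)" by (rule bdd_above_mono[OF bdd]) auto
  show "(SUP x. h x) \<le> (SUP x\<in>D. h x)"
  proof (rule cSUP_least)
    fix x
    show "h x \<le> (SUP x\<in>D. h x)"
    proof (rule ccontr)
      assume "\<not> h x \<le> (SUP x\<in>D. h x)"
      then have "x \<in> {y. (SUP x\<in>D. h x) < h y}" by simp
      moreover have "open {y. (SUP x\<in>D. h x) < h y}" by (intro open_Collect_less h continuous_on_const)
      ultimately obtain d where "d \<in> D" "(SUP x\<in>D. h x) < h d" using D[of "{y. (SUP x\<in>D. h x) < h y}"] by blast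
      then show False using cSUP_upper[OF _ bddD, of d] by simp
    qed
  qed simp
  show "(SUP x\<in>D. h x) \<le> (SUP x. h x)"
    by (rule cSUP_subset_mono[OF \<open>D \<noteq> {}\<close> bdd]) auto
qed

context closed_riemannian
begin

lemma diff_map_rand_comp: "(\<And>k. k < n \<Longrightarrow> \<omega> k \<in> Diff1 A) \<Longrightarrow> diff_map (rand_comp n \<omega>)"
proof (induction n)
  case (Suc n)
  show ?case unfolding rand_comp.simps
    by (rule diff_map_comp[OF Suc.IH C1_diff_map[OF Diff1D(2)]]) (use Suc.prems in auto)
qed (simp add: diff_map_id)

lemma Jac_rand_comp:
  "(\<And>k. k < n \<Longrightarrow> \<omega> k \<in> Diff1 A) \<Longrightarrow> Jac A G (rand_comp n \<omega>) p = (\<Prod>k<n. Jac A G (\<omega> k) (rand_comp k \<omega> p))"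
proof (induction n)
  case (Suc n)
  have "Jac A G (\<omega> n \<circ> rand_comp n \<omega>) p = Jac A G (\<omega> n) (rand_comp n \<omega> p) * Jac A G (rand_comp n \<omega>) p"
    by (rule Jac_chain[OF diff_map_rand_comp C1_diff_map[OF Diff1D(2)]]) (use Suc.prems in auto)
  moreover have "Jac A G (rand_comp n \<omega>) p = (\<Prod>k<n. Jac A G (\<omega> k) (rand_comp k \<omega> p))"
    by (rule Suc.IH) (use Suc.prems in auto)
  ultimately show ?case unfolding rand_comp.simps prod.lessThan_Suc by (simp only: mult.commute)
qed (simp add: Jac_id)

lemma max_contraction_upper: "f \<in> Diff1 A \<Longrightarrow> inverse (Jac A G f p) \<le> max_contraction A G f"
  unfolding max_contraction_def by (rule cSUP_upper[OF _ inverse_Jac_bounded]) auto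

lemma max_contraction_pos: "f \<in> Diff1 A \<Longrightarrow> max_contraction A G f > 0"
  by (rule less_le_trans[OF positive_imp_inverse_positive[OF Jac_pos] max_contraction_upper])

lemma inverse_Jac_rand_comp:
  assumes "\<And>k. k < n \<Longrightarrow> \<omega> k \<in> Diff1 A"
  shows "inverse (Jac A G (rand_comp n \<omega>) p) \<le> (\<Prod>k<n. max_contraction A G (\<omega> k))"
proof -
  have "inverse (Jac A G (rand_comp n \<omega>) p) = (\<Prod>k<n. inverse (Jac A G (\<omega> k) (rand_comp k \<omega> p)))"
    using Jac_rand_comp[of n \<omega> p, OF assms] by (simp add: prod_inversef[symmetric] comp_def)
  also have "\<dots> \<le> (\<Prod>k<n. max_contraction A G (\<omega> k))"
  proof (rule prod_mono)
  fix k assume "k \<in> {..<n}"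
  then have k: "\<omega> k \<in> Diff1 A" using assms by simp
  show "0 \<le> inverse (Jac A G (\<omega> k) (rand_comp k \<omega> p)) \<and> inverse (Jac A G (\<omega> k) (rand_comp k \<omega> p)) \<le> max_contraction A G (\<omega> k)"
    using max_contraction_upper[OF k] Jac_pos[OF k, of "rand_comp k \<omega> p"] by simp
  qed
  finally show ?thesis .
qed

lemma max_contraction_rand_comp:
  assumes "\<And>k. k < n \<Longrightarrow> \<omega> k \<in> Diff1 A"
  shows "bdd_above (range (\<lambda>p. inverse (Jac A G (rand_comp n \<omega>) p)))"
    and "inverse (Jac A G (rand_comp n \<omega>) p) \<le> max_contraction A G (rand_comp n \<omega>)"
    and "max_contraction A G (rand_comp n \<omega>) \<le> (\<Prod>k<n. max_contraction A G (\<omega> k))"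
proof -
  show b: "bdd_above (range (\<lambda>p. inverse (Jac A G (rand_comp n \<omega>) p)))"
    using inverse_Jac_rand_comp[OF assms] by (intro bdd_aboveI2)
  show "inverse (Jac A G (rand_comp n \<omega>) p) \<le> max_contraction A G (rand_comp n \<omega>)"
    unfolding max_contraction_def by (rule cSUP_upper[OF _ b]) simp
  show "max_contraction A G (rand_comp n \<omega>) \<le> (\<Prod>k<n. max_contraction A G (\<omega> k))"
    unfolding max_contraction_def[of A G "rand_comp n \<omega>"]
    by (rule cSUP_least) (use inverse_Jac_rand_comp[OF assms] in auto)
qed

lemma continuous_inverse_Jac_rand_comp:
  assumes "\<And>k. k < n \<Longrightarrow> \<omega> k \<in> Diff1 A"
  shows "continuous_on UNIV (\<lambda>p. inverse (Jac A G (rand_comp n \<omega>) p))"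
proof -
  have "continuous_on UNIV (\<lambda>p. Jac A G (\<omega> k) (rand_comp k \<omega> p))" if k: "k < n" for k
  proof (rule continuous_on_compose2[OF continuous_Jac[OF Diff1D(2)[OF assms[OF k]]]])
    show "continuous_on UNIV (rand_comp k \<omega>)"
      by (rule diff_map_cont[OF diff_map_rand_comp]) (use assms k in auto)
  qed simp
  then have "continuous_on UNIV (\<lambda>p. \<Prod>k<n. Jac A G (\<omega> k) (rand_comp k \<omega> p))"
    by (intro continuous_on_prod) simp
  moreover have "(\<Prod>k<n. Jac A G (\<omega> k) (rand_comp k \<omega> p)) \<noteq> 0" for p
  proof -
    have "(\<Prod>k<n. Jac A G (\<omega> k) (rand_comp k \<omega> p)) > 0" by (rule prod_pos) (use assms Jac_pos in auto)
    then show ?thesis by (rule less_imp_neq[THEN not_sym])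
  qed
  ultimately have "continuous_on UNIV (\<lambda>p. inverse (\<Prod>k<n. Jac A G (\<omega> k) (rand_comp k \<omega> p)))"
    by (intro continuous_on_inverse ballI)
  then show ?thesis by (simp only: Jac_rand_comp[of n \<omega>, OF assms])
qed

text \<open>Integrability of the logarithm follows from
  \<open>1 \<le> N \<omega> \<le> (\<Prod>k<n. max_contraction A G (\<omega> k))\<close>.\<close>

lemma expected_growth:
  fixes \<mu> :: "nat \<Rightarrow> ('m \<Rightarrow> 'm) measure"
  assumes \<mu>: "\<And>i. \<mu> i \<in> borel_prob_measures (Diff1_topology A)"
    and log: "\<And>i. integrable (\<mu> i) (\<lambda>f. ln (max_contraction A G f))"
    and gap: "\<And>i \<nu>. prob_space \<nu> \<Longrightarrow> sets \<nu> = sets borel \<Longrightarrow>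
      \<exists>\<phi>. continuous_on UNIV \<phi> \<and> (\<forall>x. \<phi> x \<in> {0..1}) \<and> spread (\<mu> i) \<nu> \<phi> \<ge> 8 * h"
  shows "(\<integral>\<omega>. ln (max_contraction A G (rand_comp n \<omega>)) \<partial>Pi\<^sub>M {..<n} \<mu>) \<ge> real n * h"
    and "(\<lambda>\<omega>. ln (max_contraction A G (rand_comp n \<omega>))) \<in> borel_measurable (Pi\<^sub>M {..<n} \<mu>)"
proof -
  let ?X = "borel_of (Diff1_topology A)"
  have pm: "prob_space (\<mu> i)" "sets (\<mu> i) = sets ?X" for i
    using \<mu>[of i] by (simp_all add: borel_prob_measures_def)
  have sp: "space (\<mu> i) = Diff1 A" for i
    using sets_eq_imp_space_eq[OF pm(2)[of i]] by (simp add: borel_of_space topspace_Diff1)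
  from normalized_volume_exists obtain m :: "'m measure" where m: "prob_space m" "sets m = sets borel"
    "\<forall>f\<in>Diff1 A. \<forall>q\<in>borel_measurable borel. (\<integral>\<^sup>+y. q (f y) * ennreal (Jac A G f y) \<partial>m) \<le> (\<integral>\<^sup>+y. q y \<partial>m)"
    by (elim exE conjE)
  interpret R: random_maps ?X m "Jac A G" by (rule random_maps_Diff1[OF m])
  define S where "S = Pi\<^sub>M {..<n} \<mu>"
  define N where "N \<omega> = max_contraction A G (rand_comp n \<omega>)" for \<omega>
  have probS: "prob_space S" unfolding S_def by (rule prob_space_PiM, rule pm(1))
  interpret S: prob_space S by fact
  have inD: "\<omega> k \<in> Diff1 A" if "\<omega> \<in> space S" "k < n" for \<omega> k
    using that unfolding S_def by (auto simp: space_PiM sp PiE_iff)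
  have JN: "R.J_comp n \<omega> x = Jac A G (rand_comp n \<omega>) x" if "\<omega> \<in> space S" for \<omega> x
    using Jac_rand_comp[of n \<omega> x] inD[OF that] by (simp add: R.J_comp_def)
  have Jpos: "R.J_comp n \<omega> x > 0" if "\<omega> \<in> space S" for \<omega> x
    by (rule R.J_comp_pos) (use inD[OF that] in \<open>simp add: borel_of_space topspace_Diff1\<close>)
  have NJ: "inverse (R.J_comp n \<omega> x) \<le> N \<omega>" if "\<omega> \<in> space S" for \<omega> x
    unfolding N_def JN[OF that] by (rule max_contraction_rand_comp(2)[OF inD[OF that]])
  have Npos: "N \<omega> > 0" if "\<omega> \<in> space S" for \<omega>
    by (rule less_le_trans[OF positive_imp_inverse_positive[OF Jpos[OF that]] NJ[OF that]])
  have N1: "N \<omega> \<ge> 1" if \<omega>: "\<omega> \<in> space S" for \<omega>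
  proof -
    have "inverse (N \<omega>) \<le> 1"
    proof (rule R.J_comp_lower_bound)
      show "\<omega> k \<in> space ?X" if "k < n" for k using inD[OF \<omega> that] by (simp add: borel_of_space topspace_Diff1)
      show "inverse (N \<omega>) \<le> R.J_comp n \<omega> x" for x
        using le_imp_inverse_le[OF NJ[OF \<omega>, of x]] Jpos[OF \<omega>, of x] by simp
    qed
    then show ?thesis using Npos[OF \<omega>] by (simp add: field_simps)
  qed
  have Nm: "N \<in> borel_measurable S"
  proof -
    from countable_dense_exists[where 'a='m] obtain D :: "'m set"
      where D: "countable D" "\<forall>S. open S \<longrightarrow> S \<noteq> {} \<longrightarrow> (\<exists>d\<in>D. d \<in> S)" by (elim exE conjE)
    have "D \<noteq> {}" using D(2)[rule_format, of UNIV] by auto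
    have bdd: "bdd_above (range (\<lambda>p. inverse (R.J_comp n \<omega> p)))" if "\<omega> \<in> space S" for \<omega>
      unfolding JN[OF that] by (rule max_contraction_rand_comp(1)[OF inD[OF that]])
    have N_eq: "N \<omega> = (SUP p\<in>D. inverse (R.J_comp n \<omega> p))" if \<omega>: "\<omega> \<in> space S" for \<omega>
    proof -
      have "N \<omega> = (SUP p. inverse (R.J_comp n \<omega> p))" unfolding N_def max_contraction_def JN[OF \<omega>] ..
      also have "\<dots> = (SUP p\<in>D. inverse (R.J_comp n \<omega> p))"
      proof (rule cSup_dense[OF _ bdd[OF \<omega>] _ \<open>D \<noteq> {}\<close>])
        show "continuous_on UNIV (\<lambda>p. inverse (R.J_comp n \<omega> p))"
          unfolding JN[OF \<omega>] by (rule continuous_inverse_Jac_rand_comp[OF inD[OF \<omega>]])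
      qed (use D(2) in simp)
      finally show ?thesis .
    qed
    have "(\<lambda>\<omega>. SUP p\<in>D. inverse (R.J_comp n \<omega> p)) \<in> borel_measurable S"
    proof (rule borel_measurable_cSUP[OF D(1)])
      fix p
      have jm: "(\<lambda>q. R.J_comp n (fst q) (snd q)) \<in> borel_measurable (S \<Otimes>\<^sub>M borel)"
        unfolding S_def by (rule R.J_comp_measurable) (simp_all add: pm(2))
      have "(\<lambda>\<omega>. R.J_comp n \<omega> p) \<in> borel_measurable S"
        using measurable_compose[OF measurable_Pair2' jm, of p] by simp
      then show "(\<lambda>\<omega>. inverse (R.J_comp n \<omega> p)) \<in> borel_measurable S" by measurable
    next
      fix \<omega> assume "\<omega> \<in> space S"
      from bdd[OF this] show "bdd_above ((\<lambda>p. inverse (R.J_comp n \<omega> p)) ` D)"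
        by (rule bdd_above_mono) auto
    qed
    then show ?thesis using N_eq by (simp cong: measurable_cong)
  qed
  show lm: "(\<lambda>\<omega>. ln (max_contraction A G (rand_comp n \<omega>))) \<in> borel_measurable (Pi\<^sub>M {..<n} \<mu>)"
    using Nm unfolding S_def N_def by measurable
  interpret PP: product_prob_space \<mu> "{..<n}"
    by (simp add: product_prob_space_def product_prob_space_axioms_def product_sigma_finite_def pm(1) prob_space_imp_sigma_finite)
  have int: "integrable S (\<lambda>\<omega>. ln (N \<omega>))"
  proof (rule Bochner_Integration.integrable_bound)
    have "integrable S (\<lambda>\<omega>. ln (max_contraction A G (\<omega> k)))" if "k < n" for k
    proof -
      have c: "(\<lambda>\<omega>. \<omega> k) \<in> measurable S (\<mu> k)" unfolding S_def by (rule measurable_component_singleton) (use that in simp)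
      have d: "distr S (\<mu> k) (\<lambda>\<omega>. \<omega> k) = \<mu> k" unfolding S_def by (rule PP.PiM_component) (use that in simp)
      have "integrable (distr S (\<mu> k) (\<lambda>\<omega>. \<omega> k)) (\<lambda>f. ln (max_contraction A G f))"
        unfolding d by (rule log)
      from integrable_distr[OF c this] show ?thesis .
    qed
    then show "integrable S (\<lambda>\<omega>. \<Sum>k<n. ln (max_contraction A G (\<omega> k)))" by (intro Bochner_Integration.integrable_sum) simp
    show "(\<lambda>\<omega>. ln (N \<omega>)) \<in> borel_measurable S" using Nm by measurable
    show "AE \<omega> in S. norm (ln (N \<omega>)) \<le> norm (\<Sum>k<n. ln (max_contraction A G (\<omega> k)))"
    proof (rule AE_I2)
      fix \<omega> assume \<omega>: "\<omega> \<in> space S"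
      have pos: "max_contraction A G (\<omega> k) > 0" if "k < n" for k by (rule max_contraction_pos[OF inD[OF \<omega> that]])
      have "N \<omega> \<le> (\<Prod>k<n. max_contraction A G (\<omega> k))"
        unfolding N_def by (rule max_contraction_rand_comp(3)[OF inD[OF \<omega>]])
      then have "ln (N \<omega>) \<le> ln (\<Prod>k<n. max_contraction A G (\<omega> k))"
        using Npos[OF \<omega>] by (metis ln_mono)
      also have "\<dots> = (\<Sum>k<n. ln (max_contraction A G (\<omega> k)))"
        by (rule ln_prod) (use pos in \<open>auto simp: less_le\<close>)
      finally have "ln (N \<omega>) \<le> (\<Sum>k<n. ln (max_contraction A G (\<omega> k)))" .
      moreover have "ln (N \<omega>) \<ge> 0" using N1[OF \<omega>] by simp
      ultimately show "norm (ln (N \<omega>)) \<le> norm (\<Sum>k<n. ln (max_contraction A G (\<omega> k)))" by simp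
    qed
  qed
  have "(\<integral>\<omega>. ln (N \<omega>) \<partial>Pi\<^sub>M {..<n} \<mu>) \<ge> real n * h"
  proof (rule R.expected_log_growth[OF pm])
    fix i and \<nu> :: "'m measure" assume "prob_space \<nu>" "sets \<nu> = sets borel"
    from gap[OF this, of i] obtain \<phi> where \<phi>: "continuous_on UNIV \<phi>" "\<forall>x. \<phi> x \<in> {0..1}" "spread (\<mu> i) \<nu> \<phi> \<ge> 8 * h"
      by (elim exE conjE)
    then show "\<exists>\<phi>. \<phi> \<in> borel_measurable borel \<and> (\<forall>x. \<phi> x \<in> {0..1}) \<and> spread (\<mu> i) \<nu> \<phi> \<ge> 8 * h"
      by (intro exI[of _ \<phi>]) (simp add: borel_measurable_continuous_onI)
  qed (use Npos NJ int in \<open>auto simp: S_def\<close>)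
  then show "(\<integral>\<omega>. ln (max_contraction A G (rand_comp n \<omega>)) \<partial>Pi\<^sub>M {..<n} \<mu>) \<ge> real n * h" by (simp add: N_def)
qed

end

theorem theorem1p6:
  fixes A :: "('m::{t2_space, second_countable_topology}, 'n::finite) chart set"
    and G :: "('m, 'n) chart \<Rightarrow> 'm \<Rightarrow> real^'n^'n"
    and K :: "('m \<Rightarrow> 'm) measure set"
  assumes manifold: "closed_riemannian_manifold A G"
    and compact_K: "compactin (weak_topology (Diff1_topology A)) K"
    and log_moment: "\<And>\<mu>. \<mu> \<in> K \<Longrightarrow> integrable \<mu> (\<lambda>f. ln (max_contraction A G f))"
    and measures: "\<And>\<mu>. \<mu> \<in> K \<Longrightarrow>
      \<not> (\<exists>\<nu>1 \<nu>2 :: 'm measure. prob_space \<nu>1 \<and> sets \<nu>1 = sets borel \<and>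
           prob_space \<nu>2 \<and> sets \<nu>2 = sets borel \<and> (AE f in \<mu>. distr \<nu>1 borel f = \<nu>2))"
  shows "\<exists>h::real. h > 0 \<and>
    (\<forall>(n::nat) \<mu>. (\<forall>i<n. \<mu> i \<in> K) \<longrightarrow>
       (\<integral>\<omega>. ln (max_contraction A G (rand_comp n \<omega>)) \<partial>(Pi\<^sub>M {..<n} \<mu>)) \<ge> real n * h) \<and>
    (\<forall>\<mu> :: nat \<Rightarrow> ('m \<Rightarrow> 'm) measure. (\<forall>i. \<mu> i \<in> K) \<longrightarrow>
       liminf (\<lambda>n. ereal (1 / real n *
         (\<integral>\<omega>. ln (max_contraction A G (rand_comp n \<omega>)) \<partial>(Pi\<^sub>M UNIV \<mu>)))) \<ge> ereal h)"
proof -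
  interpret closed_riemannian A G by standard (rule manifold)
  have KB: "\<mu> \<in> borel_prob_measures (Diff1_topology A)" if "\<mu> \<in> K" for \<mu>
    using compactin_subset_topspace[OF compact_K] topspace_weak_topology_subset that by blast
  have "\<exists>e>0. \<forall>\<mu>\<in>K. \<forall>\<nu>. prob_space \<nu> \<longrightarrow> sets \<nu> = sets borel \<longrightarrow>
    (\<exists>\<phi>. continuous_on UNIV \<phi> \<and> (\<forall>x. \<phi> x \<in> {0..1}) \<and> spread \<mu> \<nu> \<phi> \<ge> e)"
    by (rule uniform_spread[OF compact_manifold uniform_evaluation_Diff1 compact_K measures])
  then obtain e where e: "e > 0" and gap: "\<forall>\<mu>\<in>K. \<forall>\<nu>. prob_space \<nu> \<longrightarrow> sets \<nu> = sets borel \<longrightarrow>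
    (\<exists>\<phi>. continuous_on UNIV \<phi> \<and> (\<forall>x. \<phi> x \<in> {0..1}) \<and> spread \<mu> \<nu> \<phi> \<ge> e)"
    by (elim exE conjE)
  define h where "h = e / 8"
  have h: "h > 0" using e by (simp add: h_def)
  have gap': "\<exists>\<phi>. continuous_on UNIV \<phi> \<and> (\<forall>x. \<phi> x \<in> {0..1}) \<and> spread \<mu> \<nu> \<phi> \<ge> 8 * h"
    if "\<mu> \<in> K" "prob_space \<nu>" "sets \<nu> = sets borel" for \<mu> \<nu>
    using gap[rule_format, OF that] by (simp add: h_def)
  have all: "(\<integral>\<omega>. ln (max_contraction A G (rand_comp n \<omega>)) \<partial>Pi\<^sub>M {..<n} \<mu>) \<ge> real n * h"
      "(\<lambda>\<omega>. ln (max_contraction A G (rand_comp n \<omega>))) \<in> borel_measurable (Pi\<^sub>M {..<n} \<mu>)"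
    if "\<And>i. \<mu> i \<in> K" for \<mu> n
    by (rule expected_growth[OF KB[OF that] log_moment[OF that] gap'[OF that]], assumption+)+
  have finite: "(\<integral>\<omega>. ln (max_contraction A G (rand_comp n \<omega>)) \<partial>Pi\<^sub>M {..<n} \<mu>) \<ge> real n * h"
    if \<mu>: "\<forall>i<n. \<mu> i \<in> K" for n \<mu>
  proof (cases "n = 0")
    case True
    then show ?thesis by (simp add: max_contraction_def Jac_id)
  next
    case False
    \<comment> \<open>All coordinates must be probability measures from \<open>K\<close>, also those beyond \<open>n\<close>.\<close>
    define \<mu>' where "\<mu>' i = (if i < n then \<mu> i else \<mu> 0)" for i
    have "\<mu>' i \<in> K" for i using \<mu> False by (simp add: \<mu>'_def)
    from all(1)[of \<mu>', OF this]
    have "(\<integral>\<omega>. ln (max_contraction A G (rand_comp n \<omega>)) \<partial>Pi\<^sub>M {..<n} \<mu>') \<ge> real n * h" .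
    moreover have "Pi\<^sub>M {..<n} \<mu>' = Pi\<^sub>M {..<n} \<mu>" by (rule PiM_cong) (simp_all add: \<mu>'_def)
    ultimately show ?thesis by simp
  qed
  have infinite: "liminf (\<lambda>n. ereal (1 / real n *
         (\<integral>\<omega>. ln (max_contraction A G (rand_comp n \<omega>)) \<partial>(Pi\<^sub>M UNIV \<mu>)))) \<ge> ereal h"
    if \<mu>: "\<forall>i. \<mu> i \<in> K" for \<mu> :: "nat \<Rightarrow> ('m \<Rightarrow> 'm) measure"
  proof (rule Liminf_bounded)
    have prob: "prob_space (\<mu> i)" for i using KB \<mu> by (simp add: borel_prob_measures_def)
    interpret PP: product_prob_space \<mu> UNIV
      by (simp add: product_prob_space_def product_prob_space_axioms_def product_sigma_finite_def prob prob_space_imp_sigma_finite)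
    have "ereal h \<le> ereal (1 / real n * (\<integral>\<omega>. ln (max_contraction A G (rand_comp n \<omega>)) \<partial>(Pi\<^sub>M UNIV \<mu>)))"
      if n: "n > 0" for n
    proof -
      let ?f = "\<lambda>\<omega>. ln (max_contraction A G (rand_comp n \<omega>))"
      have restr: "?f (restrict \<omega> {..<n}) = ?f \<omega>" for \<omega>
        using rand_comp_cong[of n "restrict \<omega> {..<n}" \<omega>] by simp
      have "(\<integral>\<omega>. ?f \<omega> \<partial>Pi\<^sub>M {..<n} \<mu>) = (\<integral>\<omega>. ?f \<omega> \<partial>distr (Pi\<^sub>M UNIV \<mu>) (Pi\<^sub>M {..<n} \<mu>) (\<lambda>\<omega>. restrict \<omega> {..<n}))"
        by (subst PP.distr_PiM_restrict_finite) auto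
      also have "\<dots> = (\<integral>\<omega>. ?f (restrict \<omega> {..<n}) \<partial>Pi\<^sub>M UNIV \<mu>)"
        by (rule integral_distr[OF measurable_restrict_subset all(2)]) (use \<mu> in auto)
      also have "\<dots> = (\<integral>\<omega>. ?f \<omega> \<partial>Pi\<^sub>M UNIV \<mu>)" by (simp only: restr)
      finally have "(\<integral>\<omega>. ?f \<omega> \<partial>Pi\<^sub>M UNIV \<mu>) \<ge> real n * h" using all(1)[of \<mu> n] \<mu> by simp
      then show ?thesis using n by (simp add: field_simps)
    qed
    then show "\<forall>\<^sub>F n in sequentially. ereal h \<le> ereal (1 / real n *
         (\<integral>\<omega>. ln (max_contraction A G (rand_comp n \<omega>)) \<partial>(Pi\<^sub>M UNIV \<mu>)))"
      unfolding eventually_at_top_dense by blast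
  qed
  show ?thesis using h finite infinite by blast
qed

end
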